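(* Let $M$ and $N$ be Riemannian manifolds, let $\alpha\in(1/2,1]$, let $x\in\mathcal{C}^{\alpha}([0,T],M)$ be an $\alpha$-Hölder continuous path and let $F:M\to N$ be a smooth function. Then $$dF(x_t)=DF(x_t)\,dx_t,$$ meaning that for every $1$-form $\beta$ on $N$ and every $t\in[0,T]$, $$\int_0^t\beta\ dF(x_s)=\int_0^t (F^*\beta)\ dx_s ,$$ where $F^*\beta$ is the pull-back of $\beta$ by $F$. In particular, if $N$ is a Euclidean space, then for every $t\in[0,T]$, $$F(x_t)=F(x_0)+\int_0^t DF(x_s)\,dx_s .$$
   Context: A curve $\sigma:[0,T]\to M$ in a Riemannian manifold is $\alpha$-Hölder continuous if there is $C>0$ with $d(\sigma(t),\sigma(s))\le C|t-s|^\alpha$ for all $s,t\in[0,T]$, where $d$ is the Riemannian distance; $\mathcal{C}^\alpha([0,T],M)$ is the set of such curves. Integration of $1$-forms: let $\beta$ be a real (smooth) $1$-form on a manifold $N$ and $x:[0,T]\to N$ an $\alpha$-Hölder path. In a chart $(U,(y^1,\dots,y^n))$ with $\beta=\sum_i\beta_i\,dy^i$, the integral of $\beta$ along $x$ is defined by $$\int_0^T\beta\,dx_t=\sum_{i=1}^n\int_0^T\beta_i(x_t)\,dx^i_t,$$ where the integrals on the right are Riemann–Stieltjes (Young) integrals with respect to the $i$-th coordinate of the path; this does not depend on the chart, and when the path is not contained in one chart one subdivides the time interval and adds up. For a smooth $F=(F^1,\dots,F^q):M\to\mathbb{R}^q$, $\int_0^tDF(x_s)\,dx_s$ is the vector whose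 $j$-th entry is the integral of the $1$-form $dF^j$ along $x$. *)

theory Defs
  imports "HOL-Analysis.Analysis"
begin

section \<open>Smooth functions on open subsets of Euclidean space\<close>

text \<open>Only meant for open sets: the derivatives are two-sided. All directions \<open>v\<close> are
  used, which in finite dimension is the same as all partial derivatives.\<close>

primrec Ck_on :: "nat \<Rightarrow> ('e::euclidean_space \<Rightarrow> 'f::real_normed_vector) \<Rightarrow> 'e set \<Rightarrow> bool" where
  "Ck_on 0 f S \<longleftrightarrow> continuous_on S f"
| "Ck_on (Suc k) f S \<longleftrightarrow>
     (\<forall>y\<in>S. f differentiable (at y)) \<and> (\<forall>v. Ck_on k (\<lambda>y. frechet_derivative f (at y) v) S)"

definition smooth_on :: "('e::euclidean_space \<Rightarrow> 'f::real_normed_vector) \<Rightarrow> 'e set \<Rightarrow> bool" where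
  "smooth_on f S \<longleftrightarrow> (\<forall>k. Ck_on k f S)"


section \<open>Smooth manifolds\<close>

text \<open>A chart is a pair \<open>(U, \<phi>)\<close>, where the values of \<open>\<phi>\<close> outside \<open>U\<close> are irrelevant.
  The atlas need not be maximal; a maximal atlas is allowed.\<close>

record ('a, 'e) manifold =
  mfd_top :: "'a topology"
  atlas :: "('a set \<times> ('a \<Rightarrow> 'e)) set"

abbreviation points :: "('a, 'e) manifold \<Rightarrow> 'a set" where
  "points M \<equiv> topspace (mfd_top M)"

definition smooth_manifold :: "('a, 'e::euclidean_space) manifold \<Rightarrow> bool" where
  "smooth_manifold M \<longleftrightarrow>
     Hausdorff_space (mfd_top M) \<and> second_countable (mfd_top M) \<and>
     (\<forall>(U, \<phi>)\<in>atlas M. openin (mfd_top M) U \<and> open (\<phi> ` U) \<and>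
        homeomorphic_map (subtopology (mfd_top M) U) (top_of_set (\<phi> ` U)) \<phi>) \<and>
     (\<Union>(U, \<phi>)\<in>atlas M. U) = points M \<and>
     (\<forall>(U, \<phi>)\<in>atlas M. \<forall>(V, \<psi>)\<in>atlas M. smooth_on (\<psi> \<circ> inv_into U \<phi>) (\<phi> ` (U \<inter> V)))"

definition euclidean_manifold :: "('f::euclidean_space, 'f) manifold" where
  "euclidean_manifold = \<lparr>mfd_top = euclidean, atlas = {(UNIV, id)}\<rparr>"

definition smooth_map ::
  "('a, 'm::euclidean_space) manifold \<Rightarrow> ('b, 'n::euclidean_space) manifold \<Rightarrow> ('a \<Rightarrow> 'b) \<Rightarrow> bool" where
  "smooth_map M N F \<longleftrightarrow>
     continuous_map (mfd_top M) (mfd_top N) F \<and>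
     (\<forall>(U, \<phi>)\<in>atlas M. \<forall>(V, \<psi>)\<in>atlas N.
        smooth_on (\<psi> \<circ> F \<circ> inv_into U \<phi>) (\<phi> ` (U \<inter> F -` V)))"

definition smooth_near :: "('a, 'e::euclidean_space) manifold \<Rightarrow> 'a \<Rightarrow> ('a \<Rightarrow> real) \<Rightarrow> bool" where
  "smooth_near M p f \<longleftrightarrow>
     (\<exists>W. openin (mfd_top M) W \<and> p \<in> W \<and>
        (\<forall>(U, \<phi>)\<in>atlas M. smooth_on (f \<circ> inv_into U \<phi>) (\<phi> ` (U \<inter> W))))"


section \<open>Tangent vectors and 1-forms\<close>

text \<open>Tangent vectors at \<open>p\<close> are derivations of germs at \<open>p\<close> of smooth functions. As functions
  in HOL are total, a tangent vector is also applied to functions that are not smooth near \<open>p\<close>,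
  and is \<open>0\<close> there. The vector space operations are pointwise.\<close>

type_synonym 'a tangent = "('a \<Rightarrow> real) \<Rightarrow> real"

definition tangent_space :: "('a, 'e::euclidean_space) manifold \<Rightarrow> 'a \<Rightarrow> 'a tangent set" where
  "tangent_space M p = {v.
     (\<forall>f. \<not> smooth_near M p f \<longrightarrow> v f = 0) \<and>
     (\<forall>f g. smooth_near M p f \<and> smooth_near M p g \<longrightarrow>
        v (\<lambda>q. f q + g q) = v f + v g \<and>
        v (\<lambda>q. f q * g q) = v f * g p + f p * v g) \<and>
     (\<forall>f c. smooth_near M p f \<longrightarrow> v (\<lambda>q. c * f q) = c * v f) \<and>
     (\<forall>f g. smooth_near M p f \<and> smooth_near M p g \<and>
        (\<exists>W. openin (mfd_top M) W \<and> p \<in> W \<and> (\<forall>q\<in>W. f q = g q)) \<longrightarrow> v f = v g)}"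

definition coord_vector ::
  "('a, 'e::euclidean_space) manifold \<Rightarrow> 'a set \<times> ('a \<Rightarrow> 'e) \<Rightarrow> 'e \<Rightarrow> 'a \<Rightarrow> 'a tangent" where
  "coord_vector M = (\<lambda>(U, \<phi>) b p f.
     if smooth_near M p f then frechet_derivative (f \<circ> inv_into U \<phi>) (at (\<phi> p)) b else 0)"

definition push_forward ::
  "('b, 'n::euclidean_space) manifold \<Rightarrow> ('a \<Rightarrow> 'b) \<Rightarrow> 'a \<Rightarrow> 'a tangent \<Rightarrow> 'b tangent" where
  "push_forward N F p v = (\<lambda>f. if smooth_near N (F p) f then v (f \<circ> F) else 0)"

type_synonym 'a form = "'a \<Rightarrow> 'a tangent \<Rightarrow> real"

definition one_form :: "('a, 'e::euclidean_space) manifold \<Rightarrow> 'a form \<Rightarrow> bool" where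
  "one_form M \<beta> \<longleftrightarrow>
     (\<forall>p\<in>points M. \<forall>v\<in>tangent_space M p.
        (\<forall>w\<in>tangent_space M p. \<beta> p (\<lambda>f. v f + w f) = \<beta> p v + \<beta> p w) \<and>
        (\<forall>c. \<beta> p (\<lambda>f. c * v f) = c * \<beta> p v)) \<and>
     (\<forall>(U, \<phi>)\<in>atlas M. \<forall>b\<in>Basis.
        smooth_on ((\<lambda>p. \<beta> p (coord_vector M (U, \<phi>) b p)) \<circ> inv_into U \<phi>) (\<phi> ` U))"

definition pull_back ::
  "('b, 'n::euclidean_space) manifold \<Rightarrow> ('a \<Rightarrow> 'b) \<Rightarrow> 'b form \<Rightarrow> 'a form" where
  "pull_back N F \<beta> = (\<lambda>p v. \<beta> (F p) (push_forward N F p v))"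

definition differential :: "('a \<Rightarrow> real) \<Rightarrow> 'a form" where
  "differential f = (\<lambda>p v. v f)"


section \<open>Riemannian metrics, the Riemannian distance and Hoelder curves\<close>

definition riemannian_metric ::
  "('a, 'e::euclidean_space) manifold \<Rightarrow> ('a \<Rightarrow> 'a tangent \<Rightarrow> 'a tangent \<Rightarrow> real) \<Rightarrow> bool" where
  "riemannian_metric M g \<longleftrightarrow>
     (\<forall>p\<in>points M. \<forall>u\<in>tangent_space M p. \<forall>v\<in>tangent_space M p.
        g p u v = g p v u \<and>
        (\<forall>w\<in>tangent_space M p. g p (\<lambda>f. u f + w f) v = g p u v + g p w v) \<and>
        (\<forall>c. g p (\<lambda>f. c * u f) v = c * g p u v) \<and>
        (u \<noteq> (\<lambda>f. 0) \<longrightarrow> g p u u > 0)) \<and>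
     (\<forall>(U, \<phi>)\<in>atlas M. \<forall>b\<in>Basis. \<forall>b'\<in>Basis.
        smooth_on ((\<lambda>p. g p (coord_vector M (U, \<phi>) b p) (coord_vector M (U, \<phi>) b' p)) \<circ> inv_into U \<phi>)
          (\<phi> ` U))"

definition C1_curve :: "('a, 'e::euclidean_space) manifold \<Rightarrow> (real \<Rightarrow> 'a) \<Rightarrow> real \<Rightarrow> real \<Rightarrow> bool" where
  "C1_curve M c a b \<longleftrightarrow>
     continuous_map (top_of_set {a..b}) (mfd_top M) c \<and>
     (\<forall>(U, \<phi>)\<in>atlas M. \<exists>D.
        (\<forall>s\<in>{a..b} \<inter> c -` U. ((\<phi> \<circ> c) has_vector_derivative D s) (at s within {a..b})) \<and>
        continuous_on ({a..b} \<inter> c -` U) D)"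

definition piecewise_C1_curve :: "('a, 'e::euclidean_space) manifold \<Rightarrow> (real \<Rightarrow> 'a) \<Rightarrow> bool" where
  "piecewise_C1_curve M c \<longleftrightarrow>
     continuous_map (top_of_set {0..1}) (mfd_top M) c \<and>
     (\<exists>S. finite S \<and>
        (\<forall>a b. 0 \<le> a \<and> a < b \<and> b \<le> 1 \<and> {a<..<b} \<inter> S = {} \<longrightarrow> C1_curve M c a b))"

definition velocity :: "('a, 'e::euclidean_space) manifold \<Rightarrow> (real \<Rightarrow> 'a) \<Rightarrow> real \<Rightarrow> 'a tangent" where
  "velocity M c t = (\<lambda>f. if smooth_near M (c t) f then vector_derivative (f \<circ> c) (at t) else 0)"

text \<open>The integrand has no meaning at the endpoints and at the break points, a null set.\<close>

definition curve_length ::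
  "('a, 'e::euclidean_space) manifold \<Rightarrow> ('a \<Rightarrow> 'a tangent \<Rightarrow> 'a tangent \<Rightarrow> real) \<Rightarrow> (real \<Rightarrow> 'a) \<Rightarrow> ennreal" where
  "curve_length M g c =
     (\<integral>\<^sup>+t\<in>{0..1}. ennreal (sqrt (g (c t) (velocity M c t) (velocity M c t))) \<partial>lborel)"

text \<open>The distance between points of different components is \<open>\<infinity>\<close>.\<close>

definition riemannian_distance ::
  "('a, 'e::euclidean_space) manifold \<Rightarrow> ('a \<Rightarrow> 'a tangent \<Rightarrow> 'a tangent \<Rightarrow> real) \<Rightarrow> 'a \<Rightarrow> 'a \<Rightarrow> ennreal" where
  "riemannian_distance M g p q =
     (INF c\<in>{c. piecewise_C1_curve M c \<and> c 0 = p \<and> c 1 = q}. curve_length M g c)"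

definition hoelder_curves ::
  "('a, 'e::euclidean_space) manifold \<Rightarrow> ('a \<Rightarrow> 'a tangent \<Rightarrow> 'a tangent \<Rightarrow> real) \<Rightarrow> real \<Rightarrow> real \<Rightarrow> (real \<Rightarrow> 'a) set" where
  "hoelder_curves M g \<alpha> T = {x. x ` {0..T} \<subseteq> points M \<and>
     (\<exists>C>0. \<forall>s\<in>{0..T}. \<forall>t\<in>{0..T}.
        riemannian_distance M g (x t) (x s) \<le> ennreal (C * \<bar>t - s\<bar> powr \<alpha>))}"


section \<open>Integration of 1-forms along curves\<close>

text \<open>Riemann--Stieltjes integral of \<open>f\<close> against \<open>g\<close>: limit of the tagged sums as the mesh
  tends to \<open>0\<close>.\<close>

definition has_RS_integral ::
  "(real \<Rightarrow> real) \<Rightarrow> (real \<Rightarrow> real) \<Rightarrow> real \<Rightarrow> real \<Rightarrow> real \<Rightarrow> bool" where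
  "has_RS_integral f g a b I \<longleftrightarrow>
     (\<forall>\<epsilon>>0. \<exists>\<delta>>0. \<forall>(n::nat) (\<tau>::nat \<Rightarrow> real) (\<xi>::nat \<Rightarrow> real).
        \<tau> 0 = a \<and> \<tau> n = b \<and>
        (\<forall>i<n. \<tau> i \<le> \<xi> i \<and> \<xi> i \<le> \<tau> (Suc i) \<and> \<tau> (Suc i) - \<tau> i < \<delta>) \<longrightarrow>
        \<bar>(\<Sum>i<n. f (\<xi> i) * (g (\<tau> (Suc i)) - g (\<tau> i))) - I\<bar> < \<epsilon>)"

definition has_chart_integral ::
  "('a, 'e::euclidean_space) manifold \<Rightarrow> 'a set \<times> ('a \<Rightarrow> 'e) \<Rightarrow> 'a form \<Rightarrow> (real \<Rightarrow> 'a) \<Rightarrow> real \<Rightarrow> real \<Rightarrow> real \<Rightarrow> bool" where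
  "has_chart_integral M c \<beta> x a b I \<longleftrightarrow>
     (\<exists>J. (\<forall>i\<in>Basis.
            has_RS_integral (\<lambda>s. \<beta> (x s) (coord_vector M c i (x s))) (\<lambda>s. snd c (x s) \<bullet> i) a b (J i)) \<and>
          I = (\<Sum>i\<in>Basis. J i))"

text \<open>\<open>I\<close> is a value of the integral of \<open>\<beta>\<close> along \<open>x\<close> over \<open>[a,b]\<close>, computed with some
  subdivision and some charts that contain the corresponding pieces of the path.\<close>

definition has_form_integral ::
  "('a, 'e::euclidean_space) manifold \<Rightarrow> 'a form \<Rightarrow> (real \<Rightarrow> 'a) \<Rightarrow> real \<Rightarrow> real \<Rightarrow> real \<Rightarrow> bool" where
  "has_form_integral M \<beta> x a b I \<longleftrightarrow>
     (\<exists>(n::nat) (\<tau>::nat \<Rightarrow> real) c J.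
        \<tau> 0 = a \<and> \<tau> n = b \<and>
        (\<forall>i<n. \<tau> i \<le> \<tau> (Suc i) \<and> c i \<in> atlas M \<and> x ` {\<tau> i..\<tau> (Suc i)} \<subseteq> fst (c i) \<and>
           has_chart_integral M (c i) \<beta> x (\<tau> i) (\<tau> (Suc i)) (J i)) \<and>
        I = (\<Sum>i<n. J i))"

text \<open>Uniqueness is required because a value may a priori depend on the subdivision and on the
  charts.\<close>

definition form_integrable ::
  "('a, 'e::euclidean_space) manifold \<Rightarrow> 'a form \<Rightarrow> (real \<Rightarrow> 'a) \<Rightarrow> real \<Rightarrow> real \<Rightarrow> bool" where
  "form_integrable M \<beta> x a b \<longleftrightarrow> (\<exists>!I. has_form_integral M \<beta> x a b I)"

definition form_integral ::
  "('a, 'e::euclidean_space) manifold \<Rightarrow> 'a form \<Rightarrow> (real \<Rightarrow> 'a) \<Rightarrow> real \<Rightarrow> real \<Rightarrow> real" where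
  "form_integral M \<beta> x a b = (THE I. has_form_integral M \<beta> x a b I)"

text \<open>For vector-valued \<open>F\<close>, the integral of \<open>DF(x\<^sub>s) dx\<^sub>s\<close>: its components are the integrals of
  the differentials of the components of \<open>F\<close>.\<close>

definition D_integrable ::
  "('a, 'e::euclidean_space) manifold \<Rightarrow> ('a \<Rightarrow> 'f::euclidean_space) \<Rightarrow> (real \<Rightarrow> 'a) \<Rightarrow> real \<Rightarrow> real \<Rightarrow> bool" where
  "D_integrable M F x a b \<longleftrightarrow> (\<forall>j\<in>Basis. form_integrable M (differential (\<lambda>p. F p \<bullet> j)) x a b)"

definition D_integral ::
  "('a, 'e::euclidean_space) manifold \<Rightarrow> ('a \<Rightarrow> 'f::euclidean_space) \<Rightarrow> (real \<Rightarrow> 'a) \<Rightarrow> real \<Rightarrow> real \<Rightarrow> 'f" where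
  "D_integral M F x a b =
     (\<Sum>j\<in>Basis. form_integral M (differential (\<lambda>p. F p \<bullet> j)) x a b *\<^sub>R j)"

end

theory Submission
  imports Defs
begin

text \<open>
  In one pair of charts, write \<open>y\<^sub>s = \<phi> (x s)\<close> and let \<open>H\<close> be \<open>F\<close> in
  coordinates. Over a short interval \<open>[u, v]\<close> a Young integral differs from the first term
  of its Riemann sum by \<open>O((v - u) powr (2 * \<alpha>))\<close>, so the two sides of the first claim differ from
  \<open>\<Sum>\<^sub>j \<beta>\<^sub>j(F x\<^sub>u) (H\<^sub>j(y\<^sub>v) - H\<^sub>j(y\<^sub>u))\<close> and \<open>\<Sum>\<^sub>j \<beta>\<^sub>j(F x\<^sub>u) DH\<^sub>j(y\<^sub>u)(y\<^sub>v - y\<^sub>u)\<close> by such amounts; the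
  second sum is \<open>F\<^sup>*\<beta>\<close> applied to the increment of \<open>y\<close>. By Taylor's formula these sums differ by
  \<open>O(norm (y\<^sub>v - y\<^sub>u)\<^sup>2)\<close>, which is again \<open>O((v - u) powr (2 * \<alpha>))\<close> because \<open>y\<close> is
  \<open>\<alpha>\<close>-Hoelder. Hence the difference of the two
  indefinite integrals has increments of order \<open>2 * \<alpha> > 1\<close>, so its derivative vanishes and
  it is constant (\<open>chart_integral_pull_back\<close>).

  The same lemma with \<open>F = id\<close> says that the integral in one chart does not depend on the
  chart. So the indefinite integrals of the pieces glue to a primitive \<open>Z\<close> on the whole
  interval (\<open>form_primitive_exists\<close>), and every subdivision with every choice of charts
  yields the value \<open>Z t - Z 0\<close> (\<open>has_form_integral_iff_primitive\<close>). This is integrability in the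
  sense of a unique value, and the comparison of the two global integrals becomes a local one.

  Two ingredients are analytic. The Young integral with its error term
  (\<open>young_primitive\<close>) is obtained as a limit of left-point sums over dyadic grids. The Hoelder
  condition is stated with the Riemannian distance; it becomes a Hoelder condition in charts because,
  on a small coordinate ball, the metric dominates a multiple of the Euclidean metric, and a
  curve that leaves the ball cannot be short (\<open>riemannian_distance_lower_bound\<close>).

  The claim about Euclidean targets is the first one for the constant form \<open>dz\<^sub>j\<close>, whose Riemann
  sums telescope (\<open>differential_integral\<close>).
\<close>

section \<open>Calculus of smooth functions\<close>

lemma Ck_on_subset: "Ck_on k f S \<Longrightarrow> T \<subseteq> S \<Longrightarrow> Ck_on k f T"
  by (induction k arbitrary: f) (auto intro: continuous_on_subset)

lemma Ck_on_local:
  assumes "\<And>y. y \<in> S \<Longrightarrow> \<exists>T. open T \<and> y \<in> T \<and> Ck_on k f T"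
  shows "Ck_on k f S"
  using assms
proof (induction k arbitrary: f)
  case 0
  have "isCont f y" if "y \<in> S" for y
    using 0[OF that] by (auto simp: continuous_on_eq_continuous_at)
  then show ?case
    by (simp add: continuous_at_imp_continuous_on)
next
  case (Suc k)
  have "f differentiable (at y)" if "y \<in> S" for y
    using Suc.prems[OF that] unfolding Ck_on.simps by blast
  moreover have "Ck_on k (\<lambda>y. frechet_derivative f (at y) v) S" for v
  proof (rule Suc.IH)
    fix y assume "y \<in> S"
    from Suc.prems[OF this] show "\<exists>T. open T \<and> y \<in> T \<and> Ck_on k (\<lambda>y. frechet_derivative f (at y) v) T"
      unfolding Ck_on.simps by blast
  qed
  ultimately show ?case by simp
qed

lemma frechet_derivative_at':
  "(f has_derivative f') (at x) \<Longrightarrow> frechet_derivative f (at x) = f'"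
  by (rule frechet_derivative_at[symmetric])

lemma has_derivative_cong_open:
  assumes "open S" "y \<in> S" "\<And>z. z \<in> S \<Longrightarrow> f z = g z"
  shows "(f has_derivative D) (at y) \<longleftrightarrow> (g has_derivative D) (at y)"
  using assms has_derivative_transform_within_open[of f D y UNIV S g]
    has_derivative_transform_within_open[of g D y UNIV S f] by auto

lemma frechet_derivative_cong:
  assumes "open S" "y \<in> S" "\<And>z. z \<in> S \<Longrightarrow> f z = g z"
  shows "frechet_derivative f (at y) = frechet_derivative g (at y)"
  using has_derivative_cong_open[OF assms] by (simp add: frechet_derivative_def)

lemma differentiable_cong_open:
  assumes "open S" "y \<in> S" "\<And>z. z \<in> S \<Longrightarrow> f z = g z"
  shows "f differentiable (at y) \<longleftrightarrow> g differentiable (at y)"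
  using has_derivative_cong_open[OF assms] by (simp add: differentiable_def)

lemma Ck_on_cong:
  assumes "open S" "\<And>z. z \<in> S \<Longrightarrow> f z = g z"
  shows "Ck_on k f S \<longleftrightarrow> Ck_on k g S"
  using assms(2)
proof (induction k arbitrary: f g)
  case 0 then show ?case by (simp cong: continuous_on_cong)
next
  case (Suc k)
  have "Ck_on k (\<lambda>y. frechet_derivative f (at y) v) S \<longleftrightarrow> Ck_on k (\<lambda>y. frechet_derivative g (at y) v) S" for v
    using frechet_derivative_cong[OF assms(1) _ Suc.prems] by (intro Suc.IH) simp
  then show ?case using differentiable_cong_open[OF assms(1) _ Suc.prems] by auto
qed

text \<open>Stated separately because the recursion defining \<open>Ck_on\<close> does not say that order
  \<open>Suc k\<close> contains order \<open>k\<close>; it rests on differentiable functions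
  being continuous.\<close>

lemma Ck_on_SucD: "Ck_on (Suc k) f S \<Longrightarrow> Ck_on k f S"
proof (induction k arbitrary: f)
  case 0 then show ?case
    by (auto intro!: continuous_at_imp_continuous_on differentiable_imp_continuous_within)
qed simp

lemma Ck_on_const:
  fixes c :: "'f::real_normed_vector" and S :: "'e::euclidean_space set"
  shows "Ck_on k (\<lambda>y. c) S"
proof (induction k arbitrary: c)
  case 0
  show ?case by (simp only: Ck_on.simps continuous_on_const)
next
  case (Suc k)
  have D: "frechet_derivative (\<lambda>y. c) (at y) = (\<lambda>v. 0)" for y :: 'e
    by (rule frechet_derivative_at') (rule has_derivative_const)
  show ?case
    unfolding Ck_on.simps D by (intro conjI ballI allI differentiable_const Suc)
qed

lemma Ck_on_add:
  assumes "open S" "Ck_on k f S" "Ck_on k g S"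
  shows "Ck_on k (\<lambda>y. f y + g y) S"
  using assms(2,3)
proof (induction k arbitrary: f g)
  case 0 then show ?case by (simp add: continuous_on_add)
next
  case (Suc k)
  have D: "frechet_derivative (\<lambda>y. f y + g y) (at y) v
      = frechet_derivative f (at y) v + frechet_derivative g (at y) v" if "y \<in> S" for y v
    using Suc.prems that
    by (subst frechet_derivative_at'[OF has_derivative_add]) (auto simp: frechet_derivative_works)
  have "Ck_on k (\<lambda>y. frechet_derivative (\<lambda>y. f y + g y) (at y) v) S" for v
    using Suc.IH[of "\<lambda>y. frechet_derivative f (at y) v" "\<lambda>y. frechet_derivative g (at y) v"] Suc.prems
    by (subst Ck_on_cong[OF assms(1) D]) auto
  then show ?case using Suc.prems by (auto intro: differentiable_add)
qed

lemma Ck_on_sum: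
  assumes "open S" "\<And>i. i \<in> I \<Longrightarrow> Ck_on k (f i) S"
  shows "Ck_on k (\<lambda>y. \<Sum>i\<in>I. f i y) S"
  using assms(2) proof (induction I rule: infinite_finite_induct)
  case (insert i I)
  then show ?case using Ck_on_add[OF assms(1), of k "f i" "\<lambda>y. \<Sum>i\<in>I. f i y"] by simp
next
  case empty
  show ?case by (simp only: sum.empty Ck_on_const)
next
  case (infinite I)
  show ?case by (simp only: sum.infinite[OF infinite(1)] Ck_on_const)
qed

lemma Ck_on_scaleR:
  fixes a :: "'e::euclidean_space \<Rightarrow> real"
  assumes "open S" "Ck_on k a S" "Ck_on k g S"
  shows "Ck_on k (\<lambda>y. a y *\<^sub>R g y) S"
  using assms(2,3)
proof (induction k arbitrary: a g)
  case 0 then show ?case by (simp add: continuous_on_scaleR)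
next
  case (Suc k)
  have D: "frechet_derivative (\<lambda>y. a y *\<^sub>R g y) (at y) v
      = a y *\<^sub>R frechet_derivative g (at y) v + frechet_derivative a (at y) v *\<^sub>R g y" if "y \<in> S" for y v
  proof -
    have "(a has_derivative frechet_derivative a (at y)) (at y)" "(g has_derivative frechet_derivative g (at y)) (at y)"
      using Suc.prems that by (auto simp: frechet_derivative_works)
    from frechet_derivative_at'[OF has_derivative_scaleR[OF this]] show ?thesis by simp
  qed
  have "Ck_on k (\<lambda>y. frechet_derivative (\<lambda>y. a y *\<^sub>R g y) (at y) v) S" for v
  proof (subst Ck_on_cong[OF assms(1) D], assumption, rule Ck_on_add[OF assms(1)])
    show "Ck_on k (\<lambda>y. a y *\<^sub>R frechet_derivative g (at y) v) S"
      using Suc.prems Ck_on_SucD[OF Suc.prems(1)] by (intro Suc.IH) simp_all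
    show "Ck_on k (\<lambda>y. frechet_derivative a (at y) v *\<^sub>R g y) S"
      using Suc.prems Ck_on_SucD[OF Suc.prems(2)] by (intro Suc.IH) simp_all
  qed
  then show ?case using Suc.prems by (auto intro: differentiable_scaleR)
qed

lemma Ck_on_mult:
  fixes f g :: "'e::euclidean_space \<Rightarrow> real"
  assumes "open S" "Ck_on k f S" "Ck_on k g S"
  shows "Ck_on k (\<lambda>y. f y * g y) S"
  using Ck_on_scaleR[OF assms] by simp

lemma Ck_on_linear_comp:
  assumes L: "bounded_linear L" and "open S" "Ck_on k f S"
  shows "Ck_on k (\<lambda>y. L (f y)) S"
  using assms(3)
proof (induction k arbitrary: f)
  case 0 then show ?case by (auto intro: bounded_linear.continuous_on[OF L])
next
  case (Suc k)
  have d: "((\<lambda>y. L (f y)) has_derivative (\<lambda>v. L (frechet_derivative f (at y) v))) (at y)" if "y \<in> S" for y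
    using bounded_linear.has_derivative[OF L] Suc.prems that by (auto simp: frechet_derivative_works)
  have "Ck_on k (\<lambda>y. frechet_derivative (\<lambda>y. L (f y)) (at y) v) S" for v
    using Suc.IH Suc.prems frechet_derivative_at'[OF d]
    by (subst Ck_on_cong[OF assms(2), where g="\<lambda>y. L (frechet_derivative f (at y) v)"]) auto
  then show ?case using d by (auto intro: differentiableI)
qed

lemma Ck_on_linear: "bounded_linear L \<Longrightarrow> Ck_on k L S"
proof (induction k)
  case 0 then show ?case by (auto intro: linear_continuous_on)
next
  case (Suc k)
  have "frechet_derivative L (at y) = L" for y
    using bounded_linear_imp_has_derivative[OF Suc.prems] frechet_derivative_at' by metis
  then show ?case
    using Suc bounded_linear_imp_has_derivative differentiableI
    by (auto intro!: Ck_on_const) blast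
qed

lemma frechet_derivative_Basis:
  fixes f :: "'e::euclidean_space \<Rightarrow> 'f::real_normed_vector"
  assumes "f differentiable (at y)"
  shows "frechet_derivative f (at y) v = (\<Sum>b\<in>Basis. (v \<bullet> b) *\<^sub>R frechet_derivative f (at y) b)"
proof -
  have l: "linear (frechet_derivative f (at y))" using assms by (rule linear_frechet_derivative)
  have "frechet_derivative f (at y) v = frechet_derivative f (at y) (\<Sum>b\<in>Basis. (v \<bullet> b) *\<^sub>R b)"
    by (simp add: euclidean_representation)
  also have "\<dots> = (\<Sum>b\<in>Basis. (v \<bullet> b) *\<^sub>R frechet_derivative f (at y) b)"
    by (simp add: linear_sum[OF l] linear_cmul[OF l])
  finally show ?thesis .
qed

lemma frechet_derivative_chain:
  assumes "g differentiable (at y)" "f differentiable (at (g y))"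
  shows "frechet_derivative (\<lambda>y. f (g y)) (at y) v = frechet_derivative f (at (g y)) (frechet_derivative g (at y) v)"
proof -
  have "((f \<circ> g) has_derivative (frechet_derivative f (at (g y)) \<circ> frechet_derivative g (at y))) (at y)"
    using assms by (intro diff_chain_at) (auto simp: frechet_derivative_works)
  from frechet_derivative_at'[OF this] show ?thesis by (simp add: o_def)
qed

text \<open>The chain rule, with the inner derivative expanded in the standard basis, writes every
  directional derivative of the composite as a sum of products of functions of order
  \<open>k\<close>, so the induction closes.\<close>

lemma Ck_on_compose:
  fixes g :: "'e::euclidean_space \<Rightarrow> 'f::euclidean_space"
  assumes "open S" "Ck_on k g S" "Ck_on k f T" "g ` S \<subseteq> T"
  shows "Ck_on k (\<lambda>y. f (g y)) S"
  using assms(2,3)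
proof (induction k arbitrary: f)
  case 0 then show ?case using continuous_on_compose2[OF _ _ assms(4)] by simp
next
  case (Suc k)
  have gd: "g differentiable (at y)" "f differentiable (at (g y))" if "y \<in> S" for y
    using Suc.prems that assms(4) by auto
  have D: "frechet_derivative (\<lambda>y. f (g y)) (at y) v
     = (\<Sum>b\<in>Basis. (frechet_derivative g (at y) v \<bullet> b) *\<^sub>R frechet_derivative f (at (g y)) b)" if "y \<in> S" for y v
    using gd[OF that] by (simp add: frechet_derivative_chain) (rule frechet_derivative_Basis)
  have "Ck_on k (\<lambda>y. frechet_derivative (\<lambda>y. f (g y)) (at y) v) S" for v
  proof (subst Ck_on_cong[OF assms(1) D], assumption, intro Ck_on_sum Ck_on_scaleR assms(1))
    fix b
    show "Ck_on k (\<lambda>y. frechet_derivative g (at y) v \<bullet> b) S"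
      using Suc.prems by (intro Ck_on_linear_comp[OF bounded_linear_inner_left] assms(1)) auto
    show "Ck_on k (\<lambda>y. frechet_derivative f (at (g y)) b) S"
      using Suc.prems(2) Ck_on_SucD[OF Suc.prems(1)] by (intro Suc.IH) auto
  qed
  moreover have "(\<lambda>y. f (g y)) differentiable (at y)" if "y \<in> S" for y
    using differentiable_chain_at[OF gd[OF that]] by (simp add: o_def)
  ultimately show ?case by simp
qed

lemma smooth_on_subset: "smooth_on f S \<Longrightarrow> T \<subseteq> S \<Longrightarrow> smooth_on f T"
  by (auto simp: smooth_on_def intro: Ck_on_subset)

lemma smooth_on_local:
  assumes "\<And>y. y \<in> S \<Longrightarrow> \<exists>T. open T \<and> y \<in> T \<and> smooth_on f T"
  shows "smooth_on f S"
  using assms unfolding smooth_on_def by (meson Ck_on_local)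

lemma smooth_on_cong: "open S \<Longrightarrow> (\<And>z. z \<in> S \<Longrightarrow> f z = g z) \<Longrightarrow> smooth_on f S \<longleftrightarrow> smooth_on g S"
  unfolding smooth_on_def by (simp cong: Ck_on_cong)

lemma smooth_on_differentiable: "smooth_on f S \<Longrightarrow> y \<in> S \<Longrightarrow> f differentiable (at y)"
  unfolding smooth_on_def using Ck_on.simps(2) by blast

lemma smooth_on_continuous: "smooth_on f S \<Longrightarrow> continuous_on S f"
  unfolding smooth_on_def using Ck_on.simps(1) by blast

lemma smooth_on_derivative: "smooth_on f S \<Longrightarrow> smooth_on (\<lambda>y. frechet_derivative f (at y) v) S"
  unfolding smooth_on_def using Ck_on.simps(2) by blast

lemma smooth_on_const: "smooth_on (\<lambda>y. c) S"
  by (simp add: smooth_on_def Ck_on_const)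

lemma smooth_on_compose:
  fixes g :: "'e::euclidean_space \<Rightarrow> 'f::euclidean_space"
  shows "open S \<Longrightarrow> smooth_on g S \<Longrightarrow> smooth_on f T \<Longrightarrow> g ` S \<subseteq> T \<Longrightarrow> smooth_on (\<lambda>y. f (g y)) S"
  by (auto simp: smooth_on_def intro: Ck_on_compose)

lemma smooth_on_add:
  "open S \<Longrightarrow> smooth_on f S \<Longrightarrow> smooth_on g S \<Longrightarrow> smooth_on (\<lambda>y. f y + g y) S"
  unfolding smooth_on_def by (simp add: Ck_on_add)

lemma smooth_on_mult:
  fixes f g :: "'e::euclidean_space \<Rightarrow> real"
  shows "open S \<Longrightarrow> smooth_on f S \<Longrightarrow> smooth_on g S \<Longrightarrow> smooth_on (\<lambda>y. f y * g y) S"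
  unfolding smooth_on_def by (simp add: Ck_on_mult)

lemma smooth_on_sum:
  "open S \<Longrightarrow> (\<And>i. i \<in> I \<Longrightarrow> smooth_on (f i) S) \<Longrightarrow> smooth_on (\<lambda>y. \<Sum>i\<in>I. f i y) S"
  unfolding smooth_on_def by (simp add: Ck_on_sum)

lemma smooth_on_inner_left: "open S \<Longrightarrow> smooth_on f S \<Longrightarrow> smooth_on (\<lambda>y. f y \<bullet> b) S"
  by (auto simp: smooth_on_def intro: Ck_on_linear_comp bounded_linear_inner_left)

text \<open>The directional derivatives along basis vectors are bounded on a small closed ball, which bounds
  the operator norm of the derivative there; the ball is convex, so the mean value inequality
  applies.\<close>

lemma smooth_on_locally_Lipschitz:
  fixes f :: "'e::euclidean_space \<Rightarrow> 'f::real_normed_vector"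
  assumes f: "smooth_on f S" and "open S" "y0 \<in> S"
  shows "\<exists>r L. r > 0 \<and> L \<ge> 0 \<and> cball y0 r \<subseteq> S \<and>
    (\<forall>y\<in>cball y0 r. \<forall>z\<in>cball y0 r. norm (f z - f y) \<le> L * norm (z - y))"
proof -
  obtain r where r: "r > 0" "cball y0 r \<subseteq> S" using assms open_contains_cball by blast
  have "\<exists>B\<ge>0. \<forall>y\<in>cball y0 r. norm (frechet_derivative f (at y) b) \<le> B" for b
  proof -
    have "continuous_on (cball y0 r) (\<lambda>y. norm (frechet_derivative f (at y) b))"
      using smooth_on_continuous[OF smooth_on_derivative[OF f, of b]] r continuous_on_subset
      by (intro continuous_on_norm) blast
    then have "bounded ((\<lambda>y. norm (frechet_derivative f (at y) b)) ` cball y0 r)"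
      by (intro compact_imp_bounded compact_continuous_image) auto
    then obtain B where "\<forall>y\<in>cball y0 r. norm (frechet_derivative f (at y) b) \<le> B"
      by (force simp: bounded_iff)
    then show ?thesis using r by (intro exI[of _ "max B 0"]) auto
  qed
  then obtain B where B: "\<And>b. B b \<ge> 0" "\<And>b y. y \<in> cball y0 r \<Longrightarrow> norm (frechet_derivative f (at y) b) \<le> B b"
    by metis
  define L where "L = (\<Sum>b\<in>(Basis::'e set). B b)"
  have Df: "(f has_derivative frechet_derivative f (at y)) (at y within cball y0 r)" if "y \<in> cball y0 r" for y
    using smooth_on_differentiable[OF f] that r frechet_derivative_works has_derivative_at_withinI by blast
  have "onorm (frechet_derivative f (at y)) \<le> L" if y: "y \<in> cball y0 r" for y
  proof (rule onorm_le)
    fix v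
    have "norm (frechet_derivative f (at y) v) \<le> (\<Sum>b\<in>Basis. norm ((v \<bullet> b) *\<^sub>R frechet_derivative f (at y) b))"
      using smooth_on_differentiable[OF f] y r(2) frechet_derivative_Basis[of f y v] norm_sum by (metis subsetD)
    also have "\<dots> \<le> (\<Sum>b\<in>(Basis::'e set). norm v * B b)"
      using B y by (intro sum_mono) (auto intro!: mult_mono simp: Basis_le_norm)
    also have "\<dots> = L * norm v" by (simp add: L_def sum_distrib_left mult.commute)
    finally show "norm (frechet_derivative f (at y) v) \<le> L * norm v" .
  qed
  then have "norm (f z - f y) \<le> L * norm (z - y)" if "y \<in> cball y0 r" "z \<in> cball y0 r" for y z
    using differentiable_bound[OF convex_cball Df] that by blast
  moreover have "L \<ge> 0" by (simp add: L_def B sum_nonneg)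
  ultimately show ?thesis using r by (intro exI[of _ r] exI[of _ L]) simp
qed

text \<open>The derivative is itself Lipschitz on a small ball. On the segment from \<open>y\<close> to
  \<open>z\<close> it therefore differs from its value at \<open>y\<close> by a multiple of
  \<open>norm (z - y)\<close>, which yields the quadratic error.\<close>

lemma smooth_on_local_Taylor:
  fixes f :: "'e::euclidean_space \<Rightarrow> 'f::real_normed_vector"
  assumes f: "smooth_on f S" and "open S" "y0 \<in> S"
  shows "\<exists>r K. r > 0 \<and> K \<ge> 0 \<and> cball y0 r \<subseteq> S \<and>
    (\<forall>y\<in>cball y0 r. \<forall>z\<in>cball y0 r.
       norm (f z - f y - frechet_derivative f (at y) (z - y)) \<le> K * (norm (z - y))\<^sup>2)"
proof -
  let ?D = "\<lambda>b y. frechet_derivative f (at y) b"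
  have "\<exists>r L. r > 0 \<and> L \<ge> 0 \<and> cball y0 r \<subseteq> S \<and>
     (\<forall>y \<in> cball y0 r. \<forall>z \<in> cball y0 r. norm (?D b z - ?D b y) \<le> L * norm (z - y))" for b
    by (rule smooth_on_locally_Lipschitz[OF smooth_on_derivative[OF f] assms(2,3)])
  then obtain r L where r: "\<And>b. r b > 0" "\<And>b. L b \<ge> 0" "\<And>b. cball y0 (r b) \<subseteq> S"
    "\<And>b y z. y \<in> cball y0 (r b) \<Longrightarrow> z \<in> cball y0 (r b) \<Longrightarrow> norm (?D b z - ?D b y) \<le> L b * norm (z - y)"
    by metis
  define R where "R = Min (r ` Basis)"
  have R: "R > 0" "\<And>b. b \<in> Basis \<Longrightarrow> R \<le> r b" using r(1) by (auto simp: R_def)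
  have RS: "cball y0 R \<subseteq> S" using R(2)[OF SOME_Basis] r(3) by (meson dual_order.trans subset_cball)
  define K where "K = (\<Sum>b\<in>(Basis::'e set). L b)"
  have diff: "f differentiable (at y)" if "y \<in> cball y0 R" for y
    using smooth_on_differentiable[OF f] that RS by blast
  have "norm (f z - f y - frechet_derivative f (at y) (z - y)) \<le> K * (norm (z - y))\<^sup>2"
    if y: "y \<in> cball y0 R" and z: "z \<in> cball y0 R" for y z
  proof -
    have seg: "y + t *\<^sub>R (z - y) \<in> cball y0 R" if "t \<in> {0..1}" for t
      using convexD_alt[OF convex_cball y z, of t] that by (simp add: algebra_simps)
    have "norm (f z - f y - frechet_derivative f (at y) (z - y)) \<le> norm (z - y) * (K * norm (z - y))"
    proof (rule differentiable_bound_linearization[where S = "cball y0 R \<inter> cball y (norm (z - y))"])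
      show "y + t *\<^sub>R (z - y) \<in> cball y0 R \<inter> cball y (norm (z - y))" if "t \<in> {0..1}" for t
        using seg[OF that] that by (auto simp: dist_norm mult_left_le_one_le)
      show "(f has_derivative frechet_derivative f (at w)) (at w within cball y0 R \<inter> cball y (norm (z - y)))"
        if "w \<in> cball y0 R \<inter> cball y (norm (z - y))" for w
        using diff that frechet_derivative_works has_derivative_at_withinI by blast
      fix w assume w: "w \<in> cball y0 R \<inter> cball y (norm (z - y))"
      show "onorm (frechet_derivative f (at w) - frechet_derivative f (at y)) \<le> K * norm (z - y)"
        unfolding fun_diff_def
      proof (rule onorm_le)
        fix v
        have "norm (frechet_derivative f (at w) v - frechet_derivative f (at y) v)
            = norm (\<Sum>b\<in>Basis. (v \<bullet> b) *\<^sub>R (?D b w - ?D b y))"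
          using w y frechet_derivative_Basis[OF diff, of w v] frechet_derivative_Basis[OF diff, of y v]
          by (simp add: sum_subtractf scaleR_diff_right)
        also have "\<dots> \<le> (\<Sum>b\<in>Basis. norm ((v \<bullet> b) *\<^sub>R (?D b w - ?D b y)))" by (rule norm_sum)
        also have "\<dots> \<le> (\<Sum>b\<in>(Basis::'e set). norm v * (L b * norm (z - y)))"
        proof (rule sum_mono)
          fix b :: 'e assume b: "b \<in> Basis"
          have "norm (?D b w - ?D b y) \<le> L b * norm (w - y)"
            using w y R(2)[OF b] by (intro r(4)) auto
          also have "\<dots> \<le> L b * norm (z - y)"
            using w r(2) by (intro mult_left_mono) (auto simp: dist_norm norm_minus_commute)
          finally show "norm ((v \<bullet> b) *\<^sub>R (?D b w - ?D b y)) \<le> norm v * (L b * norm (z - y))"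
            using b by (auto intro!: mult_mono simp: Basis_le_norm)
        qed
        also have "\<dots> = K * norm (z - y) * norm v"
          by (simp add: K_def sum_distrib_left sum_distrib_right mult_ac)
        finally show "norm (frechet_derivative f (at w) v - frechet_derivative f (at y) v) \<le> K * norm (z - y) * norm v" .
      qed
    next
      show "y \<in> cball y0 R \<inter> cball y (norm (z - y))" using y by auto
    qed
    then show ?thesis by (simp add: power2_eq_square mult_ac)
  qed
  moreover have "K \<ge> 0" by (simp add: K_def r sum_nonneg)
  ultimately show ?thesis using R RS by (intro exI[of _ R] exI[of _ K]) simp
qed

section \<open>The Young integral of Hoelder functions\<close>

definition hoelder_on :: "real \<Rightarrow> real set \<Rightarrow> (real \<Rightarrow> 'f::real_normed_vector) \<Rightarrow> bool" where
  "hoelder_on \<alpha> S f \<longleftrightarrow> (\<exists>C\<ge>0. \<forall>s\<in>S. \<forall>t\<in>S. norm (f t - f s) \<le> C * \<bar>t - s\<bar> powr \<alpha>)"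

definition grid :: "real \<Rightarrow> real \<Rightarrow> nat \<Rightarrow> nat \<Rightarrow> real" where
  "grid a b n k = a + real k * ((b - a) / 2 ^ n)"

text \<open>The left-point Riemann sum of \<open>f dg\<close> over \<open>{a..v}\<close> for the dyadic
  grid of level \<open>n\<close>. The grid belongs to \<open>{a..b}\<close> and is merely cut
  off at \<open>v\<close>; differences of values at two points are therefore additive over
  intervals, for each \<open>n\<close> and hence in the limit.\<close>

definition dyadic_sum :: "(real \<Rightarrow> real) \<Rightarrow> (real \<Rightarrow> real) \<Rightarrow> real \<Rightarrow> real \<Rightarrow> nat \<Rightarrow> real \<Rightarrow> real" where
  "dyadic_sum f g a b n v =
     (\<Sum>k<2^n. f (grid a b n k) * (g (min v (grid a b n (Suc k))) - g (min v (grid a b n k))))"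

lemma sum_le_card_bound:
  fixes F :: "'i \<Rightarrow> real"
  assumes "finite I" "\<And>i. i \<in> I \<Longrightarrow> i \<notin> J \<Longrightarrow> F i = 0" "\<And>i. i \<in> J \<Longrightarrow> \<bar>F i\<bar> \<le> B"
    and "J \<subseteq> I" "real (card J) \<le> c" "B \<ge> 0"
  shows "\<bar>sum F I\<bar> \<le> c * B"
proof -
  have "sum F I = sum F J" using assms by (intro sum.mono_neutral_right) auto
  also have "\<bar>\<dots>\<bar> \<le> (\<Sum>i\<in>J. \<bar>F i\<bar>)" by (rule sum_abs)
  also have "\<dots> \<le> (\<Sum>i\<in>J. B)" using assms by (intro sum_mono) auto
  also have "\<dots> \<le> c * B" using assms(5,6) by (simp add: mult_right_mono)
  finally show ?thesis .
qed

text \<open>When the mesh \<open>h\<close> is at most \<open>v - u\<close>, the interval meets at most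
  \<open>(v - u) / h + 2\<close> cells. All estimates below multiply this number by a
  bound for one cell.\<close>

lemma grid_count:
  assumes "a < b" "a \<le> u" "u \<le> v" "(b - a) / 2 ^ n \<le> v - u"
  defines "h \<equiv> (b - a) / 2 ^ n"
  shows "real (card {k. k < (2::nat) ^ n \<and> u < grid a b n (Suc k) \<and> grid a b n k < v}) \<le> 3 * (v - u) / h"
    (is "real (card ?J) \<le> _")
proof -
  have h: "h > 0" using assms by (simp add: h_def)
  have r: "1 \<le> (v - u) / h" using assms(4) h by (simp add: h_def[symmetric] field_simps)
  have sub: "int ` ?J \<subseteq> {\<lfloor>(u - a) / h\<rfloor> .. \<lceil>(v - a) / h\<rceil> - 1}"
  proof clarify
    fix k assume k: "u < grid a b n (Suc k)" "grid a b n k < v"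
    have "(u - a) / h < real k + 1" "real k < (v - a) / h"
      using k h by (auto simp: grid_def h_def[symmetric] field_simps)
    then show "int k \<in> {\<lfloor>(u - a) / h\<rfloor> .. \<lceil>(v - a) / h\<rceil> - 1}"
      by (auto simp: less_ceiling_iff) linarith+
  qed
  have "card ?J = card (int ` ?J)" by (simp add: card_image)
  also have "\<dots> \<le> card {\<lfloor>(u - a) / h\<rfloor> .. \<lceil>(v - a) / h\<rceil> - 1}" using sub by (intro card_mono) auto
  also have "\<dots> = nat (\<lceil>(v - a) / h\<rceil> - \<lfloor>(u - a) / h\<rfloor>)" by simp
  finally have "real (card ?J) \<le> real (nat (\<lceil>(v - a) / h\<rceil> - \<lfloor>(u - a) / h\<rfloor>))" by linarith
  also have "\<dots> \<le> (v - a) / h - (u - a) / h + 2"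
  proof -
    have "(u - a) / h \<le> (v - a) / h" using h assms by (intro divide_right_mono) auto
    then show ?thesis by linarith
  qed
  also have "\<dots> = (v - u) / h + 2" by (simp add: diff_divide_distrib)
  also have "\<dots> \<le> (v - u) / h + 2 * ((v - u) / h)" using r by linarith
  also have "\<dots> = 3 * (v - u) / h" using h by (simp add: field_simps)
  finally show ?thesis .
qed

lemma grid_telescope:
  fixes g :: "real \<Rightarrow> real"
  assumes "a \<le> b" "a \<le> v" "v \<le> b"
  shows "(\<Sum>k<2^n. g (min v (grid a b n (Suc k))) - g (min v (grid a b n k))) = g v - g a"
proof -
  have "(\<Sum>k<2^n. g (min v (grid a b n (Suc k))) - g (min v (grid a b n k)))
     = g (min v (grid a b n (2 ^ n))) - g (min v (grid a b n 0))"
    by (rule sum_lessThan_telescope[of "\<lambda>k. g (min v (grid a b n k))"])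
  also have "\<dots> = g v - g a" using assms by (simp add: grid_def)
  finally show ?thesis .
qed

lemma min_increment_eq_0:
  fixes u v p q :: real
  assumes "u \<le> v" "q \<le> p" "p \<le> u \<or> v \<le> q"
  shows "(g (min v p) - g (min v q)) - (g (min u p) - g (min u q)) = (0::real)"
  using assms(3)
proof
  assume "p \<le> u"
  then have "min v p = p" "min u p = p" "min v q = q" "min u q = q" using assms by auto
  then show ?thesis by simp
next
  assume "v \<le> q"
  then have "min v p = v" "min u p = u" "min v q = v" "min u q = u" using assms by auto
  then show ?thesis by simp
qed

text \<open>Refining the grid replaces, on the right half of each cell, the value of \<open>f\<close> at the
  left end by the value at the midpoint. This changes the sum by at most a constant times
  \<open>h powr (2 * \<alpha>)\<close> per cell, and only the
  \<open>O((v - u) / h)\<close> cells that meet \<open>{u..v}\<close> contribute.\<close>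

lemma dyadic_step:
  assumes "\<alpha> > 0" and fA: "\<And>s t. \<bar>f t - f s\<bar> \<le> A * \<bar>t - s\<bar> powr \<alpha>"
    and gB: "\<And>s t. \<bar>g t - g s\<bar> \<le> B * \<bar>t - s\<bar> powr \<alpha>" and "A \<ge> 0" "B \<ge> 0"
    and "a < b" "a \<le> u" "u \<le> v" "(b - a) / 2 ^ n \<le> v - u"
  defines "h \<equiv> (b - a) / 2 ^ n" and "Z \<equiv> dyadic_sum f g a b"
  shows "\<bar>(Z (Suc n) v - Z n v) - (Z (Suc n) u - Z n u)\<bar> \<le> 6 * A * B * (v - u) * h powr (2 * \<alpha> - 1)"
proof -
  have h: "h > 0" using assms by (simp add: h_def)
  define p where "p k = grid a b n k" for k
  define q where "q k = grid a b (Suc n) (Suc (2 * k))" for k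
  have pq: "grid a b (Suc n) (2 * k) = p k" "grid a b (Suc n) (Suc (Suc (2 * k))) = p (Suc k)" for k
    by (auto simp: p_def grid_def field_simps)
  have q: "q k - p k = h / 2" "p (Suc k) - q k = h / 2" for k
    by (auto simp: p_def q_def grid_def h_def field_simps)
  let ?\<Delta> = "\<lambda>w k. g (min w (p (Suc k))) - g (min w (q k))"
  have diff: "Z (Suc n) w - Z n w = (\<Sum>k<2^n. (f (q k) - f (p k)) * ?\<Delta> w k)" for w
  proof -
    let ?G = "\<lambda>k. f (grid a b (Suc n) k) * (g (min w (grid a b (Suc n) (Suc k))) - g (min w (grid a b (Suc n) k)))"
    have "Z (Suc n) w = (\<Sum>k<2^n. sum ?G {k*2..<k*2+2})"
      unfolding Z_def dyadic_sum_def by (subst sum.nat_group) (simp add: mult.commute)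
    also have "\<dots> = (\<Sum>k<2^n. ?G (2*k) + ?G (Suc (2*k)))"
      by (intro sum.cong refl) (simp add: numeral_2_eq_2 mult.commute)
    also have "\<dots> = (\<Sum>k<2^n. f (p k) * (g (min w (q k)) - g (min w (p k))) + f (q k) * ?\<Delta> w k)"
      by (intro sum.cong refl) (simp only: pq q_def)
    finally show ?thesis
      unfolding Z_def dyadic_sum_def p_def[symmetric]
      by (simp add: sum_subtractf[symmetric] algebra_simps)
  qed
  have "(Z (Suc n) v - Z n v) - (Z (Suc n) u - Z n u)
      = (\<Sum>k<2^n. (f (q k) - f (p k)) * (?\<Delta> v k - ?\<Delta> u k))"
    unfolding diff by (simp add: sum_subtractf[symmetric] right_diff_distrib)
  also have "\<bar>\<dots>\<bar> \<le> (3 * (v - u) / h) * (A * h powr \<alpha> * (2 * B * h powr \<alpha>))"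
  proof (rule sum_le_card_bound)
    show "real (card {k. k < (2::nat) ^ n \<and> u < p (Suc k) \<and> p k < v}) \<le> 3 * (v - u) / h"
      unfolding p_def h_def using assms by (intro grid_count) auto
    fix k
    show "(f (q k) - f (p k)) * (?\<Delta> v k - ?\<Delta> u k) = 0"
      if "k \<in> {..<2 ^ n}" "k \<notin> {k. k < 2 ^ n \<and> u < p (Suc k) \<and> p k < v}"
    proof -
      have "p (Suc k) \<le> u \<or> v \<le> q k" using that q[of k] h by auto
      then have "?\<Delta> v k - ?\<Delta> u k = 0"
        using q[of k] h \<open>u \<le> v\<close> by (intro min_increment_eq_0) auto
      then show ?thesis by (simp only: mult_zero_right)
    qed
    have f: "\<bar>f (q k) - f (p k)\<bar> \<le> A * h powr \<alpha>"
    proof -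
      have "\<bar>f (q k) - f (p k)\<bar> \<le> A * \<bar>q k - p k\<bar> powr \<alpha>" by (rule fA)
      also have "\<dots> \<le> A * h powr \<alpha>" using q[of k] h \<open>\<alpha> > 0\<close> \<open>A \<ge> 0\<close> \<open>B \<ge> 0\<close> by (intro mult_left_mono powr_mono2) linarith+
      finally show ?thesis .
    qed
    have g: "\<bar>?\<Delta> w k\<bar> \<le> B * h powr \<alpha>" for w
    proof -
      have "\<bar>?\<Delta> w k\<bar> \<le> B * \<bar>min w (p (Suc k)) - min w (q k)\<bar> powr \<alpha>" by (rule gB)
      also have "\<dots> \<le> B * h powr \<alpha>" using q[of k] h \<open>\<alpha> > 0\<close> \<open>A \<ge> 0\<close> \<open>B \<ge> 0\<close> by (intro mult_left_mono powr_mono2) linarith+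
      finally show ?thesis .
    qed
    have "\<bar>?\<Delta> v k - ?\<Delta> u k\<bar> \<le> 2 * B * h powr \<alpha>" using g[of v] g[of u] by linarith
    then show "\<bar>(f (q k) - f (p k)) * (?\<Delta> v k - ?\<Delta> u k)\<bar> \<le> A * h powr \<alpha> * (2 * B * h powr \<alpha>)"
      unfolding abs_mult using f assms by (intro mult_mono) auto
  qed (use assms in auto)
  also have "\<dots> = 6 * A * B * (v - u) * h powr (2 * \<alpha> - 1)"
    using h by (simp add: powr_diff powr_add[symmetric] mult_ac)
  finally show ?thesis .
qed

text \<open>At the level whose mesh is comparable to \<open>v - u\<close>, only a bounded number of cells
  meets \<open>{u..v}\<close>, and on each of them \<open>f\<close> differs from
  \<open>f u\<close> by at most a constant times \<open>(v - u) powr \<alpha>\<close>.\<close>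

lemma dyadic_base:
  assumes "\<alpha> > 0" and fA: "\<And>s t. \<bar>f t - f s\<bar> \<le> A * \<bar>t - s\<bar> powr \<alpha>"
    and gB: "\<And>s t. \<bar>g t - g s\<bar> \<le> B * \<bar>t - s\<bar> powr \<alpha>" and "A \<ge> 0" "B \<ge> 0"
    and "a < b" "a \<le> u" "u \<le> v" "v \<le> b" "(b - a) / 2 ^ n \<le> v - u" "v - u < 2 * ((b - a) / 2 ^ n)"
  defines "Z \<equiv> dyadic_sum f g a b"
  shows "\<bar>Z n v - Z n u - f u * (g v - g u)\<bar> \<le> 12 * A * B * (v - u) powr (2 * \<alpha>)"
proof -
  define h where "h = (b - a) / 2 ^ n"
  have h: "h > 0" using \<open>a < b\<close> by (simp add: h_def)
  have hu: "h \<le> v - u" "v - u < 2 * h" using assms by (auto simp: h_def)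
  define p where "p k = grid a b n k" for k
  have p: "p (Suc k) - p k = h" for k by (auto simp: p_def grid_def h_def field_simps)
  let ?\<Delta> = "\<lambda>w k. g (min w (p (Suc k))) - g (min w (p k))"
  have tel: "(\<Sum>k<2^n. ?\<Delta> w k) = g w - g a" if "a \<le> w" "w \<le> b" for w
    unfolding p_def using that assms by (intro grid_telescope) auto
  have "(\<Sum>k<2^n. ?\<Delta> v k) - (\<Sum>k<2^n. ?\<Delta> u k) = g v - g u"
    using tel[of v] tel[of u] \<open>a \<le> u\<close> \<open>u \<le> v\<close> \<open>v \<le> b\<close> by simp
  then have "Z n v - Z n u - f u * (g v - g u)
     = (\<Sum>k<2^n. f (p k) * ?\<Delta> v k) - (\<Sum>k<2^n. f (p k) * ?\<Delta> u k)
       - f u * ((\<Sum>k<2^n. ?\<Delta> v k) - (\<Sum>k<2^n. ?\<Delta> u k))"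
    by (simp add: Z_def dyadic_sum_def p_def)
  also have "\<dots> = (\<Sum>k<2^n. (f (p k) - f u) * (?\<Delta> v k - ?\<Delta> u k))"
    unfolding sum_subtractf[symmetric] sum_distrib_left by (intro sum.cong refl) (simp add: algebra_simps)
  also have "\<bar>\<dots>\<bar> \<le> 6 * (A * (v - u) powr \<alpha> * (2 * B * (v - u) powr \<alpha>))"
  proof (rule sum_le_card_bound)
    have "3 * (v - u) / h \<le> 6" using hu h by (simp add: field_simps)
    moreover have "real (card {k. k < (2::nat) ^ n \<and> u < p (Suc k) \<and> p k < v}) \<le> 3 * (v - u) / h"
      unfolding p_def h_def using \<open>a < b\<close> \<open>a \<le> u\<close> \<open>u \<le> v\<close> hu(1)[unfolded h_def] by (intro grid_count)
    ultimately show "real (card {k. k < (2::nat) ^ n \<and> u < p (Suc k) \<and> p k < v}) \<le> 6" by linarith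
  next
    fix k
    assume k: "k \<in> {..<2 ^ n}" "k \<notin> {k. k < 2 ^ n \<and> u < p (Suc k) \<and> p k < v}"
    then have "?\<Delta> v k - ?\<Delta> u k = 0"
      using p[of k] h \<open>u \<le> v\<close> by (intro min_increment_eq_0) auto
    then show "(f (p k) - f u) * (?\<Delta> v k - ?\<Delta> u k) = 0" by (simp only: mult_zero_right)
  next
    fix k
    assume k: "k \<in> {k. k < 2 ^ n \<and> u < p (Suc k) \<and> p k < v}"
    then have "u < p (Suc k)" "p k < v" by simp_all
    then have pu: "\<bar>p k - u\<bar> \<le> v - u" using p[of k] hu by linarith
    have "\<bar>f (p k) - f u\<bar> \<le> A * \<bar>p k - u\<bar> powr \<alpha>" by (rule fA)
    also have "\<dots> \<le> A * (v - u) powr \<alpha>"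
      using pu \<open>\<alpha> > 0\<close> \<open>A \<ge> 0\<close> by (intro mult_left_mono powr_mono2) auto
    finally have f: "\<bar>f (p k) - f u\<bar> \<le> A * (v - u) powr \<alpha>" .
    have g: "\<bar>?\<Delta> w k\<bar> \<le> B * (v - u) powr \<alpha>" for w
    proof -
      have "\<bar>?\<Delta> w k\<bar> \<le> B * \<bar>min w (p (Suc k)) - min w (p k)\<bar> powr \<alpha>" by (rule gB)
      also have "\<dots> \<le> B * (v - u) powr \<alpha>"
        using p[of k] hu h \<open>\<alpha> > 0\<close> \<open>B \<ge> 0\<close> by (intro mult_left_mono powr_mono2) linarith+
      finally show ?thesis .
    qed
    have "\<bar>?\<Delta> v k - ?\<Delta> u k\<bar> \<le> 2 * B * (v - u) powr \<alpha>" using g[of v] g[of u] by linarith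
    then show "\<bar>(f (p k) - f u) * (?\<Delta> v k - ?\<Delta> u k)\<bar> \<le> A * (v - u) powr \<alpha> * (2 * B * (v - u) powr \<alpha>)"
      unfolding abs_mult using f assms by (intro mult_mono) auto
  qed (use assms in auto)
  also have "\<dots> = 12 * A * B * (v - u) powr (2 * \<alpha>)"
    by (simp add: powr_add[symmetric] mult_ac)
  finally show ?thesis .
qed


text \<open>The changes from level to level form a geometric series with ratio
  \<open>2 powr (1 - 2 * \<alpha>)\<close>; this is where \<open>\<alpha> > 1/2\<close>
  is needed. Starting the series at the level adapted to \<open>v - u\<close> bounds its sum
  by a multiple of \<open>(v - u) powr (2 * \<alpha>)\<close>.\<close>

lemma young_primitive_real_line:
  fixes f g :: "real \<Rightarrow> real"
  assumes "1/2 < \<alpha>" and fA: "\<And>s t. \<bar>f t - f s\<bar> \<le> A * \<bar>t - s\<bar> powr \<alpha>"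
    and gB: "\<And>s t. \<bar>g t - g s\<bar> \<le> B * \<bar>t - s\<bar> powr \<alpha>" and "A \<ge> 0" "B \<ge> 0"
    and "a < b"
  shows "\<exists>Z K. K \<ge> 0 \<and> (\<forall>u v. a \<le> u \<longrightarrow> u \<le> v \<longrightarrow> v \<le> b \<longrightarrow>
    \<bar>Z v - Z u - f u * (g v - g u)\<bar> \<le> K * (v - u) powr (2 * \<alpha>))"
proof -
  let ?Z = "dyadic_sum f g a b"
  have \<alpha>: "0 < \<alpha>" using assms(1) by simp
  define h where "h n = (b - a) / 2 ^ n" for n :: nat
  \<comment> \<open>The ratio of the geometric series of corrections.\<close>
  define \<rho> where "\<rho> = (1/2::real) powr (2 * \<alpha> - 1)"
  have \<rho>: "0 < \<rho>" "\<rho> < 1"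
    using assms(1) powr_less_mono2[of "2 * \<alpha> - 1" "1/2" 1] by (auto simp: \<rho>_def)
  have h: "h n > 0" for n using assms by (simp add: h_def)
  have hpow: "h (n + m) powr (2 * \<alpha> - 1) = h n powr (2 * \<alpha> - 1) * \<rho> ^ m" for n m
  proof -
    have "h (n + m) = h n * (1/2) ^ m" by (simp add: h_def power_add field_simps)
    then have "h (n + m) powr (2 * \<alpha> - 1) = h n powr (2 * \<alpha> - 1) * ((1/2) ^ m) powr (2 * \<alpha> - 1)"
      using h[of n] by (simp add: powr_mult)
    also have "((1/2::real) ^ m) powr (2 * \<alpha> - 1) = \<rho> ^ m"
      by (simp add: \<rho>_def powr_powr powr_realpow[symmetric] mult.commute)
    finally show ?thesis .
  qed
  have level: "\<exists>n. h n \<le> v - u \<and> v - u < 2 * h n" if "a \<le> u" "u < v" "v \<le> b" for u v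
  proof -
    obtain n0 where "(b - a) / (v - u) < 2 ^ n0" using real_arch_pow[of 2] by auto
    then have ex: "\<exists>n. h n \<le> v - u" using that by (intro exI[of _ n0]) (simp add: h_def field_simps)
    \<comment> \<open>The first level with mesh at most \<open>v - u\<close>: the mesh at the preceding level, twice as large, exceeds \<open>v - u\<close>, and level \<open>0\<close> has mesh \<open>b - a\<close>.\<close>
    define n where "n = (LEAST n. h n \<le> v - u)"
    have n: "h n \<le> v - u" unfolding n_def using ex by (rule LeastI_ex)
    have "v - u < 2 * h n"
    proof (cases n)
      case 0 then show ?thesis using that h[of 0] by (simp add: h_def)
    next
      case (Suc m)
      then have "m < (LEAST n. h n \<le> v - u)" by (simp add: n_def[symmetric])
      then have "\<not> h m \<le> v - u" by (rule not_less_Least)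
      moreover have "h m = 2 * h n" using Suc by (simp add: h_def field_simps)
      ultimately show ?thesis by simp
    qed
    then show ?thesis using n by blast
  qed
  have step: "\<bar>(?Z (Suc (n + m)) v - ?Z (n + m) v) - (?Z (Suc (n + m)) u - ?Z (n + m) u)\<bar>
      \<le> 6 * A * B * (v - u) powr (2 * \<alpha>) * \<rho> ^ m"
    if "a \<le> u" "u < v" "v \<le> b" "h n \<le> v - u" for u v n m
  proof -
    have "h (n + m) \<le> h n"
      unfolding h_def using \<open>a < b\<close> by (intro divide_left_mono power_increasing) auto
    then have le: "(b - a) / 2 ^ (n + m) \<le> v - u" using that by (simp add: h_def)
    have "\<bar>(?Z (Suc (n + m)) v - ?Z (n + m) v) - (?Z (Suc (n + m)) u - ?Z (n + m) u)\<bar>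
       \<le> 6 * A * B * (v - u) * h (n + m) powr (2 * \<alpha> - 1)"
      unfolding h_def
      using dyadic_step[OF \<alpha> fA gB \<open>A \<ge> 0\<close> \<open>B \<ge> 0\<close> \<open>a < b\<close> that(1) less_imp_le[OF that(2)] le] .
    also have "\<dots> = 6 * A * B * ((v - u) * h n powr (2 * \<alpha> - 1)) * \<rho> ^ m" by (simp add: hpow)
    also have "\<dots> \<le> 6 * A * B * ((v - u) * (v - u) powr (2 * \<alpha> - 1)) * \<rho> ^ m"
      using that h[of n] \<alpha> assms(1,4,5) \<rho>
      by (intro mult_right_mono mult_left_mono powr_mono2 mult_nonneg_nonneg zero_le_power) linarith+
    also have "(v - u) * (v - u) powr (2 * \<alpha> - 1) = (v - u) powr (2 * \<alpha>)"
      using that by (simp add: powr_diff)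
    finally show ?thesis .
  qed
  \<comment> \<open>At \<open>a\<close> all grid points are cut off, so convergence of differences from \<open>a\<close> is convergence of the sums.\<close>
  have Za: "?Z n a = 0" for n
    using \<open>a < b\<close> by (auto simp: dyadic_sum_def grid_def intro!: sum.neutral)
  define inc where "inc v m = ?Z (Suc m) v - ?Z m v" for v m
  have geo: "summable (\<lambda>m. C * \<rho> ^ m)" for C
    using \<rho> by (intro summable_mult summable_geometric) auto
  have summ: "summable (inc v)" if "a \<le> v" "v \<le> b" for v
  proof (cases "a = v")
    case True then show ?thesis by (simp add: inc_def[abs_def] Za flip: True)
  next
    case False
    then have "a < v" using that by simp
    from level[OF order_refl this that(2)] obtain n where n: "h n \<le> v - a" by blast
    have "summable (\<lambda>m. inc v (m + n))"
    proof (rule summable_comparison_test'[OF geo, of 0])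
      fix m
      show "norm (inc v (m + n)) \<le> 6 * A * B * (v - a) powr (2 * \<alpha>) * \<rho> ^ m"
        using step[of a v n m] that n False by (simp add: inc_def Za add.commute)
    qed
    then show ?thesis by (rule summable_iff_shift[THEN iffD1])
  qed
  define Z where "Z v = (\<Sum>m. inc v m)" for v
  have inc0: "?Z 0 v + (\<Sum>m<n. inc v m) = ?Z n v" for v n
    using sum_lessThan_telescope[of "\<lambda>n. ?Z n v" n] by (simp add: inc_def)
  have Zn: "?Z 0 v + Z v = ?Z n v + (\<Sum>m. inc v (m + n))" if "a \<le> v" "v \<le> b" for v n
    using suminf_split_initial_segment[OF summ[OF that], of n] inc0[of v n] by (simp add: Z_def)
  define K where "K = 12 * A * B + 6 * A * B * (1 / (1 - \<rho>))"
  have K: "K \<ge> 0" unfolding K_def using assms \<rho> by auto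
  have "\<bar>(?Z 0 v + Z v) - (?Z 0 u + Z u) - f u * (g v - g u)\<bar> \<le> K * (v - u) powr (2 * \<alpha>)"
    if uv: "a \<le> u" "u \<le> v" "v \<le> b" for u v
  proof (cases "u = v")
    case False
    then have "u < v" using uv by simp
    obtain n where n: "h n \<le> v - u" "v - u < 2 * h n" using level[OF uv(1) \<open>u < v\<close> uv(3)] by blast
    let ?e = "\<lambda>m. inc v (m + n) - inc u (m + n)"
    have su: "summable (\<lambda>m. inc v (m + n))" "summable (\<lambda>m. inc u (m + n))"
      using summ uv by (auto intro!: summable_ignore_initial_segment)
    have e: "norm (?e m) \<le> 6 * A * B * (v - u) powr (2 * \<alpha>) * \<rho> ^ m" for m
      using step[OF uv(1) \<open>u < v\<close> uv(3) n(1), of m] by (simp add: inc_def add.commute)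
    have "\<bar>(\<Sum>m. ?e m)\<bar> \<le> (\<Sum>m. 6 * A * B * (v - u) powr (2 * \<alpha>) * \<rho> ^ m)"
      using norm_suminf_le[OF e geo] by simp
    also have "\<dots> = 6 * A * B * (v - u) powr (2 * \<alpha>) * (1 / (1 - \<rho>))"
      using \<rho> by (subst suminf_mult) (auto simp: suminf_geometric summable_geometric)
    finally have tail: "\<bar>(\<Sum>m. ?e m)\<bar> \<le> 6 * A * B * (v - u) powr (2 * \<alpha>) * (1 / (1 - \<rho>))" .
    have base: "\<bar>?Z n v - ?Z n u - f u * (g v - g u)\<bar> \<le> 12 * A * B * (v - u) powr (2 * \<alpha>)"
      using dyadic_base[OF \<alpha> fA gB \<open>A \<ge> 0\<close> \<open>B \<ge> 0\<close> \<open>a < b\<close> uv n[unfolded h_def]] .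
    have "(?Z 0 v + Z v) - (?Z 0 u + Z u) = ?Z n v - ?Z n u + (\<Sum>m. ?e m)"
      using uv Zn[of v n] Zn[of u n] suminf_diff[OF su] by simp
    then have "\<bar>(?Z 0 v + Z v) - (?Z 0 u + Z u) - f u * (g v - g u)\<bar>
       \<le> 12 * A * B * (v - u) powr (2 * \<alpha>) + 6 * A * B * (v - u) powr (2 * \<alpha>) * (1 / (1 - \<rho>))"
      using tail base by linarith
    also have "\<dots> = K * (v - u) powr (2 * \<alpha>)" by (simp add: K_def algebra_simps)
    finally show ?thesis .
  qed simp
  then show ?thesis using K by (intro exI[of _ "\<lambda>v. ?Z 0 v + Z v"] exI[of _ K]) simp
qed

text \<open>Composition with the retraction of the line onto \<open>{a..b}\<close> extends Hoelder functions
  to the whole line with the same constant.\<close>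

lemma young_primitive:
  fixes f g :: "real \<Rightarrow> real"
  assumes "1/2 < \<alpha>" and f: "hoelder_on \<alpha> {a..b} f" and g: "hoelder_on \<alpha> {a..b} g"
  shows "\<exists>Z K. K \<ge> 0 \<and> (\<forall>u v. a \<le> u \<longrightarrow> u \<le> v \<longrightarrow> v \<le> b \<longrightarrow>
    \<bar>Z v - Z u - f u * (g v - g u)\<bar> \<le> K * (v - u) powr (2 * \<alpha>))"
proof (cases "a < b")
  case False
  then have "u = v" if "a \<le> u" "u \<le> v" "v \<le> b" for u v :: real using that by simp
  then have "\<bar>0 - 0 - f u * (g v - g u)\<bar> \<le> 0 * (v - u) powr (2 * \<alpha>)" if "a \<le> u" "u \<le> v" "v \<le> b" for u v
    using that by fastforce
  then show ?thesis by (intro exI[of _ "\<lambda>_. 0"] exI[of _ 0]) simp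
next
  case True
  let ?c = "\<lambda>t. max a (min b t)"
  have c: "?c t \<in> {a..b}" "\<bar>?c t - ?c s\<bar> \<le> \<bar>t - s\<bar>" for s t using True by auto
  have ext: "\<exists>C\<ge>0. \<forall>s t. \<bar>k (?c t) - k (?c s)\<bar> \<le> C * \<bar>t - s\<bar> powr \<alpha>"
    if k: "hoelder_on \<alpha> {a..b} k" for k :: "real \<Rightarrow> real"
  proof -
    obtain C where C: "C \<ge> 0" "\<And>s t. s \<in> {a..b} \<Longrightarrow> t \<in> {a..b} \<Longrightarrow> norm (k t - k s) \<le> C * \<bar>t - s\<bar> powr \<alpha>"
      using k unfolding hoelder_on_def by blast
    have "\<bar>k (?c t) - k (?c s)\<bar> \<le> C * \<bar>t - s\<bar> powr \<alpha>" for s t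
    proof -
      have "\<bar>k (?c t) - k (?c s)\<bar> \<le> C * \<bar>?c t - ?c s\<bar> powr \<alpha>"
        using C(2)[OF c(1) c(1)] by simp
      also have "\<dots> \<le> C * \<bar>t - s\<bar> powr \<alpha>"
        using C(1) c(2) assms(1) by (intro mult_left_mono powr_mono2) auto
      finally show ?thesis .
    qed
    then show ?thesis using C(1) by blast
  qed
  obtain A where A: "A \<ge> 0" "\<And>s t. \<bar>f (?c t) - f (?c s)\<bar> \<le> A * \<bar>t - s\<bar> powr \<alpha>"
    using ext[OF f] by blast
  obtain B where B: "B \<ge> 0" "\<And>s t. \<bar>g (?c t) - g (?c s)\<bar> \<le> B * \<bar>t - s\<bar> powr \<alpha>"
    using ext[OF g] by blast
  obtain Z K where ZK: "K \<ge> 0"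
    "\<forall>u v. a \<le> u \<longrightarrow> u \<le> v \<longrightarrow> v \<le> b \<longrightarrow>
       \<bar>Z v - Z u - f (?c u) * (g (?c v) - g (?c u))\<bar> \<le> K * (v - u) powr (2 * \<alpha>)"
    using young_primitive_real_line[where f = "\<lambda>t. f (?c t)" and g = "\<lambda>t. g (?c t)", OF assms(1) A(2) B(2) A(1) B(1) True]
    by (elim exE conjE)
  have "\<bar>Z v - Z u - f u * (g v - g u)\<bar> \<le> K * (v - u) powr (2 * \<alpha>)" if "a \<le> u" "u \<le> v" "v \<le> b" for u v
  proof -
    have "?c u = u" "?c v = v" using that by auto
    then show ?thesis using ZK(2)[rule_format, OF that] by simp
  qed
  then show ?thesis using ZK(1) by (intro exI[of _ Z] exI[of _ K]) simp
qed

lemma monotone_partition: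
  fixes \<tau> :: "nat \<Rightarrow> real"
  assumes "\<And>i. i < n \<Longrightarrow> \<tau> i \<le> \<tau> (Suc i)" "i \<le> j" "j \<le> n"
  shows "\<tau> i \<le> \<tau> j"
  using assms(2,3)
proof (induction rule: dec_induct)
  case (step j)
  then have "\<tau> i \<le> \<tau> j" "\<tau> j \<le> \<tau> (Suc j)" using assms(1)[of j] by auto
  then show ?case by linarith
qed simp

text \<open>Each term of a Riemann sum differs from the increment of the primitive by
  \<open>O((v - u) powr (2 * \<alpha>))\<close>, whatever the tag. The increments
  telescope, and the errors add up to at most a constant times
  \<open>(b - a) * \<delta> powr (2 * \<alpha> - 1)\<close> when the mesh is below
  \<open>\<delta>\<close>.\<close>

lemma has_RS_integral_young_primitive:
  assumes "1/2 < \<alpha>" "a \<le> b" and f: "hoelder_on \<alpha> {a..b} f" and g: "hoelder_on \<alpha> {a..b} g"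
    and K: "K \<ge> 0" and Z: "\<And>u v. a \<le> u \<Longrightarrow> u \<le> v \<Longrightarrow> v \<le> b \<Longrightarrow>
        \<bar>Z v - Z u - f u * (g v - g u)\<bar> \<le> K * (v - u) powr (2 * \<alpha>)"
  shows "has_RS_integral f g a b (Z b - Z a)"
  unfolding has_RS_integral_def
proof (intro allI impI)
  fix \<epsilon> :: real assume "\<epsilon> > 0"
  obtain A where A: "A \<ge> 0" "\<And>s t. s \<in> {a..b} \<Longrightarrow> t \<in> {a..b} \<Longrightarrow> norm (f t - f s) \<le> A * \<bar>t - s\<bar> powr \<alpha>"
    using f unfolding hoelder_on_def by blast
  obtain B where B: "B \<ge> 0" "\<And>s t. s \<in> {a..b} \<Longrightarrow> t \<in> {a..b} \<Longrightarrow> norm (g t - g s) \<le> B * \<bar>t - s\<bar> powr \<alpha>"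
    using g unfolding hoelder_on_def by blast
  \<comment> \<open>The total error is at most \<open>(E - 1) * \<delta> powr (2 * \<alpha> - 1)\<close>; the added \<open>1\<close> keeps the inequality strict and \<open>E\<close> positive.\<close>
  define E where "E = (A * B + K) * (b - a) + 1"
  have E: "E > 0" unfolding E_def using A B K assms by (smt (verit) mult_nonneg_nonneg)
  define \<delta> where "\<delta> = (\<epsilon> / E) powr (1 / (2 * \<alpha> - 1))"
  have \<delta>: "\<delta> > 0" "\<delta> powr (2 * \<alpha> - 1) = \<epsilon> / E"
    using \<open>\<epsilon> > 0\<close> E assms(1) by (auto simp: \<delta>_def powr_powr)
  have main: "\<bar>(\<Sum>i<n. f (\<xi> i) * (g (\<tau> (Suc i)) - g (\<tau> i))) - (Z b - Z a)\<bar> < \<epsilon>"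
    if \<tau>: "\<tau> 0 = a" "\<tau> n = b" and step: "\<And>i. i < n \<Longrightarrow> \<tau> i \<le> \<xi> i \<and> \<xi> i \<le> \<tau> (Suc i) \<and> \<tau> (Suc i) - \<tau> i < \<delta>"
    for n :: nat and \<tau> \<xi> :: "nat \<Rightarrow> real"
  proof -
    have mono: "\<tau> i \<le> \<tau> (Suc i)" if "i < n" for i using step[OF that] by linarith
    have rng: "\<tau> i \<in> {a..b}" if "i \<le> n" for i
      using monotone_partition[of n \<tau> 0 i] monotone_partition[of n \<tau> i n] mono \<tau> that by auto
    have piece: "\<bar>f (\<xi> i) * (g (\<tau> (Suc i)) - g (\<tau> i)) - (Z (\<tau> (Suc i)) - Z (\<tau> i))\<bar>
        \<le> (A * B + K) * (\<epsilon> / E) * (\<tau> (Suc i) - \<tau> i)" if i: "i < n" for i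
    proof -
      let ?u = "\<tau> i" and ?v = "\<tau> (Suc i)"
      note s = step[OF i]
      have r: "?u \<in> {a..b}" "?v \<in> {a..b}" using rng i by auto
      then have x: "\<xi> i \<in> {a..b}" using s by auto
      have "\<bar>f (\<xi> i) - f ?u\<bar> \<le> A * \<bar>\<xi> i - ?u\<bar> powr \<alpha>" using A(2)[OF r(1) x] by simp
      also have "\<dots> \<le> A * (?v - ?u) powr \<alpha>" using s A(1) assms(1) by (intro mult_left_mono powr_mono2) auto
      finally have "\<bar>(f (\<xi> i) - f ?u) * (g ?v - g ?u)\<bar> \<le> (A * (?v - ?u) powr \<alpha>) * (B * (?v - ?u) powr \<alpha>)"
        unfolding abs_mult using B(2)[OF r] s A(1) by (intro mult_mono) auto
      also have "\<dots> = A * B * (?v - ?u) powr (2 * \<alpha>)"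
        by (simp add: powr_add[symmetric] mult_ac)
      finally have "\<bar>f (\<xi> i) * (g ?v - g ?u) - (Z ?v - Z ?u)\<bar> \<le> (A * B + K) * (?v - ?u) powr (2 * \<alpha>)"
        using Z[of ?u ?v] r s by (simp add: algebra_simps abs_le_iff)
      also have "(?v - ?u) powr (2 * \<alpha>) \<le> (\<epsilon> / E) * (?v - ?u)"
      proof -
        have "(?v - ?u) powr (2 * \<alpha>) = (?v - ?u) powr (2 * \<alpha> - 1) * (?v - ?u)"
          using s by (cases "?v = ?u") (auto simp: powr_diff)
        also have "\<dots> \<le> \<delta> powr (2 * \<alpha> - 1) * (?v - ?u)"
          using s assms(1) by (intro mult_right_mono powr_mono2) auto
        finally show ?thesis using \<delta> by simp
      qed
      finally show ?thesis using A(1) B(1) K by (simp add: mult_left_mono mult.assoc)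
    qed
    have tele: "(\<Sum>i<n. Z (\<tau> (Suc i)) - Z (\<tau> i)) = Z b - Z a" "(\<Sum>i<n. \<tau> (Suc i) - \<tau> i) = b - a"
      by (simp_all add: sum_lessThan_telescope \<tau> sum_lessThan_telescope[of "\<lambda>i. Z (\<tau> i)"])
    have "\<bar>(\<Sum>i<n. f (\<xi> i) * (g (\<tau> (Suc i)) - g (\<tau> i))) - (Z b - Z a)\<bar>
        = \<bar>\<Sum>i<n. f (\<xi> i) * (g (\<tau> (Suc i)) - g (\<tau> i)) - (Z (\<tau> (Suc i)) - Z (\<tau> i))\<bar>"
      by (subst sum_subtractf) (simp only: tele)
    also have "\<dots> \<le> (\<Sum>i<n. (A * B + K) * (\<epsilon> / E) * (\<tau> (Suc i) - \<tau> i))"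
      by (intro order_trans[OF sum_abs] sum_mono piece) auto
    also have "\<dots> = (A * B + K) * (\<epsilon> / E) * (b - a)" by (simp only: sum_distrib_left[symmetric] tele)
    also have "\<dots> = \<epsilon> * ((E - 1) / E)" by (simp add: E_def)
    also have "\<dots> < \<epsilon> * 1" using E \<open>\<epsilon> > 0\<close> by (intro mult_strict_left_mono) auto
    finally show ?thesis by simp
  qed
  show "\<exists>\<delta>>0. \<forall>n \<tau> \<xi>. \<tau> 0 = a \<and> \<tau> n = b \<and> (\<forall>i<n. \<tau> i \<le> \<xi> i \<and> \<xi> i \<le> \<tau> (Suc i) \<and> \<tau> (Suc i) - \<tau> i < \<delta>) \<longrightarrow>
       \<bar>(\<Sum>i<n. f (\<xi> i) * (g (\<tau> (Suc i)) - g (\<tau> i))) - (Z b - Z a)\<bar> < \<epsilon>"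
    using \<delta>(1) main by (intro exI[of _ \<delta>]) auto
qed

lemma has_RS_integral_unique:
  assumes "a \<le> b" "has_RS_integral f g a b I" "has_RS_integral f g a b J"
  shows "I = J"
proof (rule ccontr)
  assume "I \<noteq> J"
  define \<epsilon> where "\<epsilon> = \<bar>I - J\<bar> / 2"
  have "\<epsilon> > 0" using \<open>I \<noteq> J\<close> by (simp add: \<epsilon>_def)
  obtain d where d: "d > 0" and
    I: "\<And>(n::nat) \<tau> \<xi>. \<tau> 0 = a \<and> \<tau> n = b \<and> (\<forall>i<n. \<tau> i \<le> \<xi> i \<and> \<xi> i \<le> \<tau> (Suc i) \<and> \<tau> (Suc i) - \<tau> i < d) \<Longrightarrow>
        \<bar>(\<Sum>i<n. f (\<xi> i) * (g (\<tau> (Suc i)) - g (\<tau> i))) - I\<bar> < \<epsilon>"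
    using assms(2)[unfolded has_RS_integral_def, rule_format, OF \<open>\<epsilon> > 0\<close>] by blast
  obtain e where e: "e > 0" and
    J: "\<And>(n::nat) \<tau> \<xi>. \<tau> 0 = a \<and> \<tau> n = b \<and> (\<forall>i<n. \<tau> i \<le> \<xi> i \<and> \<xi> i \<le> \<tau> (Suc i) \<and> \<tau> (Suc i) - \<tau> i < e) \<Longrightarrow>
        \<bar>(\<Sum>i<n. f (\<xi> i) * (g (\<tau> (Suc i)) - g (\<tau> i))) - J\<bar> < \<epsilon>"
    using assms(3)[unfolded has_RS_integral_def, rule_format, OF \<open>\<epsilon> > 0\<close>] by blast
  obtain N :: nat where "(b - a) / min d e < real N" using reals_Archimedean2 by blast
  define n where "n = Suc N"
  have n: "n > 0" "(b - a) / real n < min d e"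
  proof -
    have "(b - a) / min d e < real n" using \<open>_ < real N\<close> by (simp add: n_def)
    then have "b - a < real n * min d e" using d e by (simp add: pos_divide_less_eq)
    then show "(b - a) / real n < min d e"
      by (subst pos_divide_less_eq) (simp_all only: n_def of_nat_0_less_iff zero_less_Suc mult.commute)
  qed (simp add: n_def)
  define \<tau> where "\<tau> i = a + real i * ((b - a) / real n)" for i
  have st: "\<tau> (Suc i) - \<tau> i = (b - a) / real n" for i by (simp add: \<tau>_def distrib_right add_divide_distrib)
  have "0 \<le> (b - a) / real n" using assms(1) by simp
  then have "\<tau> i \<le> \<tau> (Suc i)" "\<tau> (Suc i) - \<tau> i < d" "\<tau> (Suc i) - \<tau> i < e" for i
    using st[of i] n by linarith+
  moreover have "\<tau> 0 = a" "\<tau> n = b" using n by (auto simp: \<tau>_def)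
  ultimately have "\<bar>(\<Sum>i<n. f (\<tau> i) * (g (\<tau> (Suc i)) - g (\<tau> i))) - I\<bar> < \<epsilon>"
    and "\<bar>(\<Sum>i<n. f (\<tau> i) * (g (\<tau> (Suc i)) - g (\<tau> i))) - J\<bar> < \<epsilon>"
    using I[of \<tau> n \<tau>] J[of \<tau> n \<tau>] by blast+
  moreover have "\<bar>I - J\<bar> \<le> \<bar>S - I\<bar> + \<bar>S - J\<bar>" for S by linarith
  ultimately show False unfolding \<epsilon>_def by (smt (verit) field_sum_of_halves)
qed

section \<open>Charts, tangent vectors and pull-backs\<close>

lemma
  assumes "smooth_manifold M" "(U, \<phi>) \<in> atlas M"
  shows chart_open: "openin (mfd_top M) U"
    and chart_subset: "U \<subseteq> points M"
    and chart_inj: "inj_on \<phi> U"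
    and chart_homeo: "homeomorphic_map (subtopology (mfd_top M) U) (top_of_set (\<phi> ` U)) \<phi>"
    and chart_image_open: "open (\<phi> ` U)"
proof -
  show *: "openin (mfd_top M) U" "homeomorphic_map (subtopology (mfd_top M) U) (top_of_set (\<phi> ` U)) \<phi>" "open (\<phi> ` U)"
    using assms unfolding smooth_manifold_def by auto
  show "U \<subseteq> points M" using * by (simp add: openin_subset)
  with * show "inj_on \<phi> U"
    using homeomorphic_imp_injective_map by (metis inf.absorb2 topspace_subtopology)
qed

lemma chart_open_image:
  assumes "smooth_manifold M" "(U, \<phi>) \<in> atlas M" "openin (mfd_top M) W" "W \<subseteq> U"
  shows "open (\<phi> ` W)"
proof -
  have "openin (subtopology (mfd_top M) U) W"
    using assms chart_open[OF assms(1,2)] by (simp add: openin_open_subtopology)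
  then have "openin (top_of_set (\<phi> ` U)) (\<phi> ` W)"
    using homeomorphic_imp_open_map[OF chart_homeo[OF assms(1,2)]] by (simp add: open_map_def)
  then show ?thesis using chart_image_open[OF assms(1,2)] by (simp add: openin_open_eq)
qed

lemma chart_open_image_Int:
  assumes "smooth_manifold M" "(U, \<phi>) \<in> atlas M" "openin (mfd_top M) W"
  shows "open (\<phi> ` (U \<inter> W))"
  using assms chart_open[OF assms(1,2)] by (intro chart_open_image[of M]) (auto intro: openin_Int)

lemma chart_continuous:
  assumes "smooth_manifold M" "(U, \<phi>) \<in> atlas M"
  shows "continuous_map (subtopology (mfd_top M) U) euclidean \<phi>"
  using homeomorphic_imp_continuous_map[OF chart_homeo[OF assms]] continuous_map_into_fulltopology by blast

lemma chart_open_vimage: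
  assumes "smooth_manifold M" "(U, \<phi>) \<in> atlas M" "open S"
  shows "openin (mfd_top M) {p \<in> U. \<phi> p \<in> S}"
proof -
  have "topspace (subtopology (mfd_top M) U) = U" using chart_subset[OF assms(1,2)] by auto
  then have "openin (subtopology (mfd_top M) U) {p \<in> U. \<phi> p \<in> S}"
    using openin_continuous_map_preimage[OF chart_continuous[OF assms(1,2)], of S] assms(3) by simp
  then show ?thesis using openin_open_subtopology[OF chart_open[OF assms(1,2)]] by blast
qed

lemma chart_inverse:
  assumes "smooth_manifold M" "(U, \<phi>) \<in> atlas M" "p \<in> U"
  shows "inv_into U \<phi> (\<phi> p) = p"
  using chart_inj[OF assms(1,2)] assms(3) by (rule inv_into_f_f)

lemma chart_exists:
  assumes "smooth_manifold M" "p \<in> points M"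
  obtains U \<phi> where "(U, \<phi>) \<in> atlas M" "p \<in> U"
proof -
  have "(\<Union>(U, \<phi>)\<in>atlas M. U) = points M" using assms(1) by (simp add: smooth_manifold_def)
  with assms(2) show ?thesis using that by (metis (no_types, lifting) UN_E case_prod_unfold prod.collapse)
qed

lemma smooth_map_continuous: "smooth_map M N F \<Longrightarrow> continuous_map (mfd_top M) (mfd_top N) F"
  by (simp add: smooth_map_def)

lemma smooth_map_points: "smooth_map M N F \<Longrightarrow> p \<in> points M \<Longrightarrow> F p \<in> points N"
  using smooth_map_continuous continuous_map_image_subset_topspace by blast

lemma smooth_map_vimage_open:
  assumes "smooth_manifold M" "smooth_map M N F" "(U, \<phi>) \<in> atlas M" "openin (mfd_top N) W"
  shows "openin (mfd_top M) (U \<inter> F -` W)"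
proof -
  have "openin (mfd_top M) {p \<in> points M. F p \<in> W}"
    using openin_continuous_map_preimage[OF smooth_map_continuous[OF assms(2)] assms(4)] .
  moreover have "U \<inter> F -` W = U \<inter> {p \<in> points M. F p \<in> W}" using chart_subset[OF assms(1,3)] by auto
  ultimately show ?thesis using chart_open[OF assms(1,3)] by (simp add: openin_Int)
qed

lemma smooth_map_in_charts:
  assumes "smooth_map M N F" "(U, \<phi>) \<in> atlas M" "(V, \<psi>) \<in> atlas N"
  shows "smooth_on (\<lambda>z. \<psi> (F (inv_into U \<phi> z))) (\<phi> ` (U \<inter> F -` V))"
  using assms unfolding smooth_map_def by (auto simp: o_def)

lemma smooth_map_id:
  assumes "smooth_manifold M"
  shows "smooth_map M M id"
  using assms unfolding smooth_map_def smooth_manifold_def by (auto simp: o_def)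

lemma smooth_nearD:
  assumes "smooth_near M p f"
  shows "\<exists>W. openin (mfd_top M) W \<and> p \<in> W \<and>
    (\<forall>U \<phi>. (U, \<phi>) \<in> atlas M \<longrightarrow> smooth_on (\<lambda>z. f (inv_into U \<phi> z)) (\<phi> ` (U \<inter> W)))"
proof -
  have "\<exists>W. openin (mfd_top M) W \<and> p \<in> W \<and>
    (\<forall>c\<in>atlas M. smooth_on (f \<circ> inv_into (fst c) (snd c)) (snd c ` (fst c \<inter> W)))"
    using assms unfolding smooth_near_def case_prod_beta .
  then show ?thesis unfolding o_def by (metis fst_conv snd_conv)
qed

lemma smooth_nearI:
  assumes "openin (mfd_top M) W" "p \<in> W"
    "\<And>U \<phi>. (U, \<phi>) \<in> atlas M \<Longrightarrow> smooth_on (\<lambda>z. f (inv_into U \<phi> z)) (\<phi> ` (U \<inter> W))"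
  shows "smooth_near M p f"
  using assms unfolding smooth_near_def by (auto simp: o_def)

lemma smooth_near_const:
  assumes "p \<in> points M"
  shows "smooth_near M p (\<lambda>q. c)"
  using assms by (intro smooth_nearI[of M "points M"]) (auto simp: smooth_on_const)

text \<open>Stated for an arbitrary pointwise operation so that sums and products share the intersection of
  neighbourhoods.\<close>

lemma smooth_near_binary:
  assumes M: "smooth_manifold M" and f: "smooth_near M p f" and g: "smooth_near M p g"
    and op: "\<And>S F G. open S \<Longrightarrow> smooth_on F S \<Longrightarrow> smooth_on G S \<Longrightarrow> smooth_on (\<lambda>z::'e::euclidean_space. op (F z) (G z)) S"
  shows "smooth_near (M :: ('a, 'e) manifold) p (\<lambda>q. op (f q) (g q))"
proof -
  obtain W1 where 1: "openin (mfd_top M) W1" "p \<in> W1"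
    "\<And>U \<phi>. (U, \<phi>) \<in> atlas M \<Longrightarrow> smooth_on (\<lambda>z. f (inv_into U \<phi> z)) (\<phi> ` (U \<inter> W1))"
    using smooth_nearD[OF f] by blast
  obtain W2 where 2: "openin (mfd_top M) W2" "p \<in> W2"
    "\<And>U \<phi>. (U, \<phi>) \<in> atlas M \<Longrightarrow> smooth_on (\<lambda>z. g (inv_into U \<phi> z)) (\<phi> ` (U \<inter> W2))"
    using smooth_nearD[OF g] by blast
  show ?thesis
  proof (rule smooth_nearI[of M "W1 \<inter> W2"])
    fix U \<phi> assume c: "(U, \<phi>) \<in> atlas M"
    show "smooth_on (\<lambda>z. op (f (inv_into U \<phi> z)) (g (inv_into U \<phi> z))) (\<phi> ` (U \<inter> (W1 \<inter> W2)))"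
    proof (rule op)
      show "open (\<phi> ` (U \<inter> (W1 \<inter> W2)))" using M c 1 2 by (intro chart_open_image_Int[of M]) auto
    qed (rule smooth_on_subset[OF 1(3)[OF c]], blast, rule smooth_on_subset[OF 2(3)[OF c]], blast)
  qed (use 1 2 in auto)
qed

lemma smooth_near_add:
  assumes "smooth_manifold M" "smooth_near M p f" "smooth_near M p g"
  shows "smooth_near M p (\<lambda>q. f q + g q)"
  using assms by (rule smooth_near_binary[where op = "\<lambda>x y. x + y"]) (rule smooth_on_add)

lemma smooth_near_mult:
  assumes "smooth_manifold M" "smooth_near M p f" "smooth_near M p g"
  shows "smooth_near M p (\<lambda>q. f q * g q)"
  using assms by (rule smooth_near_binary[where op = "\<lambda>x y. x * y"]) (rule smooth_on_mult)

lemma smooth_near_points: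
  assumes "smooth_near M p f"
  shows "p \<in> points M"
proof -
  obtain W where "openin (mfd_top M) W" "p \<in> W" using smooth_nearD[OF assms] by (elim exE conjE)
  then show ?thesis using openin_subset by blast
qed

lemma smooth_near_cmult:
  assumes "smooth_manifold M" "smooth_near M p f"
  shows "smooth_near M p (\<lambda>q. c * f q)"
  by (rule smooth_near_mult[OF assms(1) smooth_near_const[OF smooth_near_points[OF assms(2)]] assms(2)])

lemma smooth_near_differentiable:
  assumes "smooth_manifold M" "smooth_near M p f" "(U, \<phi>) \<in> atlas M" "p \<in> U"
  shows "(\<lambda>z. f (inv_into U \<phi> z)) differentiable (at (\<phi> p))"
proof -
  obtain W where W: "p \<in> W" "\<forall>U \<phi>. (U, \<phi>) \<in> atlas M \<longrightarrow> smooth_on (\<lambda>z. f (inv_into U \<phi> z)) (\<phi> ` (U \<inter> W))"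
    using smooth_nearD[OF assms(2)] by (elim exE conjE)
  have "\<phi> p \<in> \<phi> ` (U \<inter> W)" using assms(4) W(1) by blast
  then show ?thesis by (rule smooth_on_differentiable[OF W(2)[rule_format, OF assms(3)]])
qed

lemma smooth_near_coordinate:
  assumes M: "smooth_manifold M" and c: "(U, \<phi>) \<in> atlas M" and "p \<in> U"
  shows "smooth_near M p (\<lambda>q. \<phi> q \<bullet> i)"
proof (rule smooth_nearI)
  show "openin (mfd_top M) U" by (rule chart_open[OF M c])
  fix V \<psi> assume d: "(V, \<psi>) \<in> atlas M"
  have "smooth_on (\<lambda>z. \<phi> (inv_into V \<psi> z)) (\<psi> ` (V \<inter> U))"
    using M c d unfolding smooth_manifold_def by (auto simp: o_def)
  then show "smooth_on (\<lambda>z. \<phi> (inv_into V \<psi> z) \<bullet> i) (\<psi> ` (V \<inter> U))"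
    by (intro smooth_on_inner_left chart_open_image_Int[OF M d chart_open[OF M c]])
qed fact

text \<open>Near each point a chart of the target is inserted, so that the composite becomes one of smooth
  functions on open sets of Euclidean spaces.\<close>

lemma smooth_near_compose:
  assumes M: "smooth_manifold M" and N: "smooth_manifold N" and F: "smooth_map M N F"
    and p: "p \<in> points M" and f: "smooth_near N (F p) f"
  shows "smooth_near M p (\<lambda>q. f (F q))"
proof -
  obtain W where W: "openin (mfd_top N) W" "F p \<in> W"
    "\<And>V \<psi>. (V, \<psi>) \<in> atlas N \<Longrightarrow> smooth_on (\<lambda>z. f (inv_into V \<psi> z)) (\<psi> ` (V \<inter> W))"
    using smooth_nearD[OF f] by blast
  let ?W = "{q \<in> points M. F q \<in> W}"
  show ?thesis
  proof (rule smooth_nearI)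
    show "openin (mfd_top M) ?W"
      using openin_continuous_map_preimage[OF smooth_map_continuous[OF F] W(1)] .
    show "p \<in> ?W" using p W(2) by simp
    fix U \<phi> assume c: "(U, \<phi>) \<in> atlas M"
    show "smooth_on (\<lambda>z. f (F (inv_into U \<phi> z))) (\<phi> ` (U \<inter> ?W))"
    proof (rule smooth_on_local)
      fix y assume "y \<in> \<phi> ` (U \<inter> ?W)"
      then obtain q where q: "q \<in> U" "F q \<in> W" "q \<in> points M" "y = \<phi> q" by auto
      obtain V \<psi> where d: "(V, \<psi>) \<in> atlas N" "F q \<in> V"
        using chart_exists[OF N smooth_map_points[OF F q(3)]] .
      let ?S = "\<phi> ` (U \<inter> F -` (V \<inter> W))"
      have S: "open ?S"
        using chart_open[OF N d(1)] W(1)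
        by (intro chart_open_image[OF M c smooth_map_vimage_open[OF M F c]]) auto
      have "smooth_on (\<lambda>z. f (inv_into V \<psi> (\<psi> (F (inv_into U \<phi> z))))) ?S"
      proof (rule smooth_on_compose[OF S _ W(3)[OF d(1)]])
        show "smooth_on (\<lambda>z. \<psi> (F (inv_into U \<phi> z))) ?S"
          by (rule smooth_on_subset[OF smooth_map_in_charts[OF F c d(1)]]) auto
        show "(\<lambda>z. \<psi> (F (inv_into U \<phi> z))) ` ?S \<subseteq> \<psi> ` (V \<inter> W)"
          using chart_inverse[OF M c] by auto
      qed
      also have "smooth_on (\<lambda>z. f (inv_into V \<psi> (\<psi> (F (inv_into U \<phi> z))))) ?S
         \<longleftrightarrow> smooth_on (\<lambda>z. f (F (inv_into U \<phi> z))) ?S"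
        by (rule smooth_on_cong[OF S]) (auto simp: chart_inverse[OF M c] chart_inverse[OF N d(1)])
      finally show "\<exists>T. open T \<and> y \<in> T \<and> smooth_on (\<lambda>z. f (F (inv_into U \<phi> z))) T"
        using S q d(2) by (intro exI[of _ ?S]) auto
    qed
  qed
qed

lemma tangent_space_add:
  assumes "v \<in> tangent_space M p" "w \<in> tangent_space M p"
  shows "(\<lambda>f. v f + w f) \<in> tangent_space M p"
proof -
  have loc: "u f = u g" if "u \<in> tangent_space M p" "smooth_near M p f" "smooth_near M p g"
    "\<exists>W. openin (mfd_top M) W \<and> p \<in> W \<and> (\<forall>q\<in>W. f q = g q)" for u f g
    using that unfolding tangent_space_def by blast
  show ?thesis
    unfolding tangent_space_def mem_Collect_eq
  proof (intro conjI)
    show "\<forall>f g. smooth_near M p f \<and> smooth_near M p g \<and>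
        (\<exists>W. openin (mfd_top M) W \<and> p \<in> W \<and> (\<forall>q\<in>W. f q = g q)) \<longrightarrow> v f + w f = v g + w g"
    proof (intro allI impI, elim conjE)
      fix f g assume "smooth_near M p f" "smooth_near M p g"
        "\<exists>W. openin (mfd_top M) W \<and> p \<in> W \<and> (\<forall>q\<in>W. f q = g q)"
      from loc[OF assms(1) this] loc[OF assms(2) this] show "v f + w f = v g + w g" by simp
    qed
  qed (use assms in \<open>simp_all add: tangent_space_def algebra_simps\<close>)
qed

lemma tangent_space_scale:
  assumes "v \<in> tangent_space M p"
  shows "(\<lambda>f. c * v f) \<in> tangent_space M p"
  using assms unfolding tangent_space_def mem_Collect_eq
  by (intro conjI) (simp_all add: algebra_simps)

lemma tangent_space_zero: "(\<lambda>f. 0) \<in> tangent_space M p"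
  by (simp add: tangent_space_def)

lemma tangent_space_sum:
  assumes "\<And>j. j \<in> I \<Longrightarrow> v j \<in> tangent_space M p"
  shows "(\<lambda>f. \<Sum>j\<in>I. c j * v j f) \<in> tangent_space M p"
  using assms
proof (induction I rule: infinite_finite_induct)
  case (insert i I)
  then show ?case
    using tangent_space_add[OF tangent_space_scale[of "v i" M p "c i"], of "\<lambda>f. \<Sum>j\<in>I. c j * v j f"] by simp
qed (simp_all add: tangent_space_zero)

lemma coord_vector_apply:
  "coord_vector M (U, \<phi>) b p f =
     (if smooth_near M p f then frechet_derivative (\<lambda>z. f (inv_into U \<phi> z)) (at (\<phi> p)) b else 0)"
  by (simp add: coord_vector_def o_def)

lemma coord_vector_tangent:
  assumes M: "smooth_manifold M" and c: "(U, \<phi>) \<in> atlas M" and p: "p \<in> U"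
  shows "coord_vector M (U, \<phi>) b p \<in> tangent_space M p"
proof -
  let ?D = "\<lambda>f. frechet_derivative (\<lambda>z. f (inv_into U \<phi> z)) (at (\<phi> p))"
  have d: "((\<lambda>z. f (inv_into U \<phi> z)) has_derivative ?D f) (at (\<phi> p))" if "smooth_near M p f" for f
    using smooth_near_differentiable[OF M that c p] by (simp add: frechet_derivative_works)
  note inv = chart_inverse[OF M c p]
  show ?thesis
    unfolding tangent_space_def mem_Collect_eq coord_vector_apply
  proof (intro conjI allI impI; (elim conjE)?)
    fix f assume "\<not> smooth_near M p f"
    then show "(if smooth_near M p f then ?D f b else 0) = 0" by simp
  next
    fix f g assume f: "smooth_near M p f" and g: "smooth_near M p g"
    have "?D (\<lambda>q. f q + g q) = (\<lambda>v. ?D f v + ?D g v)"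
      by (rule frechet_derivative_at'[OF has_derivative_add[OF d[OF f] d[OF g]]])
    then show "(if smooth_near M p (\<lambda>q. f q + g q) then ?D (\<lambda>q. f q + g q) b else 0)
      = (if smooth_near M p f then ?D f b else 0) + (if smooth_near M p g then ?D g b else 0)"
      using f g smooth_near_add[OF M f g] by simp
    have "?D (\<lambda>q. f q * g q) = (\<lambda>v. f p * ?D g v + ?D f v * g p)"
      using frechet_derivative_at'[OF has_derivative_mult[OF d[OF f] d[OF g]]] by (simp only: inv)
    then show "(if smooth_near M p (\<lambda>q. f q * g q) then ?D (\<lambda>q. f q * g q) b else 0)
      = (if smooth_near M p f then ?D f b else 0) * g p + f p * (if smooth_near M p g then ?D g b else 0)"
      using f g smooth_near_mult[OF M f g] by simp
  next
    fix f k assume f: "smooth_near M p f"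
    have "?D (\<lambda>q. k * f q) = (\<lambda>v. k * ?D f v)"
      by (rule frechet_derivative_at'[OF has_derivative_mult_right[OF d[OF f]]])
    then show "(if smooth_near M p (\<lambda>q. k * f q) then ?D (\<lambda>q. k * f q) b else 0)
      = k * (if smooth_near M p f then ?D f b else 0)"
      using f smooth_near_cmult[OF M f] by simp
  next
    fix f g assume f: "smooth_near M p f" and g: "smooth_near M p g"
      and "\<exists>W. openin (mfd_top M) W \<and> p \<in> W \<and> (\<forall>q\<in>W. f q = g q)"
    then obtain W where W: "openin (mfd_top M) W" "p \<in> W" "\<And>q. q \<in> W \<Longrightarrow> f q = g q" by blast
    have "?D f = ?D g"
    proof (rule frechet_derivative_cong[OF chart_open_image_Int[OF M c W(1)]])
      show "\<phi> p \<in> \<phi> ` (U \<inter> W)" using p W(2) by blast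
    qed (auto simp: chart_inverse[OF M c] W(3))
    then show "(if smooth_near M p f then ?D f b else 0) = (if smooth_near M p g then ?D g b else 0)"
      using f g by simp
  qed
qed

lemma push_forward_tangent:
  assumes M: "smooth_manifold M" and N: "smooth_manifold N" and F: "smooth_map M N F"
    and p: "p \<in> points M" and v: "v \<in> tangent_space M p"
  shows "push_forward N F p v \<in> tangent_space N (F p)"
proof -
  note sn = smooth_near_compose[OF M N F p]
  have add: "v (\<lambda>q. f q + g q) = v f + v g" and mult: "v (\<lambda>q. f q * g q) = v f * g p + f p * v g"
    if "smooth_near M p f" "smooth_near M p g" for f g
    using v that unfolding tangent_space_def by auto
  have cmult: "v (\<lambda>q. k * f q) = k * v f" if "smooth_near M p f" for f k
    using v that unfolding tangent_space_def by auto
  have loc: "v f = v g" if "smooth_near M p f" "smooth_near M p g" "openin (mfd_top M) W" "p \<in> W"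
    "\<And>q. q \<in> W \<Longrightarrow> f q = g q" for f g W
    using v that unfolding tangent_space_def by blast
  have "v (\<lambda>q. f (F q)) = v (\<lambda>q. g (F q))"
    if "smooth_near N (F p) f" "smooth_near N (F p) g" "openin (mfd_top N) W" "F p \<in> W"
    "\<And>q. q \<in> W \<Longrightarrow> f q = g q" for f g W
  proof (rule loc[OF sn[OF that(1)] sn[OF that(2)] openin_continuous_map_preimage[OF smooth_map_continuous[OF F] that(3)]])
    show "p \<in> {q \<in> points M. F q \<in> W}" using p that(4) by simp
  qed (use that(5) in blast)
  note push_loc = this
  show ?thesis
    unfolding tangent_space_def mem_Collect_eq
  proof (intro conjI allI impI; (elim conjE exE)?)
    fix f assume "\<not> smooth_near N (F p) f"
    then show "push_forward N F p v f = 0" by (simp add: push_forward_def)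
  next
    fix f g assume f: "smooth_near N (F p) f" and g: "smooth_near N (F p) g"
    show "push_forward N F p v (\<lambda>q. f q + g q) = push_forward N F p v f + push_forward N F p v g"
      using f g smooth_near_add[OF N f g] add[OF sn[OF f] sn[OF g]] by (simp add: push_forward_def o_def)
    show "push_forward N F p v (\<lambda>q. f q * g q) =
        push_forward N F p v f * g (F p) + f (F p) * push_forward N F p v g"
      using f g smooth_near_mult[OF N f g] mult[OF sn[OF f] sn[OF g]] by (simp add: push_forward_def o_def)
  next
    fix f k assume f: "smooth_near N (F p) f"
    show "push_forward N F p v (\<lambda>q. k * f q) = k * push_forward N F p v f"
      using f smooth_near_cmult[OF N f] cmult[OF sn[OF f]] by (simp add: push_forward_def o_def)
  next
    fix f g W assume f: "smooth_near N (F p) f" and g: "smooth_near N (F p) g"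
      and "openin (mfd_top N) W" "F p \<in> W" "\<forall>q\<in>W. f q = g q"
    then show "push_forward N F p v f = push_forward N F p v g"
      using push_loc[of f g W] by (simp add: push_forward_def o_def)
  qed
qed

text \<open>The chain rule in coordinates: the coefficients are the columns of the Jacobian matrix of
  \<open>F\<close>. The identity also holds at functions that are not smooth, where both sides
  vanish by convention.\<close>

lemma push_forward_coord_vector:
  assumes M: "smooth_manifold M" and N: "smooth_manifold N" and F: "smooth_map M N F"
    and c: "(U, \<phi>) \<in> atlas M" and d: "(V, \<psi>) \<in> atlas N" and p: "p \<in> U" "F p \<in> V"
  shows "push_forward N F p (coord_vector M (U, \<phi>) b p) =
    (\<lambda>f. \<Sum>j\<in>Basis. (frechet_derivative (\<lambda>z. \<psi> (F (inv_into U \<phi> z))) (at (\<phi> p)) b \<bullet> j)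
        * coord_vector N (V, \<psi>) j (F p) f)"
proof
  fix f
  let ?H = "\<lambda>z. \<psi> (F (inv_into U \<phi> z))"
  let ?S = "\<phi> ` (U \<inter> F -` V)"
  have pM: "p \<in> points M" using p chart_subset[OF M c] by auto
  have S: "open ?S" "\<phi> p \<in> ?S"
    using p by (auto intro!: chart_open_image[OF M c smooth_map_vimage_open[OF M F c chart_open[OF N d]]])
  show "push_forward N F p (coord_vector M (U, \<phi>) b p) f = 
    (\<Sum>j\<in>Basis. (frechet_derivative ?H (at (\<phi> p)) b \<bullet> j) * coord_vector N (V, \<psi>) j (F p) f)"
  proof (cases "smooth_near N (F p) f")
    case False
    then show ?thesis by (simp add: push_forward_def coord_vector_apply)
  next
    case f: True
    let ?f = "\<lambda>w. f (inv_into V \<psi> w)"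
    have H: "?H (\<phi> p) = \<psi> (F p)" by (simp add: chart_inverse[OF M c p(1)])
    have fd: "?f differentiable (at (?H (\<phi> p)))"
      unfolding H by (rule smooth_near_differentiable[OF N f d p(2)])
    have Hd: "?H differentiable (at (\<phi> p))"
      by (rule smooth_on_differentiable[OF smooth_map_in_charts[OF F c d] S(2)])
    have "push_forward N F p (coord_vector M (U, \<phi>) b p) f
       = frechet_derivative (\<lambda>z. f (F (inv_into U \<phi> z))) (at (\<phi> p)) b"
      using f smooth_near_compose[OF M N F pM f] by (simp add: push_forward_def coord_vector_apply o_def)
    also have "frechet_derivative (\<lambda>z. f (F (inv_into U \<phi> z))) (at (\<phi> p))
        = frechet_derivative (\<lambda>z. ?f (?H z)) (at (\<phi> p))"
      by (rule frechet_derivative_cong[OF S]) (auto simp: chart_inverse[OF M c] chart_inverse[OF N d])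
    also have "\<dots> b = frechet_derivative ?f (at (?H (\<phi> p))) (frechet_derivative ?H (at (\<phi> p)) b)"
      by (rule frechet_derivative_chain[OF Hd fd])
    also have "\<dots> = (\<Sum>j\<in>Basis. (frechet_derivative ?H (at (\<phi> p)) b \<bullet> j) * frechet_derivative ?f (at (\<psi> (F p))) j)"
      unfolding H[symmetric] by (subst frechet_derivative_Basis[OF fd]) simp
    finally show ?thesis unfolding coord_vector_apply[of N] using f by simp
  qed
qed

lemma one_form_add:
  assumes "one_form M \<beta>" "p \<in> points M" "v \<in> tangent_space M p" "w \<in> tangent_space M p"
  shows "\<beta> p (\<lambda>f. v f + w f) = \<beta> p v + \<beta> p w"
  using assms unfolding one_form_def by blast

lemma one_form_scale:
  assumes "one_form M \<beta>" "p \<in> points M" "v \<in> tangent_space M p"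
  shows "\<beta> p (\<lambda>f. c * v f) = c * \<beta> p v"
  using assms unfolding one_form_def by blast

lemma one_form_coeff_smooth:
  assumes "one_form M \<beta>" "(U, \<phi>) \<in> atlas M" "b \<in> Basis"
  shows "smooth_on (\<lambda>z. \<beta> (inv_into U \<phi> z) (coord_vector M (U, \<phi>) b (inv_into U \<phi> z))) (\<phi> ` U)"
  using assms unfolding one_form_def by (auto simp: o_def)

lemma one_form_sum:
  assumes b: "one_form M \<beta>" "p \<in> points M" and "\<And>j. j \<in> I \<Longrightarrow> v j \<in> tangent_space M p"
  shows "\<beta> p (\<lambda>f. \<Sum>j\<in>I. c j * v j f) = (\<Sum>j\<in>I. c j * \<beta> p (v j))"
proof -
  have z: "\<beta> p (\<lambda>f. 0) = 0"
    using one_form_scale[OF b tangent_space_zero, of 0] by simp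
  show ?thesis using assms(3)
  proof (induction I rule: infinite_finite_induct)
    case (insert i I)
    then show ?case
      using one_form_add[OF b tangent_space_scale[of "v i" M p "c i"] tangent_space_sum[of I v M p c]]
        one_form_scale[OF b, of "v i" "c i"] by simp
  qed (simp_all add: z)
qed

lemma pull_back_coeff:
  assumes M: "smooth_manifold M" and N: "smooth_manifold N" and F: "smooth_map M N F" and b: "one_form N \<beta>"
    and c: "(U, \<phi>) \<in> atlas M" and d: "(V, \<psi>) \<in> atlas N" and p: "p \<in> U" "F p \<in> V"
  shows "pull_back N F \<beta> p (coord_vector M (U, \<phi>) b p) =
    (\<Sum>j\<in>Basis. (frechet_derivative (\<lambda>z. \<psi> (F (inv_into U \<phi> z))) (at (\<phi> p)) b \<bullet> j)
        * \<beta> (F p) (coord_vector N (V, \<psi>) j (F p)))"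
proof -
  have "F p \<in> points N" using p chart_subset[OF N d] by auto
  then show ?thesis
    unfolding pull_back_def push_forward_coord_vector[OF M N F c d p]
    by (intro one_form_sum[OF b] coord_vector_tangent[OF N d p(2)])
qed

text \<open>Near each point the coefficients are sums of products of entries of the Jacobian matrix with
  coefficients of \<open>\<beta>\<close> composed with \<open>F\<close>.\<close>

lemma one_form_pull_back:
  assumes M: "smooth_manifold M" and N: "smooth_manifold N" and F: "smooth_map M N F" and b: "one_form N \<beta>"
  shows "one_form M (pull_back N F \<beta>)"
  unfolding one_form_def
proof (intro conjI ballI allI; (clarify)?)
  fix p v w assume p: "p \<in> points M" and v: "v \<in> tangent_space M p" and w: "w \<in> tangent_space M p"
  have "push_forward N F p (\<lambda>f. v f + w f) = (\<lambda>f. push_forward N F p v f + push_forward N F p w f)"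
    by (auto simp: push_forward_def)
  then show "pull_back N F \<beta> p (\<lambda>f. v f + w f) = pull_back N F \<beta> p v + pull_back N F \<beta> p w"
    using one_form_add[OF b smooth_map_points[OF F p] push_forward_tangent[OF M N F p v] push_forward_tangent[OF M N F p w]]
    by (simp add: pull_back_def)
next
  fix p v k assume p: "p \<in> points M" and v: "v \<in> tangent_space M p"
  have "push_forward N F p (\<lambda>f. k * v f) = (\<lambda>f. k * push_forward N F p v f)"
    by (auto simp: push_forward_def)
  then show "pull_back N F \<beta> p (\<lambda>f. k * v f) = k * pull_back N F \<beta> p v"
    using one_form_scale[OF b smooth_map_points[OF F p] push_forward_tangent[OF M N F p v]]
    by (simp add: pull_back_def)
next
  fix U \<phi> and e :: 'b assume c: "(U, \<phi>) \<in> atlas M" and e: "e \<in> Basis"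
  let ?c = "\<lambda>z. pull_back N F \<beta> (inv_into U \<phi> z) (coord_vector M (U, \<phi>) e (inv_into U \<phi> z))"
  have "smooth_on ?c (\<phi> ` U)"
  proof (rule smooth_on_local)
    fix y assume "y \<in> \<phi> ` U"
    then obtain p where p: "p \<in> U" "y = \<phi> p" by auto
    then have "F p \<in> points N" using smooth_map_points[OF F] chart_subset[OF M c] by blast
    then obtain V \<psi> where d: "(V, \<psi>) \<in> atlas N" "F p \<in> V" using chart_exists[OF N] by metis
    let ?S = "\<phi> ` (U \<inter> F -` V)"
    let ?H = "\<lambda>z. \<psi> (F (inv_into U \<phi> z))"
    let ?b = "\<lambda>j w. \<beta> (inv_into V \<psi> w) (coord_vector N (V, \<psi>) j (inv_into V \<psi> w))"
    have S: "open ?S"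
      by (auto intro!: chart_open_image[OF M c smooth_map_vimage_open[OF M F c chart_open[OF N d(1)]]])
    have H: "smooth_on ?H ?S" by (rule smooth_map_in_charts[OF F c d(1)])
    have "smooth_on (\<lambda>z. \<Sum>j\<in>Basis. (frechet_derivative ?H (at z) e \<bullet> j) * ?b j (?H z)) ?S"
    proof -
      have 1: "smooth_on (\<lambda>z. frechet_derivative ?H (at z) e \<bullet> j) ?S" for j
        by (intro smooth_on_inner_left S smooth_on_derivative H)
      have 2: "smooth_on (\<lambda>z. ?b j (?H z)) ?S" if "j \<in> Basis" for j
        using chart_inverse[OF M c]
        by (intro smooth_on_compose[OF S H one_form_coeff_smooth[OF b d(1) that]]) auto
      show ?thesis
        by (intro smooth_on_sum smooth_on_mult S 1 2)
    qed
    also have "?this \<longleftrightarrow> smooth_on ?c ?S"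
    proof (rule smooth_on_cong[OF S])
      fix z assume "z \<in> ?S"
      then obtain q where q: "q \<in> U" "F q \<in> V" "z = \<phi> q" by auto
      show "(\<Sum>j\<in>Basis. (frechet_derivative ?H (at z) e \<bullet> j) * ?b j (?H z)) = ?c z"
        unfolding q(3) chart_inverse[OF M c q(1)] chart_inverse[OF N d(1) q(2)]
        by (rule pull_back_coeff[OF M N F b c d(1) q(1,2), symmetric])
    qed
    finally show "\<exists>T. open T \<and> y \<in> T \<and> smooth_on ?c T"
      using S p d(2) by (intro exI[of _ ?S]) auto
  qed
  then show "smooth_on ((\<lambda>p. pull_back N F \<beta> p (coord_vector M (U, \<phi>) e p)) \<circ> inv_into U \<phi>) (\<phi> ` U)"
    by (simp add: o_def)
qed

section \<open>The Riemannian distance dominates coordinate differences\<close>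

text \<open>The tangent vector whose coordinates in the chart \<open>c\<close> are those of
  \<open>v\<close>.\<close>

definition chart_vector ::
  "('a, 'e::euclidean_space) manifold \<Rightarrow> 'a set \<times> ('a \<Rightarrow> 'e) \<Rightarrow> 'a \<Rightarrow> 'e \<Rightarrow> 'a tangent" where
  "chart_vector M c p v = (\<lambda>f. \<Sum>i\<in>Basis. (v \<bullet> i) * coord_vector M c i p f)"

lemma chart_vector_tangent:
  assumes "smooth_manifold M" "(U, \<phi>) \<in> atlas M" "p \<in> U"
  shows "chart_vector M (U, \<phi>) p v \<in> tangent_space M p"
  unfolding chart_vector_def by (intro tangent_space_sum coord_vector_tangent assms)

text \<open>Applying a tangent vector to the coordinate functions recovers its coordinates; this gives the
  linear independence of the coordinate vectors.\<close>

lemma chart_vector_coordinate: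
  assumes M: "smooth_manifold M" and c: "(U, \<phi>) \<in> atlas M" and p: "p \<in> U"
  shows "chart_vector M (U, \<phi>) p v (\<lambda>q. \<phi> q \<bullet> i) = v \<bullet> i"
proof -
  have "frechet_derivative (\<lambda>z. \<phi> (inv_into U \<phi> z) \<bullet> i) (at (\<phi> p)) = frechet_derivative (\<lambda>z. z \<bullet> i) (at (\<phi> p))"
    using p by (intro frechet_derivative_cong[OF chart_image_open[OF M c]]) (auto simp: f_inv_into_f)
  also have "\<dots> = (\<lambda>k. k \<bullet> i)"
    by (rule frechet_derivative_at'[OF bounded_linear_imp_has_derivative[OF bounded_linear_inner_left]])
  finally have "chart_vector M (U, \<phi>) p v (\<lambda>q. \<phi> q \<bullet> i) = (\<Sum>k\<in>Basis. (v \<bullet> k) * (k \<bullet> i))"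
    using smooth_near_coordinate[OF M c p] by (simp add: chart_vector_def coord_vector_apply)
  also have "\<dots> = (\<Sum>k\<in>Basis. (v \<bullet> k) *\<^sub>R k) \<bullet> i" by (simp add: inner_sum_left)
  finally show ?thesis by (simp only: euclidean_representation)
qed

lemma chart_vector_nonzero:
  assumes "smooth_manifold M" "(U, \<phi>) \<in> atlas M" "p \<in> U" "v \<noteq> 0"
  shows "chart_vector M (U, \<phi>) p v \<noteq> (\<lambda>f. 0)"
proof
  assume "chart_vector M (U, \<phi>) p v = (\<lambda>f. 0)"
  then have "v \<bullet> i = 0" for i using chart_vector_coordinate[OF assms(1-3), of v i] by simp
  then show False using assms(4) by (metis inner_eq_zero_iff)
qed

lemma metric_sum_left:
  assumes g: "riemannian_metric M g" and p: "p \<in> points M" and w: "w \<in> tangent_space M p"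
    and v: "\<And>j. j \<in> I \<Longrightarrow> v j \<in> tangent_space M p"
  shows "g p (\<lambda>f. \<Sum>j\<in>I. c j * v j f) w = (\<Sum>j\<in>I. c j * g p (v j) w)"
proof -
  have add: "g p (\<lambda>f. u f + u' f) w = g p u w + g p u' w" and scale: "g p (\<lambda>f. k * u f) w = k * g p u w"
    if "u \<in> tangent_space M p" "u' \<in> tangent_space M p" for u u' k
    using g p w that unfolding riemannian_metric_def by blast+
  have z: "g p (\<lambda>f. 0) w = 0"
    using scale[OF tangent_space_zero tangent_space_zero, of 0] by simp
  show ?thesis using v
  proof (induction I rule: infinite_finite_induct)
    case (insert i I)
    then show ?case
      using add[OF tangent_space_scale[of "v i" M p "c i"] tangent_space_sum[of I v M p c]]
        scale[of "v i" "v i" "c i"] by simp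
  qed (simp_all add: z)
qed

lemma metric_chart_vector:
  assumes M: "smooth_manifold M" and g: "riemannian_metric M g" and c: "(U, \<phi>) \<in> atlas M" and p: "p \<in> U"
  shows "g p (chart_vector M (U, \<phi>) p v) (chart_vector M (U, \<phi>) p v) =
    (\<Sum>i\<in>Basis. (v \<bullet> i) * (\<Sum>j\<in>Basis. (v \<bullet> j) * g p (coord_vector M (U, \<phi>) j p) (coord_vector M (U, \<phi>) i p)))"
proof -
  have pM: "p \<in> points M" using p chart_subset[OF M c] by auto
  have sym: "g p u w = g p w u" if "u \<in> tangent_space M p" "w \<in> tangent_space M p" for u w
    using g pM that unfolding riemannian_metric_def by blast
  note t = chart_vector_tangent[OF M c p] coord_vector_tangent[OF M c p]
  have expand: "g p (chart_vector M (U, \<phi>) p v) w = (\<Sum>j\<in>Basis. (v \<bullet> j) * g p (coord_vector M (U, \<phi>) j p) w)"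
    if "w \<in> tangent_space M p" for w
    unfolding chart_vector_def by (rule metric_sum_left[OF g pM that t(2)])
  show ?thesis
    unfolding expand[OF t(1)] by (simp only: sym[OF t(2) t(1)] expand[OF t(2)])
qed

text \<open>On \<open>A\<close>, Riemannian lengths are at least \<open>m\<close> times the Euclidean
  lengths seen in the chart.\<close>

definition chart_metric_bound ::
  "('a, 'e::euclidean_space) manifold \<Rightarrow> ('a \<Rightarrow> 'a tangent \<Rightarrow> 'a tangent \<Rightarrow> real) \<Rightarrow>
    'a set \<times> ('a \<Rightarrow> 'e) \<Rightarrow> real \<Rightarrow> 'a set \<Rightarrow> bool" where
  "chart_metric_bound M g c m A \<longleftrightarrow> 0 < m \<and> A \<subseteq> fst c \<and>
     (\<forall>p\<in>A. \<forall>v. (m * norm v)\<^sup>2 \<le> g p (chart_vector M c p v) (chart_vector M c p v))"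

text \<open>The coordinate expression of the metric is a continuous positive function on the compact product
  of the closed ball with the unit sphere; its minimum is the square of the required constant,
  and the rest is homogeneity.\<close>

lemma metric_lower_bound:
  fixes \<phi> :: "'a \<Rightarrow> 'e::euclidean_space"
  assumes M: "smooth_manifold M" and g: "riemannian_metric M g" and c: "(U, \<phi>) \<in> atlas M"
    and R: "R > 0" "cball y0 R \<subseteq> \<phi> ` U"
  shows "\<exists>m. chart_metric_bound M g (U, \<phi>) m {p \<in> U. \<phi> p \<in> cball y0 R}"
proof -
  define G where "G j i y = g (inv_into U \<phi> y) (coord_vector M (U, \<phi>) j (inv_into U \<phi> y))
      (coord_vector M (U, \<phi>) i (inv_into U \<phi> y))" for i j y
  define Q where "Q y v = (\<Sum>i\<in>Basis. (v \<bullet> i) * (\<Sum>j\<in>Basis. (v \<bullet> j) * G j i y))" for y v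
  have Q: "g p (chart_vector M (U, \<phi>) p v) (chart_vector M (U, \<phi>) p v) = Q (\<phi> p) v" if "p \<in> U" for p v
    unfolding Q_def G_def metric_chart_vector[OF M g c that] chart_inverse[OF M c that] ..
  have Gc: "continuous_on (\<phi> ` U) (G j i)" if "i \<in> Basis" "j \<in> Basis" for i j
  proof (rule smooth_on_continuous)
    show "smooth_on (G j i) (\<phi> ` U)"
      using g c that unfolding riemannian_metric_def G_def[abs_def] by (auto simp: o_def)
  qed
  define K where "K = cball y0 R \<times> sphere (0::'e) 1"
  have "compact K" unfolding K_def by (intro compact_Times compact_cball compact_sphere)
  moreover have "K \<noteq> {}"
  proof -
    have "(y0, SOME b. b \<in> Basis) \<in> K" using R norm_Basis[OF SOME_Basis] by (simp add: K_def)
    then show ?thesis by blast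
  qed
  moreover have "continuous_on K (\<lambda>z. Q (fst z) (snd z))"
  proof -
    have "continuous_on K (\<lambda>z. G j i (fst z))" if "i \<in> Basis" "j \<in> Basis" for i j
      using R(2) by (intro continuous_on_compose2[OF Gc[OF that]] continuous_intros) (auto simp: K_def)
    then show ?thesis unfolding Q_def by (intro continuous_intros) auto
  qed
  ultimately obtain z where z: "z \<in> K" "\<And>w. w \<in> K \<Longrightarrow> Q (fst z) (snd z) \<le> Q (fst w) (snd w)"
    using continuous_attains_inf[of K "\<lambda>z. Q (fst z) (snd z)"] by blast
  define m where "m = Q (fst z) (snd z)"
  have "m > 0"
  proof -
    obtain p where p: "p \<in> U" "fst z = \<phi> p" using z(1) R(2) by (auto simp: K_def)
    have pM: "p \<in> points M" using p chart_subset[OF M c] by auto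
    have "snd z \<noteq> 0" using z(1) by (auto simp: K_def)
    then have "g p (chart_vector M (U, \<phi>) p (snd z)) (chart_vector M (U, \<phi>) p (snd z)) > 0"
      using g pM chart_vector_nonzero[OF M c p(1)] chart_vector_tangent[OF M c p(1)]
      unfolding riemannian_metric_def by blast
    then show ?thesis unfolding Q[OF p(1)] m_def p(2) .
  qed
  have "m * (norm v)\<^sup>2 \<le> Q y v" if y: "y \<in> cball y0 R" for y v
  proof (cases "v = 0")
    case True then show ?thesis by (simp add: Q_def)
  next
    case False
    let ?u = "v /\<^sub>R norm v"
    have "(y, ?u) \<in> K" using y False by (simp add: K_def)
    then have "m \<le> Q y ?u" using z(2) unfolding m_def by fastforce
    moreover have "Q y v = (norm v)\<^sup>2 * Q y ?u"
    proof -
      have "v = norm v *\<^sub>R ?u" using False by simp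
      then have "Q y v = Q y (norm v *\<^sub>R ?u)" by simp
      also have "Q y (k *\<^sub>R u) = k\<^sup>2 * Q y u" for k u
        unfolding Q_def by (simp add: sum_distrib_left power2_eq_square mult_ac)
      finally show ?thesis .
    qed
    moreover have "(norm v)\<^sup>2 * m \<le> (norm v)\<^sup>2 * Q y ?u" if "m \<le> Q y ?u"
      using that by (intro mult_left_mono) auto
    ultimately show ?thesis by (simp add: mult.commute)
  qed
  then have "chart_metric_bound M g (U, \<phi>) (sqrt m) {p \<in> U. \<phi> p \<in> cball y0 R}"
    unfolding chart_metric_bound_def using Q \<open>m > 0\<close> by (auto simp: power_mult_distrib)
  then show ?thesis by blast
qed

text \<open>The chain rule: both sides send a function \<open>f\<close> that is smooth near
  \<open>\<gamma> t\<close> to the derivative of its coordinate expression in direction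
  \<open>D\<close>.\<close>

lemma velocity_in_chart:
  assumes M: "smooth_manifold M" and c: "(U, \<phi>) \<in> atlas M"
    and \<gamma>: "continuous_map (top_of_set {a..b}) (mfd_top M) \<gamma>" and t: "t \<in> {a<..<b}" "\<gamma> t \<in> U"
    and D: "((\<phi> \<circ> \<gamma>) has_vector_derivative D) (at t within {a..b})"
  shows "velocity M \<gamma> t = chart_vector M (U, \<phi>) (\<gamma> t) D"
proof
  fix f
  show "velocity M \<gamma> t f = chart_vector M (U, \<phi>) (\<gamma> t) D f"
  proof (cases "smooth_near M (\<gamma> t) f")
    case False
    then show ?thesis by (simp add: velocity_def chart_vector_def coord_vector_apply)
  next
    case f: True
    let ?f = "\<lambda>z. f (inv_into U \<phi> z)"
    let ?D = "frechet_derivative ?f (at (\<phi> (\<gamma> t)))"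
    have fd: "?f differentiable (at (\<phi> (\<gamma> t)))" by (rule smooth_near_differentiable[OF M f c t(2)])
    have "at t within {a..b} = at t" using t by (intro at_within_Icc_at) auto
    then have "((\<phi> \<circ> \<gamma>) has_derivative (\<lambda>h. h *\<^sub>R D)) (at t)" using D by (simp add: has_vector_derivative_def)
    then have "((?f \<circ> (\<phi> \<circ> \<gamma>)) has_derivative (?D \<circ> (\<lambda>h. h *\<^sub>R D))) (at t)"
      using fd by (intro diff_chain_at) (auto simp: frechet_derivative_works)
    moreover have "?D \<circ> (\<lambda>h. h *\<^sub>R D) = (\<lambda>h. h *\<^sub>R ?D D)"
      using linear_cmul[OF linear_frechet_derivative[OF fd]] by (auto simp: o_def)
    ultimately have 1: "((?f \<circ> (\<phi> \<circ> \<gamma>)) has_vector_derivative ?D D) (at t)"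
      by (simp add: has_vector_derivative_def)
    have "openin (top_of_set {a..b}) {s \<in> {a..b}. \<gamma> s \<in> U}"
      using openin_continuous_map_preimage[OF \<gamma> chart_open[OF M c]] by simp
    then obtain S where S: "open S" "{s \<in> {a..b}. \<gamma> s \<in> U} = {a..b} \<inter> S"
      unfolding openin_open by (elim exE conjE)
    have "((f \<circ> \<gamma>) has_vector_derivative ?D D) (at t)"
    proof (rule has_vector_derivative_transform_within_open[OF 1])
      show "open ({a<..<b} \<inter> S)" using S(1) by auto
      have "t \<in> {s \<in> {a..b}. \<gamma> s \<in> U}" using t by simp
      then show "t \<in> {a<..<b} \<inter> S" unfolding S(2) using t by blast
      fix s assume s: "s \<in> {a<..<b} \<inter> S"
      then have "s \<in> {a..b} \<inter> S" by simp
      then have "\<gamma> s \<in> U" unfolding S(2)[symmetric] by blast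
      then show "(?f \<circ> (\<phi> \<circ> \<gamma>)) s = (f \<circ> \<gamma>) s" by (simp add: chart_inverse[OF M c])
    qed
    then have "velocity M \<gamma> t f = ?D D" using f by (simp add: velocity_def vector_derivative_at)
    also have "\<dots> = (\<Sum>i\<in>Basis. (D \<bullet> i) * ?D i)" by (subst frechet_derivative_Basis[OF fd]) simp
    finally show ?thesis using f by (simp add: chart_vector_def coord_vector_apply)
  qed
qed

abbreviation speed ::
  "('a, 'e::euclidean_space) manifold \<Rightarrow> ('a \<Rightarrow> 'a tangent \<Rightarrow> 'a tangent \<Rightarrow> real) \<Rightarrow> (real \<Rightarrow> 'a) \<Rightarrow> real \<Rightarrow> ennreal" where
  "speed M g \<gamma> \<equiv> \<lambda>t. ennreal (sqrt (g (\<gamma> t) (velocity M \<gamma> t) (velocity M \<gamma> t)))"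

text \<open>The speed of a curve is not evidently measurable, so its integral is not evidently additive over
  intervals. It is therefore bounded from below through a measurable function \<open>G\<close>
  below it; the support in the interval allows such functions for adjacent intervals to be
  added.\<close>

definition length_minorant :: "(real \<Rightarrow> ennreal) \<Rightarrow> real \<Rightarrow> real \<Rightarrow> ennreal \<Rightarrow> bool" where
  "length_minorant F a b l \<longleftrightarrow> (\<exists>G. G \<in> borel_measurable lborel \<and> (\<forall>t. G t \<le> F t) \<and>
     (\<forall>t. t \<notin> {a<..<b} \<longrightarrow> G t = 0) \<and> l \<le> (\<integral>\<^sup>+t. G t \<partial>lborel))"

lemma length_minorant_combine:
  assumes "length_minorant F a b l" "length_minorant F b c l'" "a \<le> b" "b \<le> c"
  shows "length_minorant F a c (l + l')"
proof -
  obtain G where G: "G \<in> borel_measurable lborel" "\<And>t. G t \<le> F t" "\<And>t. t \<notin> {a<..<b} \<Longrightarrow> G t = 0"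
    "l \<le> (\<integral>\<^sup>+t. G t \<partial>lborel)" using assms(1) unfolding length_minorant_def by blast
  obtain H where H: "H \<in> borel_measurable lborel" "\<And>t. H t \<le> F t" "\<And>t. t \<notin> {b<..<c} \<Longrightarrow> H t = 0"
    "l' \<le> (\<integral>\<^sup>+t. H t \<partial>lborel)" using assms(2) unfolding length_minorant_def by blast
  have "G t + H t \<le> F t" for t
    using G(2,3)[of t] H(2,3)[of t] by (cases "t \<in> {a<..<b}") auto
  moreover have "G t + H t = 0" if "t \<notin> {a<..<c}" for t
    using G(3)[of t] H(3)[of t] that assms(3,4) by auto
  moreover have "l + l' \<le> (\<integral>\<^sup>+t. G t + H t \<partial>lborel)"
    using G(1,4) H(1,4) by (simp add: nn_integral_add add_mono)
  ultimately show ?thesis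
    unfolding length_minorant_def using G(1) H(1) by (intro exI[of _ "\<lambda>t. G t + H t"]) auto
qed

lemma length_minorant_mono: "length_minorant F a b l \<Longrightarrow> l' \<le> l \<Longrightarrow> length_minorant F a b l'"
  unfolding length_minorant_def by (meson order_trans)

lemma length_minorant_zero: "length_minorant F a b 0"
  unfolding length_minorant_def by (intro exI[of _ "\<lambda>_. 0"]) auto

text \<open>The minorant is \<open>m\<close> times the norm of the coordinate velocity, which is continuous;
  the displacement is the integral of that velocity.\<close>

lemma length_minorant_C1:
  fixes \<phi> :: "'a \<Rightarrow> 'e::euclidean_space"
  assumes M: "smooth_manifold M" and c: "(U, \<phi>) \<in> atlas M"
    and mb: "chart_metric_bound M g (U, \<phi>) m A"
    and \<gamma>: "C1_curve M \<gamma> a b" and "a \<le> b" and A: "\<gamma> ` {a..b} \<subseteq> A"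
  shows "length_minorant (speed M g \<gamma>) a b
     (ennreal (m * norm (\<phi> (\<gamma> b) - \<phi> (\<gamma> a))))"
proof -
  have m: "m > 0" and AU: "A \<subseteq> U"
    and bound: "\<And>p v. p \<in> A \<Longrightarrow>
       (m * norm v)\<^sup>2 \<le> g p (chart_vector M (U, \<phi>) p v) (chart_vector M (U, \<phi>) p v)"
    using mb by (auto simp: chart_metric_bound_def)
  have full: "{a..b} \<inter> \<gamma> -` U = {a..b}" using A AU by auto
  have "\<exists>D. (\<forall>s\<in>{a..b} \<inter> \<gamma> -` U. ((\<phi> \<circ> \<gamma>) has_vector_derivative D s) (at s within {a..b})) \<and>
      continuous_on ({a..b} \<inter> \<gamma> -` U) D"
    using \<gamma> c unfolding C1_curve_def by fastforce
  then obtain D where D: "\<And>s. s \<in> {a..b} \<Longrightarrow> ((\<phi> \<circ> \<gamma>) has_vector_derivative D s) (at s within {a..b})"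
    "continuous_on {a..b} D" unfolding full by blast
  let ?N = "\<lambda>t. m * norm (D t)"
  let ?G = "\<lambda>t. ennreal (?N t) * indicator {a<..<b} t"
  have Nc: "continuous_on {a..b} ?N" using D(2) by (intro continuous_intros)
  have int: "(?N has_integral integral {a..b} ?N) {a<..<b}"
    using integrable_integral[OF integrable_continuous_real[OF Nc]] has_integral_Icc_iff_Ioo by blast
  have "m * norm (\<phi> (\<gamma> b) - \<phi> (\<gamma> a)) \<le> integral {a..b} ?N"
  proof -
    have "(D has_integral ((\<phi> \<circ> \<gamma>) b - (\<phi> \<circ> \<gamma>) a)) {a..b}"
      by (rule fundamental_theorem_of_calculus[OF \<open>a \<le> b\<close> D(1)])
    then have eq: "\<phi> (\<gamma> b) - \<phi> (\<gamma> a) = integral {a..b} D" by (simp add: integral_unique)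
    have "norm (integral {a..b} D) \<le> integral {a..b} (\<lambda>t. norm (D t))"
      using D(2) by (intro integral_norm_bound_integral integrable_continuous_real continuous_intros) auto
    then show ?thesis using m by (simp add: eq)
  qed
  moreover have "(\<integral>\<^sup>+t. ?G t \<partial>lborel) = ennreal (integral {a..b} ?N)"
    using m by (intro nn_integral_has_integral_lebesgue'[OF _ int]) auto
  moreover have "?G \<in> borel_measurable lborel"
  proof -
    have "(\<lambda>t. indicator {a<..<b} t *\<^sub>R ?N t) \<in> borel_measurable borel"
      using Nc by (intro borel_measurable_continuous_on_indicator) (auto intro: continuous_on_subset)
    then have "(\<lambda>t. ennreal (indicator {a<..<b} t *\<^sub>R ?N t)) \<in> borel_measurable lborel" by simp
    also have "(\<lambda>t. ennreal (indicator {a<..<b} t *\<^sub>R ?N t)) = ?G"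
      by (auto simp: indicator_def)
    finally show ?thesis .
  qed
  moreover have "?G t \<le> speed M g \<gamma> t" for t
  proof (cases "t \<in> {a<..<b}")
    case True
    then have t: "\<gamma> t \<in> A" "t \<in> {a..b}" using A by auto
    have "velocity M \<gamma> t = chart_vector M (U, \<phi>) (\<gamma> t) (D t)"
      using \<gamma> t A AU True by (intro velocity_in_chart[OF M c _ _ _ D(1)[OF t(2)]]) (auto simp: C1_curve_def)
    then have "?N t \<le> sqrt (g (\<gamma> t) (velocity M \<gamma> t) (velocity M \<gamma> t))"
      using bound[OF t(1), of "D t"] by (simp add: real_le_rsqrt)
    then show ?thesis using True by (simp add: ennreal_leI)
  qed simp
  ultimately show ?thesis
    unfolding length_minorant_def by (intro exI[of _ ?G]) (auto simp: ennreal_leI)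
qed

text \<open>Bisection (\<open>Bolzano\<close>) replaces an enumeration of the break points: near each time
  at most that time itself is a break point, and then the curve is continuously differentiable
  on either side.\<close>

lemma length_minorant_piecewise_C1:
  fixes \<phi> :: "'a \<Rightarrow> 'e::euclidean_space"
  assumes M: "smooth_manifold M" and c: "(U, \<phi>) \<in> atlas M"
    and mb: "chart_metric_bound M g (U, \<phi>) m A"
    and \<gamma>: "piecewise_C1_curve M \<gamma>" and s: "0 \<le> s" "s \<le> 1" and A: "\<gamma> ` {0..s} \<subseteq> A"
  shows "length_minorant (speed M g \<gamma>) 0 s
     (ennreal (m * norm (\<phi> (\<gamma> s) - \<phi> (\<gamma> 0))))"
proof -
  let ?F = "speed M g \<gamma>"
  have m: "m > 0" using mb by (simp add: chart_metric_bound_def)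
  let ?l = "\<lambda>a b. ennreal (m * norm (\<phi> (\<gamma> b) - \<phi> (\<gamma> a)))"
  obtain S where S: "finite S"
    "\<forall>a b. 0 \<le> a \<and> a < b \<and> b \<le> 1 \<and> {a<..<b} \<inter> S = {} \<longrightarrow> C1_curve M \<gamma> a b"
    using \<gamma> unfolding piecewise_C1_curve_def by (elim conjE exE)
  have comb: "length_minorant ?F a e (?l a e)"
    if "length_minorant ?F a b (?l a b)" "length_minorant ?F b e (?l b e)" "a \<le> b" "b \<le> e" for a b e
  proof (rule length_minorant_mono[OF length_minorant_combine[OF that]])
    have "norm (\<phi> (\<gamma> e) - \<phi> (\<gamma> a)) \<le> norm (\<phi> (\<gamma> b) - \<phi> (\<gamma> a)) + norm (\<phi> (\<gamma> e) - \<phi> (\<gamma> b))"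
      using norm_triangle_ineq[of "\<phi> (\<gamma> b) - \<phi> (\<gamma> a)" "\<phi> (\<gamma> e) - \<phi> (\<gamma> b)"] by simp
    then have "m * norm (\<phi> (\<gamma> e) - \<phi> (\<gamma> a)) \<le> m * norm (\<phi> (\<gamma> b) - \<phi> (\<gamma> a)) + m * norm (\<phi> (\<gamma> e) - \<phi> (\<gamma> b))"
      using m by (simp add: distrib_left[symmetric])
    then show "?l a e \<le> ?l a b + ?l b e"
      using m by (simp add: ennreal_plus[symmetric] ennreal_leI del: ennreal_plus)
  qed
  have piece: "length_minorant ?F a b (?l a b)"
    if "0 \<le> a" "a \<le> b" "b \<le> s" "{a<..<b} \<inter> S = {}" for a b
  proof (cases "a = b")
    case True
    then show ?thesis by (simp add: length_minorant_zero)
  next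
    case False
    have "{a..b} \<subseteq> {0..s}" using that by auto
    then have sub: "\<gamma> ` {a..b} \<subseteq> A" using A by (rule subset_trans[OF image_mono])
    have C1: "C1_curve M \<gamma> a b" using that False s by (intro S(2)[rule_format]) simp
    show ?thesis by (rule length_minorant_C1[OF M c mb C1 that(2) sub])
  qed
  define P where "P a b \<longleftrightarrow> (0 \<le> a \<longrightarrow> b \<le> s \<longrightarrow> length_minorant ?F a b (?l a b))" for a b
  have "P 0 s"
    using s(1)
  proof (rule Bolzano)
    fix a b e assume "P a b" "P b e" "a \<le> b" "b \<le> e"
    then show "P a e" unfolding P_def by (intro impI comb[of a b e]) auto
  next
    fix t
    obtain d where d: "d > 0" "\<forall>x\<in>S. x \<noteq> t \<longrightarrow> d \<le> dist t x" using finite_set_avoid[OF S(1)] by blast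
    have "length_minorant ?F a b (?l a b)" if "a \<le> t" "t \<le> b" "b - a < d" "0 \<le> a" "b \<le> s" for a b
    proof (rule comb[OF piece piece that(1,2)])
      show "{a<..<t} \<inter> S = {}"
      proof (rule equals0I)
        fix y assume "y \<in> {a<..<t} \<inter> S"
        then have "y \<in> S" "y \<noteq> t" "a < y" "y < t" by auto
        then show False using d(2)[rule_format, of y] that by (simp add: dist_real_def)
      qed
      show "{t<..<b} \<inter> S = {}"
      proof (rule equals0I)
        fix y assume "y \<in> {t<..<b} \<inter> S"
        then have "y \<in> S" "y \<noteq> t" "t < y" "y < b" by auto
        then show False using d(2)[rule_format, of y] that by (simp add: dist_real_def)
      qed
    qed (use that in linarith)+
    then show "\<exists>d>0. \<forall>a b. a \<le> t \<and> t \<le> b \<and> b - a < d \<longrightarrow> P a b"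
      unfolding P_def using d(1) by (intro exI[of _ d]) simp
  qed
  then show ?thesis unfolding P_def by simp
qed

lemma curve_length_lower_bound:
  fixes \<phi> :: "'a \<Rightarrow> 'e::euclidean_space"
  assumes M: "smooth_manifold M" and c: "(U, \<phi>) \<in> atlas M"
    and mb: "chart_metric_bound M g (U, \<phi>) m A"
    and \<gamma>: "piecewise_C1_curve M \<gamma>" and s: "0 \<le> s" "s \<le> 1" and A: "\<gamma> ` {0..s} \<subseteq> A"
  shows "ennreal (m * norm (\<phi> (\<gamma> s) - \<phi> (\<gamma> 0))) \<le> curve_length M g \<gamma>"
proof -
  obtain G where G: "\<And>t. G t \<le> speed M g \<gamma> t"
    "\<And>t. t \<notin> {0<..<s} \<Longrightarrow> G t = 0" "ennreal (m * norm (\<phi> (\<gamma> s) - \<phi> (\<gamma> 0))) \<le> (\<integral>\<^sup>+t. G t \<partial>lborel)"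
    using length_minorant_piecewise_C1[OF M c mb \<gamma> s A] unfolding length_minorant_def by blast
  have "G t \<le> speed M g \<gamma> t * indicator {0..1} t" for t
    using G(1,2)[of t] s by (cases "t \<in> {0<..<s}") auto
  then have "(\<integral>\<^sup>+t. G t \<partial>lborel) \<le> curve_length M g \<gamma>"
    unfolding curve_length_def by (intro nn_integral_mono)
  then show ?thesis using G(3) by (rule order_trans[rotated])
qed

text \<open>A curve that leaves the ball of radius \<open>R\<close> first meets the sphere, since the
  compact closed ball is closed in the Hausdorff space \<open>M\<close>. Up to that time it
  stays in the chart and moves by at least \<open>R / 2\<close> there.\<close>

lemma curve_long_or_ends_in_chart:
  fixes \<phi> :: "'a \<Rightarrow> 'e::euclidean_space"
  assumes M: "smooth_manifold M" and c: "(U, \<phi>) \<in> atlas M"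
    and R: "R > 0" "cball y0 R \<subseteq> \<phi> ` U"
    and mb: "chart_metric_bound M g (U, \<phi>) m {p \<in> U. \<phi> p \<in> cball y0 R}"
    and \<gamma>: "piecewise_C1_curve M \<gamma>" and q: "\<gamma> 0 \<in> U" "dist y0 (\<phi> (\<gamma> 0)) < R / 2"
  shows "ennreal (m * (R / 2)) \<le> curve_length M g \<gamma> \<or>
    \<gamma> 1 \<in> U \<and> ennreal (m * norm (\<phi> (\<gamma> 1) - \<phi> (\<gamma> 0))) \<le> curve_length M g \<gamma>"
proof -
  define A where "A = {p \<in> U. \<phi> p \<in> cball y0 R}"
  define B where "B = {p \<in> U. \<phi> p \<in> ball y0 R}"
  have AU: "A \<subseteq> U" by (auto simp: A_def)
  have m: "m > 0" using mb by (simp add: chart_metric_bound_def)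
  have lower: "ennreal (m * norm (\<phi> (\<gamma> s) - \<phi> (\<gamma> 0))) \<le> curve_length M g \<gamma>"
    if "0 \<le> s" "s \<le> 1" "\<gamma> ` {0..s} \<subseteq> A" for s
    by (rule curve_length_lower_bound[OF M c mb[folded A_def] \<gamma> that])
  have \<gamma>c: "continuous_map (top_of_set {0..1}) (mfd_top M) \<gamma>" using \<gamma> by (simp add: piecewise_C1_curve_def)
  have B: "openin (mfd_top M) B" unfolding B_def by (intro chart_open_vimage[OF M c]) simp
  have Acl: "closedin (mfd_top M) A"
  proof (rule compactin_imp_closedin)
    show "Hausdorff_space (mfd_top M)" using M by (simp add: smooth_manifold_def)
    have top: "topspace (subtopology (mfd_top M) U) = U" using chart_subset[OF M c] by auto
    obtain k where "homeomorphic_maps (subtopology (mfd_top M) U) (top_of_set (\<phi> ` U)) \<phi> k"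
      using chart_homeo[OF M c] unfolding homeomorphic_map_maps by (elim exE)
    then have k: "continuous_map (top_of_set (\<phi> ` U)) (subtopology (mfd_top M) U) k"
      "\<And>p. p \<in> U \<Longrightarrow> k (\<phi> p) = p" "\<And>y. y \<in> \<phi> ` U \<Longrightarrow> \<phi> (k y) = y"
      by (simp_all only: homeomorphic_maps_def top topspace_euclidean_subtopology)
    have "compactin (top_of_set (\<phi> ` U)) (cball y0 R)" using R(2) by (simp add: compactin_subtopology)
    then have "compactin (subtopology (mfd_top M) U) (k ` cball y0 R)"
      using k(1) by (rule image_compactin)
    moreover have "k ` cball y0 R = A"
    proof (intro equalityI subsetI)
      fix p assume "p \<in> A"
      then have "p = k (\<phi> p)" "\<phi> p \<in> cball y0 R" using k(2) by (simp_all add: A_def)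
      then show "p \<in> k ` cball y0 R" by (rule image_eqI)
    next
      fix p assume "p \<in> k ` cball y0 R"
      then obtain y where y: "y \<in> cball y0 R" "p = k y" by blast
      then obtain p' where "p' \<in> U" "y = \<phi> p'" using R(2) by blast
      then show "p \<in> A" using y k(2) by (simp add: A_def)
    qed
    ultimately show "compactin (mfd_top M) A" by (simp add: compactin_subtopology)
  qed
  define E where "E = {s \<in> {0..1}. \<gamma> s \<notin> B}"
  show ?thesis
  proof (cases "E = {}")
    case True
    then have sub: "\<gamma> ` {0..1} \<subseteq> A" by (auto simp: E_def A_def B_def)
    then have "\<gamma> 1 \<in> A" by (rule subsetD) simp
    then have "\<gamma> 1 \<in> U" "ennreal (m * norm (\<phi> (\<gamma> 1) - \<phi> (\<gamma> 0))) \<le> curve_length M g \<gamma>"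
      using lower[of 1] sub AU by auto
    then show ?thesis by simp
  next
    case False
    have "openin (top_of_set {0..1}) {s \<in> {0..1}. \<gamma> s \<in> B}"
      using openin_continuous_map_preimage[OF \<gamma>c B] by simp
    then have "closedin (top_of_set {0..1}) ({0..1} - {s \<in> {0..1}. \<gamma> s \<in> B})"
      by (metis closedin_diff closedin_topspace topspace_euclidean_subtopology)
    moreover have "{0..1} - {s \<in> {0..1}. \<gamma> s \<in> B} = E" by (auto simp: E_def)
    ultimately have "closed E" using closedin_closed_trans[of "{0..1}" E] by simp
    have bdd: "bdd_below E" by (auto simp: E_def bdd_below_def)
    \<comment> \<open>The first exit time.\<close>
  define r where "r = Inf E"
    have rE: "r \<in> E" unfolding r_def by (rule closed_contains_Inf[OF False bdd \<open>closed E\<close>])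
    have before: "\<gamma> t \<in> B" if "0 \<le> t" "t < r" for t
    proof (rule ccontr)
      assume "\<gamma> t \<notin> B"
      then have "t \<in> E" using that rE by (auto simp: E_def)
      then show False using cInf_lower[OF _ bdd, of t] that by (simp add: r_def)
    qed
    have "\<gamma> 0 \<in> B" using q R by (auto simp: B_def)
    then have r: "0 < r" "r \<le> 1" "\<gamma> r \<notin> B" using rE by (auto simp: E_def less_le)
    have "closedin (top_of_set {0..1}) {s \<in> {0..1}. \<gamma> s \<in> A}"
      using closedin_continuous_map_preimage[OF \<gamma>c Acl] by simp
    then have "closed {s \<in> {0..1}. \<gamma> s \<in> A}" using closedin_closed_trans by blast
    moreover have "{0..<r} \<subseteq> {s \<in> {0..1}. \<gamma> s \<in> A}"
      using before r by (auto simp: A_def B_def less_imp_le)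
    ultimately have "closure {0..<r} \<subseteq> {s \<in> {0..1}. \<gamma> s \<in> A}" by (rule closure_minimal[rotated])
    then have sub: "\<gamma> ` {0..r} \<subseteq> A" using r by auto
    then have "\<gamma> r \<in> A" using r by auto
    then have "dist y0 (\<phi> (\<gamma> r)) = R" using r(3) by (auto simp: A_def B_def)
    then have "R / 2 \<le> norm (\<phi> (\<gamma> r) - \<phi> (\<gamma> 0))"
      using q(2) dist_triangle[of y0 "\<phi> (\<gamma> r)" "\<phi> (\<gamma> 0)"] by (simp add: dist_norm norm_minus_commute)
    then have "ennreal (m * (R / 2)) \<le> ennreal (m * norm (\<phi> (\<gamma> r) - \<phi> (\<gamma> 0)))"
      using m by (intro ennreal_leI mult_left_mono) auto
    also have "\<dots> \<le> curve_length M g \<gamma>" using lower[of r] sub r by auto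
    finally show ?thesis ..
  qed
qed

text \<open>If the distance is below the threshold, some curve is shorter than the threshold, which forces
  the second point into the chart; curves above the threshold do not affect the infimum.\<close>

lemma riemannian_distance_lower_bound:
  fixes \<phi> :: "'a \<Rightarrow> 'e::euclidean_space"
  assumes M: "smooth_manifold M" and c: "(U, \<phi>) \<in> atlas M"
    and R: "R > 0" "cball y0 R \<subseteq> \<phi> ` U"
    and mb: "chart_metric_bound M g (U, \<phi>) m {p \<in> U. \<phi> p \<in> cball y0 R}"
    and q: "q \<in> U" "dist y0 (\<phi> q) < R / 2" and d: "riemannian_distance M g q q' < ennreal (m * (R / 2))"
  shows "q' \<in> U \<and> ennreal (m * norm (\<phi> q' - \<phi> q)) \<le> riemannian_distance M g q q'"
proof -
  let ?C = "{\<gamma>. piecewise_C1_curve M \<gamma> \<and> \<gamma> 0 = q \<and> \<gamma> 1 = q'}"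
  have curve: "ennreal (m * (R / 2)) \<le> curve_length M g \<gamma> \<or>
      q' \<in> U \<and> ennreal (m * norm (\<phi> q' - \<phi> q)) \<le> curve_length M g \<gamma>" if "\<gamma> \<in> ?C" for \<gamma>
    using curve_long_or_ends_in_chart[OF M c R mb, of \<gamma>] that q by auto
  have short: "\<exists>\<gamma>\<in>?C. curve_length M g \<gamma> < e" if "riemannian_distance M g q q' < e" for e
    using that unfolding riemannian_distance_def INF_less_iff .
  have "q' \<in> U" using short[OF d] curve by (meson leD)
  moreover have "ennreal (m * norm (\<phi> q' - \<phi> q)) \<le> riemannian_distance M g q q'"
  proof (rule ccontr)
    assume "\<not> ?thesis"
    then have "riemannian_distance M g q q' < min (ennreal (m * norm (\<phi> q' - \<phi> q))) (ennreal (m * (R / 2)))"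
      using d by simp
    from short[OF this] curve show False by (meson leD min_less_iff_conj)
  qed
  ultimately show ?thesis ..
qed

text \<open>The regularity of a curve that the integration theory uses: no metric appears, and it passes to
  images under smooth maps.\<close>

definition chart_hoelder ::
  "('a, 'e::euclidean_space) manifold \<Rightarrow> real \<Rightarrow> real \<Rightarrow> (real \<Rightarrow> 'a) \<Rightarrow> bool" where
  "chart_hoelder M \<alpha> T x \<longleftrightarrow> x ` {0..T} \<subseteq> points M \<and>
     (\<forall>U \<phi> t. (U, \<phi>) \<in> atlas M \<longrightarrow> t \<in> {0..T} \<longrightarrow> x t \<in> U \<longrightarrow>
        (\<exists>\<delta>>0. \<exists>C\<ge>0. \<forall>s\<in>{0..T}. \<forall>s'\<in>{0..T}. \<bar>s - t\<bar> < \<delta> \<longrightarrow> \<bar>s' - t\<bar> < \<delta> \<longrightarrow>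
           x s \<in> U \<and> norm (\<phi> (x s') - \<phi> (x s)) \<le> C * \<bar>s' - s\<bar> powr \<alpha>))"

text \<open>For times close to \<open>t\<close> the distances are below the threshold
  \<open>m * (R / 2)\<close> under which the Riemannian distance dominates coordinate
  differences. A first application at \<open>t\<close> itself confines the curve to the half
  ball, a second one compares two arbitrary nearby times.\<close>

lemma hoelder_curve_chart_hoelder:
  assumes M: "smooth_manifold M" and g: "riemannian_metric M g" and "\<alpha> > 0"
    and x: "x \<in> hoelder_curves M g \<alpha> T"
  shows "chart_hoelder M \<alpha> T x"
  unfolding chart_hoelder_def
proof (intro conjI allI impI)
  show "x ` {0..T} \<subseteq> points M" using x by (simp add: hoelder_curves_def)
  obtain C where "C > 0" and C': "\<forall>s\<in>{0..T}. \<forall>t\<in>{0..T}.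
      riemannian_distance M g (x t) (x s) \<le> ennreal (C * \<bar>t - s\<bar> powr \<alpha>)"
    using x unfolding hoelder_curves_def mem_Collect_eq by (elim conjE exE)
  note C = \<open>C > 0\<close> C'[rule_format]
  fix U \<phi> t assume c: "(U, \<phi>) \<in> atlas M" and t: "t \<in> {0..T}" and xt: "x t \<in> U"
  obtain R where R: "R > 0" "cball (\<phi> (x t)) R \<subseteq> \<phi> ` U"
    using chart_image_open[OF M c] xt open_contains_cball by blast
  obtain m where mb: "chart_metric_bound M g (U, \<phi>) m {p \<in> U. \<phi> p \<in> cball (\<phi> (x t)) R}"
    using metric_lower_bound[OF M g c R] by blast
  then have m: "m > 0" by (simp add: chart_metric_bound_def)
  \<comment> \<open>Two times within \<open>\<delta>\<close> of \<open>t\<close> are less than \<open>2 * \<delta>\<close> apart, which makes \<open>C * r powr \<alpha>\<close> smaller than \<open>m * (R / 2)\<close>.\<close>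
  define \<delta> where "\<delta> = (m * (R / 2) / C) powr (1 / \<alpha>) / 2"
  have \<delta>: "\<delta> > 0" using m R C by (simp add: \<delta>_def)
  have small: "C * r powr \<alpha> < m * (R / 2)" if "0 \<le> r" "r < 2 * \<delta>" for r
  proof -
    have "r powr \<alpha> < (2 * \<delta>) powr \<alpha>" using that \<open>\<alpha> > 0\<close> by (intro powr_less_mono2) auto
    also have "\<dots> = m * (R / 2) / C" using m R C \<open>\<alpha> > 0\<close> by (simp add: \<delta>_def powr_powr)
    finally show ?thesis using C(1) by (simp add: pos_less_divide_eq mult.commute mult.left_commute)
  qed
  note lower = riemannian_distance_lower_bound[OF M c R mb]
  have near: "x s \<in> U" "dist (\<phi> (x t)) (\<phi> (x s)) < R / 2" if s: "s \<in> {0..T}" "\<bar>s - t\<bar> < \<delta>" for s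
  proof -
    have "riemannian_distance M g (x t) (x s) \<le> ennreal (C * \<bar>t - s\<bar> powr \<alpha>)" using C s t by auto
    also have "\<dots> < ennreal (m * (R / 2))"
      using small[of "\<bar>t - s\<bar>"] s \<delta> C m R by (intro ennreal_lessI) auto
    finally have lt: "riemannian_distance M g (x t) (x s) < ennreal (m * (R / 2))" .
    then have "x s \<in> U \<and> ennreal (m * norm (\<phi> (x s) - \<phi> (x t))) \<le> riemannian_distance M g (x t) (x s)"
      using xt R by (intro lower) auto
    with lt have "x s \<in> U" "ennreal (m * norm (\<phi> (x s) - \<phi> (x t))) < ennreal (m * (R / 2))" by auto
    then show "x s \<in> U" "dist (\<phi> (x t)) (\<phi> (x s)) < R / 2"
      using m R by (auto simp: ennreal_less_iff dist_norm norm_minus_commute)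
  qed
  have hoel: "norm (\<phi> (x s') - \<phi> (x s)) \<le> (C / m) * \<bar>s' - s\<bar> powr \<alpha>"
    if s: "s \<in> {0..T}" "s' \<in> {0..T}" "\<bar>s - t\<bar> < \<delta>" "\<bar>s' - t\<bar> < \<delta>" for s s'
  proof -
    have le: "riemannian_distance M g (x s) (x s') \<le> ennreal (C * \<bar>s - s'\<bar> powr \<alpha>)" using C s by auto
    also have "\<dots> < ennreal (m * (R / 2))"
      using small[of "\<bar>s - s'\<bar>"] s \<delta> C m R by (intro ennreal_lessI) auto
    finally have "ennreal (m * norm (\<phi> (x s') - \<phi> (x s))) \<le> riemannian_distance M g (x s) (x s')"
      using lower[OF near[OF s(1,3)]] by blast
    also note le
    finally have "m * norm (\<phi> (x s') - \<phi> (x s)) \<le> C * \<bar>s' - s\<bar> powr \<alpha>"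
      using C by (simp add: ennreal_le_iff abs_minus_commute)
    then show ?thesis using m by (simp add: field_simps)
  qed
  show "\<exists>\<delta>>0. \<exists>C\<ge>0. \<forall>s\<in>{0..T}. \<forall>s'\<in>{0..T}. \<bar>s - t\<bar> < \<delta> \<longrightarrow> \<bar>s' - t\<bar> < \<delta> \<longrightarrow>
           x s \<in> U \<and> norm (\<phi> (x s') - \<phi> (x s)) \<le> C * \<bar>s' - s\<bar> powr \<alpha>"
    using \<delta> near hoel C m by (intro exI[of _ \<delta>] conjI exI[of _ "C / m"]) auto
qed

section \<open>Integrals in a single chart\<close>

lemma hoelder_on_combine:
  fixes f :: "real \<Rightarrow> 'f::real_normed_vector"
  assumes "hoelder_on \<alpha> {a..b} f" "hoelder_on \<alpha> {b..e} f" "a \<le> b" "b \<le> e" "\<alpha> > 0"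
  shows "hoelder_on \<alpha> {a..e} f"
proof -
  obtain C where C: "C \<ge> 0" "\<forall>s\<in>{a..b}. \<forall>t\<in>{a..b}. norm (f t - f s) \<le> C * \<bar>t - s\<bar> powr \<alpha>"
    using assms(1) unfolding hoelder_on_def by (elim exE conjE)
  obtain D where D: "D \<ge> 0" "\<forall>s\<in>{b..e}. \<forall>t\<in>{b..e}. norm (f t - f s) \<le> D * \<bar>t - s\<bar> powr \<alpha>"
    using assms(2) unfolding hoelder_on_def by (elim exE conjE)
  have mixed: "norm (f t - f s) \<le> (C + D) * \<bar>t - s\<bar> powr \<alpha>" if "s \<in> {a..b}" "t \<in> {b..e}" for s t
  proof -
    have "norm (f t - f s) \<le> norm (f b - f s) + norm (f t - f b)"
      using norm_triangle_ineq[of "f b - f s" "f t - f b"] by simp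
    also have "\<dots> \<le> C * \<bar>b - s\<bar> powr \<alpha> + D * \<bar>t - b\<bar> powr \<alpha>"
      using C(2)[rule_format, of s b] D(2)[rule_format, of b t] that assms(3,4) by (intro add_mono) simp_all
    also have "\<dots> \<le> C * \<bar>t - s\<bar> powr \<alpha> + D * \<bar>t - s\<bar> powr \<alpha>"
      using C(1) D(1) that assms(5) by (intro add_mono mult_left_mono powr_mono2) auto
    finally show ?thesis by (simp add: distrib_right)
  qed
  have "norm (f t - f s) \<le> (C + D) * \<bar>t - s\<bar> powr \<alpha>" if s: "s \<in> {a..e}" and t: "t \<in> {a..e}" for s t
  proof -
    have le: "C * \<bar>t - s\<bar> powr \<alpha> \<le> (C + D) * \<bar>t - s\<bar> powr \<alpha>" "D * \<bar>t - s\<bar> powr \<alpha> \<le> (C + D) * \<bar>t - s\<bar> powr \<alpha>"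
      using C(1) D(1) by (auto intro!: mult_right_mono)
    consider "s \<le> b" "t \<le> b" | "s \<le> b" "b \<le> t" | "b \<le> s" "t \<le> b" | "b \<le> s" "b \<le> t" by linarith
    then show ?thesis
    proof cases
      case 1
      then have "norm (f t - f s) \<le> C * \<bar>t - s\<bar> powr \<alpha>" using C(2)[rule_format, of s t] s t by simp
      then show ?thesis using le(1) by (rule order_trans)
    next
      case 2
      then show ?thesis using mixed[of s t] s t by auto
    next
      case 3
      then show ?thesis using mixed[of t s] s t by (auto simp: norm_minus_commute abs_minus_commute)
    next
      case 4
      then have "norm (f t - f s) \<le> D * \<bar>t - s\<bar> powr \<alpha>" using D(2)[rule_format, of s t] s t by simp
      then show ?thesis using le(2) by (rule order_trans)
    qed
  qed
  then show ?thesis unfolding hoelder_on_def using C(1) D(1) by (intro exI[of _ "C + D"]) auto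
qed

text \<open>Hoelder bounds on adjacent intervals combine, with the constants added, so bisection turns the
  local condition into a global one.\<close>

lemma hoelder_on_local:
  fixes f :: "real \<Rightarrow> 'f::real_normed_vector"
  assumes "a \<le> b" "\<alpha> > 0"
    and loc: "\<And>t. t \<in> {a..b} \<Longrightarrow> \<exists>\<delta>>0. \<exists>C\<ge>0. \<forall>s\<in>{a..b}. \<forall>s'\<in>{a..b}. \<bar>s - t\<bar> < \<delta> \<longrightarrow> \<bar>s' - t\<bar> < \<delta> \<longrightarrow>
       norm (f s' - f s) \<le> C * \<bar>s' - s\<bar> powr \<alpha>"
  shows "hoelder_on \<alpha> {a..b} f"
proof -
  define P where "P u v \<longleftrightarrow> (a \<le> u \<longrightarrow> v \<le> b \<longrightarrow> hoelder_on \<alpha> {u..v} f)" for u v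
  have "P a b"
    using assms(1)
  proof (rule Bolzano)
    fix u v w assume "P u v" "P v w" "u \<le> v" "v \<le> w"
    then show "P u w" unfolding P_def using assms(2) by (intro impI hoelder_on_combine[of \<alpha> u v f w]) auto
  next
    fix t assume "a \<le> t" "t \<le> b"
    then obtain \<delta> C where \<delta>: "\<delta> > 0" "C \<ge> 0" "\<forall>s\<in>{a..b}. \<forall>s'\<in>{a..b}. \<bar>s - t\<bar> < \<delta> \<longrightarrow> \<bar>s' - t\<bar> < \<delta> \<longrightarrow>
       norm (f s' - f s) \<le> C * \<bar>s' - s\<bar> powr \<alpha>"
      using loc[of t] by auto
    have "hoelder_on \<alpha> {u..v} f" if "u \<le> t" "t \<le> v" "v - u < \<delta>" "a \<le> u" "v \<le> b" for u v
      unfolding hoelder_on_def using \<delta> that by (intro exI[of _ C]) auto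
    then show "\<exists>d>0. \<forall>u v. u \<le> t \<and> t \<le> v \<and> v - u < d \<longrightarrow> P u v"
      unfolding P_def using \<delta>(1) by (intro exI[of _ \<delta>]) simp
  qed
  then show ?thesis by (simp add: P_def)
qed

lemma hoelder_on_subset: "hoelder_on \<alpha> S f \<Longrightarrow> S' \<subseteq> S \<Longrightarrow> hoelder_on \<alpha> S' f"
  unfolding hoelder_on_def by (meson subsetD)

lemma hoelder_on_cong:
  assumes "\<And>s. s \<in> S \<Longrightarrow> f s = f' s"
  shows "hoelder_on \<alpha> S f \<longleftrightarrow> hoelder_on \<alpha> S f'"
  unfolding hoelder_on_def using assms by (simp cong: ball_cong)

lemma hoelder_on_bounded:
  assumes "hoelder_on \<alpha> {a..b} f" "a \<le> b" "\<alpha> > 0"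
  shows "\<exists>B\<ge>0. \<forall>s\<in>{a..b}. norm (f s) \<le> B"
proof -
  obtain C where C: "C \<ge> 0" "\<forall>s\<in>{a..b}. \<forall>t\<in>{a..b}. norm (f t - f s) \<le> C * \<bar>t - s\<bar> powr \<alpha>"
    using assms(1) unfolding hoelder_on_def by (elim exE conjE)
  have "norm (f s) \<le> norm (f a) + C * (b - a) powr \<alpha>" if s: "s \<in> {a..b}" for s
  proof -
    have "norm (f s) \<le> norm (f a) + norm (f s - f a)"
      using norm_triangle_ineq[of "f a" "f s - f a"] by simp
    also have "norm (f s - f a) \<le> C * \<bar>s - a\<bar> powr \<alpha>" using C(2)[rule_format, of a s] s assms(2) by simp
    also have "\<dots> \<le> C * (b - a) powr \<alpha>" using C(1) s assms(3) by (intro mult_left_mono powr_mono2) auto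
    finally show ?thesis by simp
  qed
  then show ?thesis using C(1) by (intro exI[of _ "norm (f a) + C * (b - a) powr \<alpha>"]) auto
qed

lemma chart_hoelder_near:
  assumes x: "chart_hoelder M \<alpha> T x" and "\<alpha> > 0" and c: "(U, \<phi>) \<in> atlas M" and t: "t \<in> {0..T}" "x t \<in> U" and "r > 0"
  shows "\<exists>\<delta>>0. \<exists>C\<ge>0. \<forall>s\<in>{0..T}. \<forall>s'\<in>{0..T}. \<bar>s - t\<bar> < \<delta> \<longrightarrow> \<bar>s' - t\<bar> < \<delta> \<longrightarrow>
     x s \<in> U \<and> \<phi> (x s) \<in> cball (\<phi> (x t)) r \<and> norm (\<phi> (x s') - \<phi> (x s)) \<le> C * \<bar>s' - s\<bar> powr \<alpha>"
proof -
  obtain \<delta> C where \<delta>: "\<delta> > 0" "C \<ge> 0" "\<forall>s\<in>{0..T}. \<forall>s'\<in>{0..T}. \<bar>s - t\<bar> < \<delta> \<longrightarrow> \<bar>s' - t\<bar> < \<delta> \<longrightarrow>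
           x s \<in> U \<and> norm (\<phi> (x s') - \<phi> (x s)) \<le> C * \<bar>s' - s\<bar> powr \<alpha>"
    using x c t unfolding chart_hoelder_def by meson
  define d where "d = min \<delta> ((r / (C + 1)) powr (1 / \<alpha>))"
  have d: "d > 0" using \<delta> \<open>r > 0\<close> by (simp add: d_def)
  have "\<phi> (x s) \<in> cball (\<phi> (x t)) r" if s: "s \<in> {0..T}" "\<bar>s - t\<bar> < d" for s
  proof -
    have "norm (\<phi> (x s) - \<phi> (x t)) \<le> C * \<bar>s - t\<bar> powr \<alpha>"
      using \<delta>(3)[rule_format, of t s] \<delta>(1) s t by (simp add: d_def)
    also have "\<dots> \<le> (C + 1) * ((r / (C + 1)) powr (1 / \<alpha>)) powr \<alpha>"
      using s \<delta>(2) \<open>\<alpha> > 0\<close> by (intro mult_mono powr_mono2) (auto simp: d_def)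
    also have "\<dots> = r" using \<delta>(2) \<open>r > 0\<close> \<open>\<alpha> > 0\<close> by (simp add: powr_powr)
    finally show ?thesis by (simp add: dist_norm norm_minus_commute)
  qed
  then show ?thesis using d \<delta>(2,3) by (intro exI[of _ d] conjI exI[of _ C]) (auto simp: d_def)
qed

lemma chart_hoelder_smooth_function:
  fixes k :: "'e::euclidean_space \<Rightarrow> 'f::real_normed_vector"
  assumes M: "smooth_manifold M" and x: "chart_hoelder M \<alpha> T x" and \<alpha>: "\<alpha> > 0" and c: "(U, \<phi>) \<in> atlas M"
    and k: "smooth_on k (\<phi> ` U)" and ab: "0 \<le> a" "a \<le> b" "b \<le> T" "x ` {a..b} \<subseteq> U"
  shows "hoelder_on \<alpha> {a..b} (\<lambda>s. k (\<phi> (x s)))"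
proof (rule hoelder_on_local[OF ab(2) \<alpha>])
  fix t assume t: "t \<in> {a..b}"
  then have xt: "t \<in> {0..T}" "x t \<in> U" using ab by auto
  have tU: "\<phi> (x t) \<in> \<phi> ` U" using xt(2) by simp
  obtain r L where r: "r > 0" "L \<ge> 0" "cball (\<phi> (x t)) r \<subseteq> \<phi> ` U"
    "\<forall>y\<in>cball (\<phi> (x t)) r. \<forall>z\<in>cball (\<phi> (x t)) r. norm (k z - k y) \<le> L * norm (z - y)"
    using smooth_on_locally_Lipschitz[OF k chart_image_open[OF M c] tU] by (elim exE conjE)
  obtain \<delta> C where \<delta>: "\<delta> > 0" "C \<ge> 0" "\<forall>s\<in>{0..T}. \<forall>s'\<in>{0..T}. \<bar>s - t\<bar> < \<delta> \<longrightarrow> \<bar>s' - t\<bar> < \<delta> \<longrightarrow>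
     x s \<in> U \<and> \<phi> (x s) \<in> cball (\<phi> (x t)) r \<and> norm (\<phi> (x s') - \<phi> (x s)) \<le> C * \<bar>s' - s\<bar> powr \<alpha>"
    using chart_hoelder_near[OF x \<alpha> c xt r(1)] by (elim exE conjE)
  have "norm (k (\<phi> (x s')) - k (\<phi> (x s))) \<le> (L * C) * \<bar>s' - s\<bar> powr \<alpha>"
    if "s \<in> {a..b}" "s' \<in> {a..b}" "\<bar>s - t\<bar> < \<delta>" "\<bar>s' - t\<bar> < \<delta>" for s s'
  proof -
    have s: "s \<in> {0..T}" "s' \<in> {0..T}" using that ab by auto
    have "norm (k (\<phi> (x s')) - k (\<phi> (x s))) \<le> L * norm (\<phi> (x s') - \<phi> (x s))"
      using \<delta>(3) s that(3,4) by (intro r(4)[rule_format]) auto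
    also have "\<dots> \<le> L * (C * \<bar>s' - s\<bar> powr \<alpha>)"
      using \<delta>(3) s that(3,4) r(2) by (intro mult_left_mono) auto
    finally show ?thesis by (simp add: mult.assoc)
  qed
  then show "\<exists>\<delta>>0. \<exists>C\<ge>0. \<forall>s\<in>{a..b}. \<forall>s'\<in>{a..b}. \<bar>s - t\<bar> < \<delta> \<longrightarrow> \<bar>s' - t\<bar> < \<delta> \<longrightarrow>
       norm (k (\<phi> (x s')) - k (\<phi> (x s))) \<le> C * \<bar>s' - s\<bar> powr \<alpha>"
    using \<delta>(1,2) r(2) by (intro exI[of _ \<delta>] conjI exI[of _ "L * C"]) auto
qed

lemma chart_hoelder_coordinate:
  assumes M: "smooth_manifold M" and x: "chart_hoelder M \<alpha> T x" and \<alpha>: "\<alpha> > 0" and c: "(U, \<phi>) \<in> atlas M"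
    and ab: "0 \<le> a" "a \<le> b" "b \<le> T" "x ` {a..b} \<subseteq> U"
  shows "hoelder_on \<alpha> {a..b} (\<lambda>s. \<phi> (x s) \<bullet> i)"
proof (rule chart_hoelder_smooth_function[OF M x \<alpha> c _ ab])
  show "smooth_on (\<lambda>z. z \<bullet> i) (\<phi> ` U)"
    unfolding smooth_on_def by (intro allI Ck_on_linear bounded_linear_inner_left)
qed

lemma chart_hoelder_coefficient:
  assumes M: "smooth_manifold M" and x: "chart_hoelder M \<alpha> T x" and \<alpha>: "\<alpha> > 0" and c: "(U, \<phi>) \<in> atlas M"
    and ab: "0 \<le> a" "a \<le> b" "b \<le> T" "x ` {a..b} \<subseteq> U" and b: "one_form M \<beta>" and i: "i \<in> Basis"
  shows "hoelder_on \<alpha> {a..b} (\<lambda>s. \<beta> (x s) (coord_vector M (U, \<phi>) i (x s)))"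
proof -
  have "hoelder_on \<alpha> {a..b} (\<lambda>s. (\<lambda>z. \<beta> (inv_into U \<phi> z) (coord_vector M (U, \<phi>) i (inv_into U \<phi> z))) (\<phi> (x s)))"
    by (rule chart_hoelder_smooth_function[OF M x \<alpha> c one_form_coeff_smooth[OF b c i] ab])
  moreover have "inv_into U \<phi> (\<phi> (x s)) = x s" if "s \<in> {a..b}" for s
    using ab(4) that by (intro chart_inverse[OF M c]) auto
  ultimately show ?thesis by (subst (asm) hoelder_on_cong[where f' = "\<lambda>s. \<beta> (x s) (coord_vector M (U, \<phi>) i (x s))"]) simp_all
qed

lemma chart_hoelder_smooth_map:
  assumes M: "smooth_manifold M" and N: "smooth_manifold N" and F: "smooth_map M N F"
    and x: "chart_hoelder M \<alpha> T x" and \<alpha>: "\<alpha> > 0"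
  shows "chart_hoelder N \<alpha> T (F \<circ> x)"
  unfolding chart_hoelder_def
proof (intro conjI allI impI)
  have xM: "x ` {0..T} \<subseteq> points M" using x by (simp add: chart_hoelder_def)
  then show "(F \<circ> x) ` {0..T} \<subseteq> points N" using smooth_map_points[OF F] by auto
  fix V \<psi> t assume d: "(V, \<psi>) \<in> atlas N" and t: "t \<in> {0..T}" and Ft: "(F \<circ> x) t \<in> V"
  have "x t \<in> points M" using xM t by blast
  then obtain U \<phi> where c: "(U, \<phi>) \<in> atlas M" and xt: "x t \<in> U"
    by (rule chart_exists[OF M])
  let ?S = "\<phi> ` (U \<inter> F -` V)"
  let ?H = "\<lambda>z. \<psi> (F (inv_into U \<phi> z))"
  have S: "open ?S"
    by (auto intro!: chart_open_image[OF M c smooth_map_vimage_open[OF M F c chart_open[OF N d]]])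
  have tS: "\<phi> (x t) \<in> ?S" using xt Ft by simp
  obtain r L where r: "r > 0" "L \<ge> 0" "cball (\<phi> (x t)) r \<subseteq> ?S"
    "\<forall>y\<in>cball (\<phi> (x t)) r. \<forall>z\<in>cball (\<phi> (x t)) r. norm (?H z - ?H y) \<le> L * norm (z - y)"
    using smooth_on_locally_Lipschitz[OF smooth_map_in_charts[OF F c d] S tS] by (elim exE conjE)
  obtain \<delta> C where \<delta>: "\<delta> > 0" "C \<ge> 0" "\<forall>s\<in>{0..T}. \<forall>s'\<in>{0..T}. \<bar>s - t\<bar> < \<delta> \<longrightarrow> \<bar>s' - t\<bar> < \<delta> \<longrightarrow>
     x s \<in> U \<and> \<phi> (x s) \<in> cball (\<phi> (x t)) r \<and> norm (\<phi> (x s') - \<phi> (x s)) \<le> C * \<bar>s' - s\<bar> powr \<alpha>"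
    using chart_hoelder_near[OF x \<alpha> c t xt r(1)] by (elim exE conjE)
  have near: "x s \<in> U" "F (x s) \<in> V" "\<phi> (x s) \<in> cball (\<phi> (x t)) r" "?H (\<phi> (x s)) = \<psi> (F (x s))"
    if s: "s \<in> {0..T}" "\<bar>s - t\<bar> < \<delta>" for s
  proof -
    show U: "x s \<in> U" and B: "\<phi> (x s) \<in> cball (\<phi> (x t)) r" using \<delta>(3) s by auto
    then have "\<phi> (x s) \<in> ?S" using r(3) by blast
    then obtain q where "q \<in> U" "F q \<in> V" "\<phi> (x s) = \<phi> q" by auto
    then show "F (x s) \<in> V" using inj_onD[OF chart_inj[OF M c] _ U, of q] by simp
    show "?H (\<phi> (x s)) = \<psi> (F (x s))" by (simp add: chart_inverse[OF M c U])
  qed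
  have "norm (\<psi> (F (x s')) - \<psi> (F (x s))) \<le> (L * C) * \<bar>s' - s\<bar> powr \<alpha>"
    if s: "s \<in> {0..T}" "s' \<in> {0..T}" "\<bar>s - t\<bar> < \<delta>" "\<bar>s' - t\<bar> < \<delta>" for s s'
  proof -
    have "norm (\<psi> (F (x s')) - \<psi> (F (x s))) \<le> L * norm (\<phi> (x s') - \<phi> (x s))"
      using r(4)[rule_format, OF near(3)[OF s(1,3)] near(3)[OF s(2,4)]] by (simp only: near(4)[OF s(1,3)] near(4)[OF s(2,4)])
    also have "\<dots> \<le> L * (C * \<bar>s' - s\<bar> powr \<alpha>)"
      using \<delta>(3) s r(2) by (intro mult_left_mono) auto
    finally show ?thesis by (simp add: mult.assoc)
  qed
  then show "\<exists>\<delta>>0. \<exists>C\<ge>0. \<forall>s\<in>{0..T}. \<forall>s'\<in>{0..T}. \<bar>s - t\<bar> < \<delta> \<longrightarrow> \<bar>s' - t\<bar> < \<delta> \<longrightarrow>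
           (F \<circ> x) s \<in> V \<and> norm (\<psi> ((F \<circ> x) s') - \<psi> ((F \<circ> x) s)) \<le> C * \<bar>s' - s\<bar> powr \<alpha>"
    using \<delta>(1,2) r(2) near(2) by (intro exI[of _ \<delta>] conjI exI[of _ "L * C"]) auto
qed

text \<open>Increments of order \<open>p > 1\<close> force the derivative to vanish everywhere.\<close>

lemma constant_of_local_power_bound:
  fixes D :: "real \<Rightarrow> real"
  assumes "a \<le> b" "p > 1"
    and loc: "\<And>t. t \<in> {a..b} \<Longrightarrow> \<exists>\<delta>>0. \<exists>K\<ge>0. \<forall>u\<in>{a..b}. \<forall>v\<in>{a..b}. \<bar>u - t\<bar> < \<delta> \<longrightarrow> \<bar>v - t\<bar> < \<delta> \<longrightarrow> u \<le> v \<longrightarrow>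
       \<bar>D v - D u\<bar> \<le> K * (v - u) powr p"
  shows "D a = D b"
proof -
  have "(D has_derivative (\<lambda>h. 0)) (at t within {a..b})" if t: "t \<in> {a..b}" for t
    unfolding has_derivative_within_alt
  proof (intro conjI allI impI)
    fix e :: real assume "e > 0"
    obtain \<delta> K where \<delta>: "\<delta> > 0" "K \<ge> 0" "\<forall>u\<in>{a..b}. \<forall>v\<in>{a..b}. \<bar>u - t\<bar> < \<delta> \<longrightarrow> \<bar>v - t\<bar> < \<delta> \<longrightarrow> u \<le> v \<longrightarrow>
       \<bar>D v - D u\<bar> \<le> K * (v - u) powr p"
      using loc[OF t] by (elim exE conjE)
    define d where "d = min \<delta> ((e / (K + 1)) powr (1 / (p - 1)))"
    have d: "d > 0" using \<delta> \<open>e > 0\<close> by (simp add: d_def)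
    have "norm (D y - D t - 0) \<le> e * norm (y - t)" if y: "y \<in> {a..b}" "norm (y - t) < d" for y
    proof -
      have "\<bar>D y - D t\<bar> \<le> K * \<bar>y - t\<bar> powr p"
      proof (cases "t \<le> y")
        case True
        then show ?thesis using \<delta>(3)[rule_format, of t y] \<delta>(1) t y by (simp add: d_def)
      next
        case False
        then show ?thesis using \<delta>(3)[rule_format, of y t] \<delta>(1) t y
          by (simp add: d_def abs_minus_commute)
      qed
      also have "\<dots> = K * \<bar>y - t\<bar> powr (p - 1) * \<bar>y - t\<bar>"
        by (cases "y = t") (auto simp: powr_diff)
      also have "K * \<bar>y - t\<bar> powr (p - 1) \<le> (K + 1) * ((e / (K + 1)) powr (1 / (p - 1))) powr (p - 1)"
        using y \<delta>(2) assms(2) by (intro mult_mono powr_mono2) (auto simp: d_def)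
      also have "\<dots> = e" using \<delta>(2) \<open>e > 0\<close> assms(2) by (simp add: powr_powr)
      finally show ?thesis by (simp add: mult_right_mono)
    qed
    then show "\<exists>d>0. \<forall>y\<in>{a..b}. norm (y - t) < d \<longrightarrow> norm (D y - D t - 0) \<le> e * norm (y - t)"
      using d by blast
  qed simp
  then obtain k where "\<And>t. t \<in> {a..b} \<Longrightarrow> D t = k"
    using has_derivative_zero_constant[of "{a..b}" D] by auto
  then show ?thesis using assms(1) by simp
qed

text \<open>The primitives of the individual coordinate integrals are added.\<close>

lemma chart_primitive:
  fixes \<phi> :: "'a \<Rightarrow> 'e::euclidean_space"
  assumes M: "smooth_manifold M" and x: "chart_hoelder M \<alpha> T x" and \<alpha>: "1/2 < \<alpha>" and c: "(U, \<phi>) \<in> atlas M"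
    and ab: "0 \<le> a" "a \<le> b" "b \<le> T" "x ` {a..b} \<subseteq> U" and b: "one_form M \<beta>"
  shows "\<exists>Z K. K \<ge> 0 \<and> (\<forall>u v. a \<le> u \<longrightarrow> u \<le> v \<longrightarrow> v \<le> b \<longrightarrow>
     has_chart_integral M (U, \<phi>) \<beta> x u v (Z v - Z u) \<and>
     \<bar>Z v - Z u - (\<Sum>i\<in>Basis. \<beta> (x u) (coord_vector M (U, \<phi>) i (x u)) * (\<phi> (x v) \<bullet> i - \<phi> (x u) \<bullet> i))\<bar>
       \<le> K * (v - u) powr (2 * \<alpha>))"
proof -
  have \<alpha>0: "\<alpha> > 0" using \<alpha> by simp
  let ?f = "\<lambda>i s. \<beta> (x s) (coord_vector M (U, \<phi>) i (x s))"
  let ?g = "\<lambda>i s. \<phi> (x s) \<bullet> i"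
  have fh: "hoelder_on \<alpha> {a..b} (?f i)" if "i \<in> Basis" for i
    by (rule chart_hoelder_coefficient[OF M x \<alpha>0 c ab b that])
  have gh: "hoelder_on \<alpha> {a..b} (?g i)" for i by (rule chart_hoelder_coordinate[OF M x \<alpha>0 c ab])
  have "\<forall>i\<in>Basis. \<exists>Z K. K \<ge> 0 \<and> (\<forall>u v. a \<le> u \<longrightarrow> u \<le> v \<longrightarrow> v \<le> b \<longrightarrow>
    \<bar>Z v - Z u - ?f i u * (?g i v - ?g i u)\<bar> \<le> K * (v - u) powr (2 * \<alpha>))"
    using young_primitive[OF \<alpha> fh gh] by blast
  then obtain Z K where ZK: "\<forall>i\<in>Basis. K i \<ge> 0 \<and> (\<forall>u v. a \<le> u \<longrightarrow> u \<le> v \<longrightarrow> v \<le> b \<longrightarrow>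
    \<bar>Z i v - Z i u - ?f i u * (?g i v - ?g i u)\<bar> \<le> K i * (v - u) powr (2 * \<alpha>))"
    unfolding bchoice_iff by (elim exE)
  let ?Z = "\<lambda>v. \<Sum>i\<in>Basis. Z i v"
  let ?K = "\<Sum>i\<in>(Basis::'e set). K i"
  show ?thesis
  proof (intro exI[of _ ?Z] exI[of _ ?K] conjI allI impI)
    show "0 \<le> ?K" using ZK by (intro sum_nonneg) auto
    fix u v assume uv: "a \<le> u" "u \<le> v" "v \<le> b"
    have "has_RS_integral (?f i) (?g i) u v (Z i v - Z i u)" if i: "i \<in> Basis" for i
    proof (rule has_RS_integral_young_primitive[OF \<alpha> uv(2)])
      show "hoelder_on \<alpha> {u..v} (?f i)" "hoelder_on \<alpha> {u..v} (?g i)"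
        using uv by (auto intro: hoelder_on_subset[OF fh[OF i]] hoelder_on_subset[OF gh])
      show "K i \<ge> 0" using ZK i by blast
      fix u' v' assume "u \<le> u'" "u' \<le> v'" "v' \<le> v"
      then show "\<bar>Z i v' - Z i u' - ?f i u' * (?g i v' - ?g i u')\<bar> \<le> K i * (v' - u') powr (2 * \<alpha>)"
        using bspec[OF ZK i] uv by simp
    qed
    then show "has_chart_integral M (U, \<phi>) \<beta> x u v (?Z v - ?Z u)"
      unfolding has_chart_integral_def
      by (intro exI[of _ "\<lambda>i. Z i v - Z i u"]) (simp add: sum_subtractf)
    have "\<bar>?Z v - ?Z u - (\<Sum>i\<in>Basis. ?f i u * (?g i v - ?g i u))\<bar>
      = \<bar>\<Sum>i\<in>Basis. Z i v - Z i u - ?f i u * (?g i v - ?g i u)\<bar>"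
      by (simp add: sum_subtractf)
    also have "\<dots> \<le> (\<Sum>i\<in>Basis. K i * (v - u) powr (2 * \<alpha>))"
      using ZK uv by (intro order_trans[OF sum_abs] sum_mono) auto
    finally show "\<bar>?Z v - ?Z u - (\<Sum>i\<in>Basis. ?f i u * (?g i v - ?g i u))\<bar> \<le> ?K * (v - u) powr (2 * \<alpha>)"
      by (simp add: sum_distrib_right)
  qed
qed

lemma has_chart_integral_unique:
  assumes "a \<le> b" "has_chart_integral M c \<beta> x a b I" "has_chart_integral M c \<beta> x a b J"
  shows "I = J"
proof -
  obtain f where f: "\<forall>i\<in>Basis. has_RS_integral (\<lambda>s. \<beta> (x s) (coord_vector M c i (x s))) (\<lambda>s. snd c (x s) \<bullet> i) a b (f i)"
    "I = sum f Basis" using assms(2) unfolding has_chart_integral_def by (elim exE conjE)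
  obtain g where g: "\<forall>i\<in>Basis. has_RS_integral (\<lambda>s. \<beta> (x s) (coord_vector M c i (x s))) (\<lambda>s. snd c (x s) \<bullet> i) a b (g i)"
    "J = sum g Basis" using assms(3) unfolding has_chart_integral_def by (elim exE conjE)
  have "f i = g i" if "i \<in> Basis" for i
    by (rule has_RS_integral_unique[OF assms(1) bspec[OF f(1) that] bspec[OF g(1) that]])
  then show ?thesis unfolding f(2) g(2) by (intro sum.cong) auto
qed

text \<open>The heart of the matter. The primitives \<open>W\<close> and \<open>Z\<close> of the two
  integrals have increments that agree up to
  \<open>O((v - u) powr (2 * \<alpha>))\<close>: each differs by that much from its linear
  approximation, and these approximations differ by the quadratic Taylor remainder of
  \<open>F\<close> in coordinates.\<close>

lemma chart_integral_pull_back: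
  fixes \<phi> :: "'a \<Rightarrow> 'm::euclidean_space" and \<psi> :: "'b \<Rightarrow> 'n::euclidean_space"
  assumes M: "smooth_manifold M" and N: "smooth_manifold N" and F: "smooth_map M N F"
    and x: "chart_hoelder M \<alpha> T x" and \<alpha>: "1/2 < \<alpha>" and \<beta>: "one_form N \<beta>"
    and c: "(U, \<phi>) \<in> atlas M" and d: "(V, \<psi>) \<in> atlas N"
    and ab: "0 \<le> a" "a \<le> b" "b \<le> T" and xU: "x ` {a..b} \<subseteq> U" and FV: "(F \<circ> x) ` {a..b} \<subseteq> V"
    and I: "has_chart_integral N (V, \<psi>) \<beta> (F \<circ> x) a b I"
  shows "has_chart_integral M (U, \<phi>) (pull_back N F \<beta>) x a b I"
proof -
  have \<alpha>0: "\<alpha> > 0" using \<alpha> by simp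
  let ?w = "\<lambda>i u. pull_back N F \<beta> (x u) (coord_vector M (U, \<phi>) i (x u))"
  let ?b = "\<lambda>j u. \<beta> (F (x u)) (coord_vector N (V, \<psi>) j (F (x u)))"
  let ?H = "\<lambda>z. \<psi> (F (inv_into U \<phi> z))"
  let ?S = "\<phi> ` (U \<inter> F -` V)"
  have Fx: "chart_hoelder N \<alpha> T (F \<circ> x)" by (rule chart_hoelder_smooth_map[OF M N F x \<alpha>0])
  obtain W K where W: "K \<ge> 0" "\<forall>u v. a \<le> u \<longrightarrow> u \<le> v \<longrightarrow> v \<le> b \<longrightarrow>
     has_chart_integral M (U, \<phi>) (pull_back N F \<beta>) x u v (W v - W u) \<and>
     \<bar>W v - W u - (\<Sum>i\<in>Basis. ?w i u * (\<phi> (x v) \<bullet> i - \<phi> (x u) \<bullet> i))\<bar> \<le> K * (v - u) powr (2 * \<alpha>)"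
    using chart_primitive[OF M x \<alpha> c ab xU one_form_pull_back[OF M N F \<beta>]] by (elim exE conjE)
  obtain Z L where Z: "L \<ge> 0" "\<forall>u v. a \<le> u \<longrightarrow> u \<le> v \<longrightarrow> v \<le> b \<longrightarrow>
     has_chart_integral N (V, \<psi>) \<beta> (F \<circ> x) u v (Z v - Z u) \<and>
     \<bar>Z v - Z u - (\<Sum>j\<in>Basis. ?b j u * (\<psi> (F (x v)) \<bullet> j - \<psi> (F (x u)) \<bullet> j))\<bar> \<le> L * (v - u) powr (2 * \<alpha>)"
    using chart_primitive[OF N Fx \<alpha> d ab FV \<beta>] unfolding o_def by (elim exE conjE)
  have "\<forall>j\<in>Basis. \<exists>B\<ge>0. \<forall>s\<in>{a..b}. norm (?b j s) \<le> B"
    using hoelder_on_bounded[OF chart_hoelder_coefficient[OF N Fx \<alpha>0 d ab FV \<beta>] ab(2) \<alpha>0] unfolding o_def by blast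
  then obtain B where B: "\<forall>j\<in>Basis. B j \<ge> 0 \<and> (\<forall>s\<in>{a..b}. norm (?b j s) \<le> B j)"
    unfolding bchoice_iff by (elim exE)
  have S: "open ?S"
    by (auto intro!: chart_open_image[OF M c smooth_map_vimage_open[OF M F c chart_open[OF N d]]])
  have H: "smooth_on ?H ?S" by (rule smooth_map_in_charts[OF F c d])
  \<comment> \<open>The pulled-back form, evaluated at the tangent vector with coordinates \<open>y\<close>, is \<open>\<beta>\<close> evaluated at the image of \<open>y\<close> under the Jacobian matrix.\<close>
  have germ: "(\<Sum>i\<in>Basis. ?w i u * (y \<bullet> i)) = (\<Sum>j\<in>Basis. ?b j u * (frechet_derivative ?H (at (\<phi> (x u))) y \<bullet> j))"
    if u: "u \<in> {a..b}" for u y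
  proof -
    let ?D = "frechet_derivative ?H (at (\<phi> (x u)))"
    have p: "x u \<in> U" "F (x u) \<in> V" using u xU FV by auto
    have Hd: "?H differentiable (at (\<phi> (x u)))" using p by (intro smooth_on_differentiable[OF H]) auto
    have "(\<Sum>i\<in>Basis. ?w i u * (y \<bullet> i)) = (\<Sum>i\<in>Basis. \<Sum>j\<in>Basis. (?D i \<bullet> j) * ?b j u * (y \<bullet> i))"
      unfolding pull_back_coeff[OF M N F \<beta> c d p] by (simp add: sum_distrib_right)
    also have "\<dots> = (\<Sum>j\<in>Basis. \<Sum>i\<in>Basis. (?D i \<bullet> j) * ?b j u * (y \<bullet> i))" by (rule sum.swap)
    also have "\<dots> = (\<Sum>j\<in>Basis. ?b j u * (?D y \<bullet> j))"
    proof (rule sum.cong[OF refl])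
      fix j :: 'n
      have "?D y \<bullet> j = (\<Sum>i\<in>Basis. (y \<bullet> i) * (?D i \<bullet> j))"
        by (subst frechet_derivative_Basis[OF Hd]) (simp add: inner_sum_left)
      then show "(\<Sum>i\<in>Basis. (?D i \<bullet> j) * ?b j u * (y \<bullet> i)) = ?b j u * (?D y \<bullet> j)"
        by (simp add: sum_distrib_left mult_ac)
    qed
    finally show ?thesis .
  qed
  have "W a - Z a = W b - Z b"
  proof (rule constant_of_local_power_bound[OF ab(2), of "2 * \<alpha>"])
    show "1 < 2 * \<alpha>" using \<alpha> by simp
    fix t assume t: "t \<in> {a..b}"
    have xt: "t \<in> {0..T}" "x t \<in> U" "F (x t) \<in> V" using t ab xU FV by auto
    then have tS: "\<phi> (x t) \<in> ?S" by simp
    obtain r Q where r: "r > 0" "Q \<ge> 0" "cball (\<phi> (x t)) r \<subseteq> ?S"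
      "\<forall>y\<in>cball (\<phi> (x t)) r. \<forall>z\<in>cball (\<phi> (x t)) r.
        norm (?H z - ?H y - frechet_derivative ?H (at y) (z - y)) \<le> Q * (norm (z - y))\<^sup>2"
      using smooth_on_local_Taylor[OF H S tS] by (elim exE conjE)
    obtain \<delta> C where \<delta>: "\<delta> > 0" "C \<ge> 0" "\<forall>s\<in>{0..T}. \<forall>s'\<in>{0..T}. \<bar>s - t\<bar> < \<delta> \<longrightarrow> \<bar>s' - t\<bar> < \<delta> \<longrightarrow>
       x s \<in> U \<and> \<phi> (x s) \<in> cball (\<phi> (x t)) r \<and> norm (\<phi> (x s') - \<phi> (x s)) \<le> C * \<bar>s' - s\<bar> powr \<alpha>"
      using chart_hoelder_near[OF x \<alpha>0 c xt(1,2) r(1)] by (elim exE conjE)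
    define E where "E = K + L + (\<Sum>j\<in>(Basis::'n set). B j) * (Q * C\<^sup>2)"
    have E: "E \<ge> 0" unfolding E_def using W(1) Z(1) B r(2) by (intro add_nonneg_nonneg mult_nonneg_nonneg sum_nonneg) auto
    have "\<bar>(W v - Z v) - (W u - Z u)\<bar> \<le> E * (v - u) powr (2 * \<alpha>)"
      if uv: "u \<in> {a..b}" "v \<in> {a..b}" "\<bar>u - t\<bar> < \<delta>" "\<bar>v - t\<bar> < \<delta>" "u \<le> v" for u v
    proof -
      let ?y = "\<phi> (x v) - \<phi> (x u)"
      let ?D = "frechet_derivative ?H (at (\<phi> (x u)))"
      let ?R = "\<psi> (F (x v)) - \<psi> (F (x u)) - ?D ?y"
      have T: "u \<in> {0..T}" "v \<in> {0..T}" using uv ab by auto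
      have near: "\<phi> (x u) \<in> cball (\<phi> (x t)) r" "\<phi> (x v) \<in> cball (\<phi> (x t)) r" "norm ?y \<le> C * (v - u) powr \<alpha>"
        using \<delta>(3)[rule_format, OF T uv(3,4)] \<delta>(3)[rule_format, OF T(2,1) uv(4,3)] uv(5) by auto
      have HF: "?H (\<phi> (x s)) = \<psi> (F (x s))" if "s \<in> {a..b}" for s
        using that xU by (subst chart_inverse[OF M c]) auto
      have "norm ?R \<le> Q * (norm ?y)\<^sup>2"
        using r(4)[rule_format, OF near(1,2)] by (simp only: HF[OF uv(1)] HF[OF uv(2)])
      also have "\<dots> \<le> Q * (C * (v - u) powr \<alpha>)\<^sup>2"
        using near(3) r(2) by (intro mult_left_mono power_mono) auto
      also have "\<dots> = Q * C\<^sup>2 * (v - u) powr (2 * \<alpha>)"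
        by (simp add: power_mult_distrib power2_eq_square powr_add[symmetric])
      finally have R: "norm ?R \<le> Q * C\<^sup>2 * (v - u) powr (2 * \<alpha>)" .
      have "\<bar>\<Sum>j\<in>Basis. ?b j u * (?R \<bullet> j)\<bar> \<le> (\<Sum>j\<in>(Basis::'n set). B j * (Q * C\<^sup>2 * (v - u) powr (2 * \<alpha>)))"
      proof (intro order_trans[OF sum_abs] sum_mono)
        fix j :: 'n assume j: "j \<in> Basis"
        have "\<bar>?b j u\<bar> \<le> B j" "0 \<le> B j" using B j uv(1) by auto
        moreover have "\<bar>?R \<bullet> j\<bar> \<le> Q * C\<^sup>2 * (v - u) powr (2 * \<alpha>)"
          using Basis_le_norm[OF j, of ?R] R by linarith
        ultimately show "\<bar>?b j u * (?R \<bullet> j)\<bar> \<le> B j * (Q * C\<^sup>2 * (v - u) powr (2 * \<alpha>))"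
          unfolding abs_mult by (intro mult_mono) auto
      qed
      also have "\<dots> = (\<Sum>j\<in>(Basis::'n set). B j) * (Q * C\<^sup>2) * (v - u) powr (2 * \<alpha>)"
        by (simp add: sum_distrib_right mult.assoc)
      finally have rem: "\<bar>\<Sum>j\<in>Basis. ?b j u * (?R \<bullet> j)\<bar> \<le> (\<Sum>j\<in>(Basis::'n set). B j) * (Q * C\<^sup>2) * (v - u) powr (2 * \<alpha>)" .
      have "(\<Sum>i\<in>Basis. ?w i u * (\<phi> (x v) \<bullet> i - \<phi> (x u) \<bullet> i)) = (\<Sum>i\<in>Basis. ?w i u * (?y \<bullet> i))"
        by (simp only: inner_diff_left)
      also have "\<dots> = (\<Sum>j\<in>Basis. ?b j u * (?D ?y \<bullet> j))" by (rule germ[OF uv(1)])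
      finally have g: "(\<Sum>j\<in>Basis. ?b j u * (\<psi> (F (x v)) \<bullet> j - \<psi> (F (x u)) \<bullet> j))
         - (\<Sum>i\<in>Basis. ?w i u * (\<phi> (x v) \<bullet> i - \<phi> (x u) \<bullet> i)) = (\<Sum>j\<in>Basis. ?b j u * (?R \<bullet> j))"
        by (simp only: inner_diff_left right_diff_distrib sum_subtractf)
      have w: "\<bar>W v - W u - (\<Sum>i\<in>Basis. ?w i u * (\<phi> (x v) \<bullet> i - \<phi> (x u) \<bullet> i))\<bar> \<le> K * (v - u) powr (2 * \<alpha>)"
        using W(2)[rule_format, of u v] uv by simp
      have z: "\<bar>Z v - Z u - (\<Sum>j\<in>Basis. ?b j u * (\<psi> (F (x v)) \<bullet> j - \<psi> (F (x u)) \<bullet> j))\<bar> \<le> L * (v - u) powr (2 * \<alpha>)"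
        using Z(2)[rule_format, of u v] uv by simp
      have "\<bar>(W v - Z v) - (W u - Z u)\<bar> \<le> K * (v - u) powr (2 * \<alpha>) + L * (v - u) powr (2 * \<alpha>)
          + (\<Sum>j\<in>(Basis::'n set). B j) * (Q * C\<^sup>2) * (v - u) powr (2 * \<alpha>)"
        using w z rem unfolding g[symmetric] by linarith
      then show ?thesis by (simp add: E_def distrib_right)
    qed
    then show "\<exists>\<delta>>0. \<exists>K\<ge>0. \<forall>u\<in>{a..b}. \<forall>v\<in>{a..b}. \<bar>u - t\<bar> < \<delta> \<longrightarrow> \<bar>v - t\<bar> < \<delta> \<longrightarrow> u \<le> v \<longrightarrow>
       \<bar>W v - Z v - (W u - Z u)\<bar> \<le> K * (v - u) powr (2 * \<alpha>)"
      using \<delta>(1) E by (intro exI[of _ \<delta>] conjI exI[of _ E]) auto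
  qed
  then have "W b - W a = Z b - Z a" by simp
  moreover have "has_chart_integral N (V, \<psi>) \<beta> (F \<circ> x) a b (Z b - Z a)" using Z(2) ab by simp
  then have "I = Z b - Z a" using has_chart_integral_unique[OF ab(2) I] by simp
  moreover have "has_chart_integral M (U, \<phi>) (pull_back N F \<beta>) x a b (W b - W a)" using W(2) ab by simp
  ultimately show ?thesis by simp
qed

text \<open>A change of charts is the pull-back by the identity map, read in two different charts.\<close>

lemma chart_integral_change_chart:
  assumes M: "smooth_manifold M" and x: "chart_hoelder M \<alpha> T x" and \<alpha>: "1/2 < \<alpha>" and \<beta>: "one_form M \<beta>"
    and c: "(U, \<phi>) \<in> atlas M" and d: "(V, \<psi>) \<in> atlas M"
    and ab: "0 \<le> a" "a \<le> b" "b \<le> T" and xU: "x ` {a..b} \<subseteq> U" and xV: "x ` {a..b} \<subseteq> V"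
    and I: "has_chart_integral M (V, \<psi>) \<beta> x a b I"
  shows "has_chart_integral M (U, \<phi>) \<beta> x a b I"
proof -
  \<comment> \<open>Chart integrals evaluate a form on coordinate vectors only, and there the pull-back by the identity is the form itself.\<close>
  have "push_forward M id p (coord_vector M (U, \<phi>) i p) = coord_vector M (U, \<phi>) i p" for i p
    by (auto simp: push_forward_def coord_vector_apply)
  moreover have "has_chart_integral M (U, \<phi>) (pull_back M id \<beta>) x a b I"
    using chart_integral_pull_back[OF M M smooth_map_id[OF M] x \<alpha> \<beta> c d ab xU, of I] xV I by simp
  ultimately show ?thesis by (simp add: has_chart_integral_def pull_back_def)
qed

section \<open>Primitives along a curve and global integrals\<close>

text \<open>An indefinite integral of \<open>\<beta>\<close> along \<open>x\<close>. Asking for one function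
  that serves all charts at once encodes the independence of the charts.\<close>

definition form_primitive ::
  "('a, 'e::euclidean_space) manifold \<Rightarrow> 'a form \<Rightarrow> (real \<Rightarrow> 'a) \<Rightarrow> real \<Rightarrow> real \<Rightarrow> (real \<Rightarrow> real) \<Rightarrow> bool" where
  "form_primitive M \<beta> x a b Z \<longleftrightarrow>
     (\<forall>c\<in>atlas M. \<forall>u v. a \<le> u \<longrightarrow> u \<le> v \<longrightarrow> v \<le> b \<longrightarrow> x ` {u..v} \<subseteq> fst c \<longrightarrow>
        has_chart_integral M c \<beta> x u v (Z v - Z u))"

lemma form_primitiveD:
  assumes "form_primitive M \<beta> x a b Z" "c \<in> atlas M" "a \<le> u" "u \<le> v" "v \<le> b" "x ` {u..v} \<subseteq> fst c"
  shows "has_chart_integral M c \<beta> x u v (Z v - Z u)"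
  using assms unfolding form_primitive_def by simp

lemma form_primitive_local:
  assumes M: "smooth_manifold M" and x: "chart_hoelder M \<alpha> T x" and \<alpha>: "1/2 < \<alpha>" and \<beta>: "one_form M \<beta>"
    and c: "(U, \<phi>) \<in> atlas M" and ab: "0 \<le> a" "a \<le> b" "b \<le> T" and xU: "x ` {a..b} \<subseteq> U"
  shows "\<exists>Z. form_primitive M \<beta> x a b Z"
proof -
  obtain Y K where Y: "\<forall>s t. a \<le> s \<longrightarrow> s \<le> t \<longrightarrow> t \<le> b \<longrightarrow>
      has_chart_integral M (U, \<phi>) \<beta> x s t (Y t - Y s) \<and>
      \<bar>Y t - Y s - (\<Sum>i\<in>Basis. \<beta> (x s) (coord_vector M (U, \<phi>) i (x s)) * (\<phi> (x t) \<bullet> i - \<phi> (x s) \<bullet> i))\<bar>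
       \<le> K * (t - s) powr (2 * \<alpha>)"
    using chart_primitive[OF M x \<alpha> c ab xU \<beta>] by (elim exE conjE)
  have "form_primitive M \<beta> x a b Y"
    unfolding form_primitive_def
  proof (clarsimp)
    fix V \<psi> u v assume d: "(V, \<psi>) \<in> atlas M" and u: "a \<le> u" "u \<le> v" "v \<le> b" and xV: "x ` {u..v} \<subseteq> V"
    have sub: "x ` {u..v} \<subseteq> U" using u by (intro subset_trans[OF image_mono xU]) auto
    have "0 \<le> u" "v \<le> T" using u ab by auto
    then show "has_chart_integral M (V, \<psi>) \<beta> x u v (Y v - Y u)"
      using chart_integral_change_chart[OF M x \<alpha> \<beta> d c _ u(2) _ xV sub] Y u by simp
  qed
  then show ?thesis by blast
qed

text \<open>Concatenating Riemann--Stieltjes integrals over adjacent intervals is not possible in general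
  when limits are taken along the mesh. For Hoelder curves the integral over the union exists,
  and it equals the sum because both are increments of one primitive.\<close>

lemma chart_integral_additive:
  assumes M: "smooth_manifold M" and x: "chart_hoelder M \<alpha> T x" and \<alpha>: "1/2 < \<alpha>" and \<beta>: "one_form M \<beta>"
    and c: "c \<in> atlas M" and u: "0 \<le> u" "u \<le> b" "b \<le> v" "v \<le> T" and xc: "x ` {u..v} \<subseteq> fst c"
    and I: "has_chart_integral M c \<beta> x u b I" and J: "has_chart_integral M c \<beta> x b v J"
  shows "has_chart_integral M c \<beta> x u v (I + J)"
proof -
  obtain U \<phi> where c': "(U, \<phi>) = c" by (metis surj_pair)
  have uv: "u \<le> v" using u by simp
  obtain Y where Y: "form_primitive M \<beta> x u v Y"
    using form_primitive_local[OF M x \<alpha> \<beta> c[folded c'] u(1) uv u(4) xc[folded c', unfolded fst_conv]] by (elim exE)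
  have sub: "x ` {u..b} \<subseteq> fst c" "x ` {b..v} \<subseteq> fst c"
    using u by (auto intro!: subset_trans[OF image_mono xc])
  have "I = Y b - Y u" "J = Y v - Y b"
    using has_chart_integral_unique[OF u(2) I form_primitiveD[OF Y c order_refl u(2,3) sub(1)]]
      has_chart_integral_unique[OF u(3) J form_primitiveD[OF Y c u(2,3) order_refl sub(2)]] .
  then show ?thesis using form_primitiveD[OF Y c order_refl uv order_refl xc] by simp
qed

lemma form_primitive_glue:
  assumes M: "smooth_manifold M" and x: "chart_hoelder M \<alpha> T x" and \<alpha>: "1/2 < \<alpha>" and \<beta>: "one_form M \<beta>"
    and le: "0 \<le> a" "a \<le> b" "b \<le> e" "e \<le> T"
    and Z: "form_primitive M \<beta> x a b Z" and W: "form_primitive M \<beta> x b e W"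
  shows "form_primitive M \<beta> x a e (\<lambda>t. if t \<le> b then Z t else W t - W b + Z b)"
  unfolding form_primitive_def
proof (intro ballI allI impI)
  let ?Y = "\<lambda>t. if t \<le> b then Z t else W t - W b + Z b"
  fix c u v assume c: "c \<in> atlas M" and u: "a \<le> u" "u \<le> v" "v \<le> e" and xc: "x ` {u..v} \<subseteq> fst c"
  have Yb: "?Y t = W t - W b + Z b" if "b \<le> t" for t using that by (cases "t = b") auto
  consider "v \<le> b" | "b \<le> u" | "u \<le> b" "b \<le> v" by linarith
  then show "has_chart_integral M c \<beta> x u v (?Y v - ?Y u)"
  proof cases
    case 1
    then show ?thesis using form_primitiveD[OF Z c u(1,2) _ xc] u by simp
  next
    case 2
    then have "?Y v - ?Y u = W v - W u" using Yb[of u] Yb[of v] u by linarith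
    then show ?thesis using form_primitiveD[OF W c 2 u(2,3) xc] by simp
  next
    case 3
    have sub: "x ` {u..b} \<subseteq> fst c" "x ` {b..v} \<subseteq> fst c"
      using 3 by (auto intro!: subset_trans[OF image_mono xc])
    have "has_chart_integral M c \<beta> x u v ((Z b - Z u) + (W v - W b))"
    proof (rule chart_integral_additive[OF M x \<alpha> \<beta> c _ 3 _ xc])
      show "has_chart_integral M c \<beta> x u b (Z b - Z u)" by (rule form_primitiveD[OF Z c u(1) 3(1) _ sub(1)]) simp
      show "has_chart_integral M c \<beta> x b v (W v - W b)" by (rule form_primitiveD[OF W c _ 3(2) u(3) sub(2)]) simp
    qed (use le u in auto)
    moreover have "?Y v - ?Y u = (Z b - Z u) + (W v - W b)" using Yb[OF 3(2)] 3(1) by simp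
    ultimately show ?thesis by simp
  qed
qed

lemma chart_hoelder_local_chart:
  assumes M: "smooth_manifold M" and x: "chart_hoelder M \<alpha> T x" and t: "t \<in> {0..T}"
  shows "\<exists>U \<phi> \<delta>. (U, \<phi>) \<in> atlas M \<and> \<delta> > 0 \<and>
    (\<forall>a b. 0 \<le> a \<longrightarrow> a \<le> t \<longrightarrow> t \<le> b \<longrightarrow> b \<le> T \<longrightarrow> b - a < \<delta> \<longrightarrow> x ` {a..b} \<subseteq> U)"
proof -
  have "x t \<in> points M" using x t by (auto simp: chart_hoelder_def)
  then obtain U \<phi> where c: "(U, \<phi>) \<in> atlas M" "x t \<in> U" by (rule chart_exists[OF M])
  obtain \<delta> C where \<delta>: "\<delta> > 0" "\<forall>s\<in>{0..T}. \<forall>s'\<in>{0..T}. \<bar>s - t\<bar> < \<delta> \<longrightarrow> \<bar>s' - t\<bar> < \<delta> \<longrightarrow>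
           x s \<in> U \<and> norm (\<phi> (x s') - \<phi> (x s)) \<le> C * \<bar>s' - s\<bar> powr \<alpha>"
    using x c t unfolding chart_hoelder_def by (meson)
  have "x ` {a..b} \<subseteq> U" if "0 \<le> a" "a \<le> t" "t \<le> b" "b \<le> T" "b - a < \<delta>" for a b
  proof
    fix p assume "p \<in> x ` {a..b}"
    then obtain s where s: "p = x s" "a \<le> s" "s \<le> b" by auto
    have "s \<in> {0..T}" "\<bar>s - t\<bar> < \<delta>" using s that by auto
    then show "p \<in> U" using \<delta>(2)[rule_format, of s s] s(1) by blast
  qed
  then show ?thesis using c(1) \<delta>(1) by (intro exI[of _ U] exI[of _ \<phi>] exI[of _ \<delta>]) simp
qed

lemma form_primitive_exists:
  assumes M: "smooth_manifold M" and x: "chart_hoelder M \<alpha> T x" and \<alpha>: "1/2 < \<alpha>" and \<beta>: "one_form M \<beta>" and "0 \<le> T"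
  shows "\<exists>Z. form_primitive M \<beta> x 0 T Z"
proof -
  define P where "P a b \<longleftrightarrow> (0 \<le> a \<longrightarrow> b \<le> T \<longrightarrow> (\<exists>Z. form_primitive M \<beta> x a b Z))" for a b
  have "P 0 T"
    using \<open>0 \<le> T\<close>
  proof (rule Bolzano)
    fix a b e assume P: "P a b" "P b e" and le: "a \<le> b" "b \<le> e"
    show "P a e"
      unfolding P_def
    proof (intro impI)
      assume ae: "0 \<le> a" "e \<le> T"
      then obtain Z W where "form_primitive M \<beta> x a b Z" "form_primitive M \<beta> x b e W"
        using P le unfolding P_def by fastforce
      from form_primitive_glue[OF M x \<alpha> \<beta> ae(1) le ae(2) this]
      show "\<exists>Z. form_primitive M \<beta> x a e Z" by (rule exI[of _ "\<lambda>t. if t \<le> b then Z t else W t - W b + Z b"])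
    qed
  next
    fix t assume t: "0 \<le> t" "t \<le> T"
    then have t': "t \<in> {0..T}" by simp
    obtain U \<phi> \<delta> where c: "(U, \<phi>) \<in> atlas M" "\<delta> > 0"
      "\<forall>a b. 0 \<le> a \<longrightarrow> a \<le> t \<longrightarrow> t \<le> b \<longrightarrow> b \<le> T \<longrightarrow> b - a < \<delta> \<longrightarrow> x ` {a..b} \<subseteq> U"
      using chart_hoelder_local_chart[OF M x t'] by (elim exE conjE)
    have "P a b" if "a \<le> t" "t \<le> b" "b - a < \<delta>" for a b
      unfolding P_def
    proof (intro impI)
      assume ab: "0 \<le> a" "b \<le> T"
      show "\<exists>Z. form_primitive M \<beta> x a b Z"
        using that by (intro form_primitive_local[OF M x \<alpha> \<beta> c(1) ab(1) _ ab(2)] c(3)[rule_format] ab) auto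
    qed
    then show "\<exists>d>0. \<forall>a b. a \<le> t \<and> t \<le> b \<and> b - a < d \<longrightarrow> P a b"
      using c(2) by (intro exI[of _ \<delta>]) simp
  qed
  then show ?thesis using \<open>0 \<le> T\<close> by (simp add: P_def)
qed

definition chart_subdivision ::
  "('a, 'e) manifold \<Rightarrow> (real \<Rightarrow> 'a) \<Rightarrow> real \<Rightarrow> real \<Rightarrow> nat \<Rightarrow> (nat \<Rightarrow> real) \<Rightarrow> (nat \<Rightarrow> 'a set \<times> ('a \<Rightarrow> 'e)) \<Rightarrow> bool" where
  "chart_subdivision M x a b n \<tau> c \<longleftrightarrow> \<tau> 0 = a \<and> \<tau> n = b \<and>
     (\<forall>i<n. \<tau> i \<le> \<tau> (Suc i) \<and> c i \<in> atlas M \<and> x ` {\<tau> i..\<tau> (Suc i)} \<subseteq> fst (c i))"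

lemma chart_subdivision_append:
  assumes "chart_subdivision M x a b n \<tau> c" "chart_subdivision M x b e m \<sigma> d"
  shows "chart_subdivision M x a e (n + m)
    (\<lambda>i. if i \<le> n then \<tau> i else \<sigma> (i - n)) (\<lambda>i. if i < n then c i else d (i - n))"
  unfolding chart_subdivision_def
proof (intro conjI allI impI)
  let ?\<tau> = "\<lambda>i. if i \<le> n then \<tau> i else \<sigma> (i - n)"
  let ?c = "\<lambda>i. if i < n then c i else d (i - n)"
  have 1: "\<tau> 0 = a" "\<tau> n = b" "\<And>i. i < n \<Longrightarrow> \<tau> i \<le> \<tau> (Suc i) \<and> c i \<in> atlas M \<and> x ` {\<tau> i..\<tau> (Suc i)} \<subseteq> fst (c i)"
    using assms(1) unfolding chart_subdivision_def by auto
  have 2: "\<sigma> 0 = b" "\<sigma> m = e" "\<And>i. i < m \<Longrightarrow> \<sigma> i \<le> \<sigma> (Suc i) \<and> d i \<in> atlas M \<and> x ` {\<sigma> i..\<sigma> (Suc i)} \<subseteq> fst (d i)"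
    using assms(2) unfolding chart_subdivision_def by auto
  have \<sigma>: "?\<tau> (n + k) = \<sigma> k" for k using 1(2) 2(1) by (cases k) auto
  show "?\<tau> 0 = a" using 1(1) by simp
  show "?\<tau> (n + m) = e" unfolding \<sigma> by (rule 2(2))
  fix i assume i: "i < n + m"
  show "?\<tau> i \<le> ?\<tau> (Suc i)" and "?c i \<in> atlas M" and "x ` {?\<tau> i..?\<tau> (Suc i)} \<subseteq> fst (?c i)"
  proof (atomize (full), cases "i < n")
    case True
    then show "?\<tau> i \<le> ?\<tau> (Suc i) \<and> ?c i \<in> atlas M \<and> x ` {?\<tau> i..?\<tau> (Suc i)} \<subseteq> fst (?c i)"
      using 1(3)[of i] by simp
  next
    case False
    then obtain k where k: "i = n + k" by (metis le_Suc_ex not_less)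
    have "?\<tau> i = \<sigma> k" "?\<tau> (Suc i) = \<sigma> (Suc k)" "?c i = d k"
      using \<sigma>[of k] \<sigma>[of "Suc k"] unfolding k by auto
    then show "?\<tau> i \<le> ?\<tau> (Suc i) \<and> ?c i \<in> atlas M \<and> x ` {?\<tau> i..?\<tau> (Suc i)} \<subseteq> fst (?c i)"
      using 2(3)[of k] i k by (simp only:)
  qed
qed

lemma chart_subdivision_exists:
  assumes M: "smooth_manifold M" and x: "chart_hoelder M \<alpha> T x" and t: "0 \<le> t" "t \<le> T"
  shows "\<exists>n \<tau> c. chart_subdivision M x 0 t n \<tau> c"
proof -
  define P where "P a b \<longleftrightarrow> (0 \<le> a \<longrightarrow> b \<le> T \<longrightarrow> (\<exists>n \<tau> c. chart_subdivision M x a b n \<tau> c))" for a b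
  have "P 0 t"
    using t(1)
  proof (rule Bolzano)
    fix a b e assume P: "P a b" "P b e" and le: "a \<le> b" "b \<le> e"
    show "P a e"
      unfolding P_def
    proof (intro impI)
      assume ae: "0 \<le> a" "e \<le> T"
      have "\<exists>n \<tau> c. chart_subdivision M x a b n \<tau> c" using P(1) ae le unfolding P_def by simp
      moreover have "\<exists>n \<tau> c. chart_subdivision M x b e n \<tau> c" using P(2) ae le unfolding P_def by simp
      ultimately show "\<exists>n \<tau> c. chart_subdivision M x a e n \<tau> c"
        by (elim exE) (drule (1) chart_subdivision_append, intro exI)
    qed
  next
    fix s assume s: "0 \<le> s" "s \<le> t"
    then have s': "s \<in> {0..T}" using t by simp
    obtain U \<phi> \<delta> where c: "(U, \<phi>) \<in> atlas M" "\<delta> > 0"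
      "\<forall>a b. 0 \<le> a \<longrightarrow> a \<le> s \<longrightarrow> s \<le> b \<longrightarrow> b \<le> T \<longrightarrow> b - a < \<delta> \<longrightarrow> x ` {a..b} \<subseteq> U"
      using chart_hoelder_local_chart[OF M x s'] by (elim exE conjE)
    have "P a b" if "a \<le> s" "s \<le> b" "b - a < \<delta>" for a b
      unfolding P_def
    proof (intro impI)
      assume ab: "0 \<le> a" "b \<le> T"
      have "chart_subdivision M x a b 1 (\<lambda>i. if i = 0 then a else b) (\<lambda>_. (U, \<phi>))"
        unfolding chart_subdivision_def using c(1) c(3)[rule_format, OF ab(1) that(1,2) ab(2) that(3)] that by simp
      then show "\<exists>n \<tau> c. chart_subdivision M x a b n \<tau> c" by (intro exI)
    qed
    then show "\<exists>d>0. \<forall>a b. a \<le> s \<and> s \<le> b \<and> b - a < d \<longrightarrow> P a b"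
      using c(2) by (intro exI[of _ \<delta>]) simp
  qed
  then show ?thesis using t by (simp add: P_def)
qed

text \<open>The values on the pieces of any subdivision are forced to be increments of \<open>Z\<close>, and
  these telescope; conversely every subdivision into pieces contained in charts realises the
  value.\<close>

lemma has_form_integral_iff_primitive:
  assumes M: "smooth_manifold M" and x: "chart_hoelder M \<alpha> T x" and t: "0 \<le> t" "t \<le> T"
    and Z: "form_primitive M \<beta> x 0 T Z"
  shows "has_form_integral M \<beta> x 0 t I \<longleftrightarrow> I = Z t - Z 0"
proof
  assume "has_form_integral M \<beta> x 0 t I"
  then obtain n \<tau> c J where "\<tau> 0 = 0" "\<tau> n = t" and I: "I = (\<Sum>i<n. J i)"
    and step: "\<forall>i<n. \<tau> i \<le> \<tau> (Suc i) \<and> c i \<in> atlas M \<and> x ` {\<tau> i..\<tau> (Suc i)} \<subseteq> fst (c i) \<and>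
           has_chart_integral M (c i) \<beta> x (\<tau> i) (\<tau> (Suc i)) (J i)"
    unfolding has_form_integral_def by (elim exE conjE)
  have mono: "\<tau> i \<le> \<tau> j" if "i \<le> j" "j \<le> n" for i j
    using step that by (intro monotone_partition[of n \<tau> i j]) auto
  have "J i = Z (\<tau> (Suc i)) - Z (\<tau> i)" if i: "i < n" for i
  proof -
    have s: "\<tau> i \<le> \<tau> (Suc i)" "c i \<in> atlas M" "x ` {\<tau> i..\<tau> (Suc i)} \<subseteq> fst (c i)"
      "has_chart_integral M (c i) \<beta> x (\<tau> i) (\<tau> (Suc i)) (J i)"
      using step i by auto
    have "0 \<le> \<tau> i" "\<tau> (Suc i) \<le> T" using mono[of 0 i] mono[of "Suc i" n] i t \<open>\<tau> 0 = 0\<close> \<open>\<tau> n = t\<close> by auto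
    from has_chart_integral_unique[OF s(1,4) form_primitiveD[OF Z s(2) this(1) s(1) this(2) s(3)]]
    show ?thesis .
  qed
  then have "I = (\<Sum>i<n. Z (\<tau> (Suc i)) - Z (\<tau> i))" unfolding I by (intro sum.cong) auto
  also have "\<dots> = Z t - Z 0"
    using sum_lessThan_telescope[of "\<lambda>i. Z (\<tau> i)" n] \<open>\<tau> 0 = 0\<close> \<open>\<tau> n = t\<close> by simp
  finally show "I = Z t - Z 0" .
next
  assume I: "I = Z t - Z 0"
  obtain n \<tau> c where "chart_subdivision M x 0 t n \<tau> c"
    using chart_subdivision_exists[OF M x t] by (elim exE)
  then have \<tau>: "\<tau> 0 = 0" "\<tau> n = t"
    and step: "\<And>i. i < n \<Longrightarrow> \<tau> i \<le> \<tau> (Suc i) \<and> c i \<in> atlas M \<and> x ` {\<tau> i..\<tau> (Suc i)} \<subseteq> fst (c i)"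
    unfolding chart_subdivision_def by auto
  have mono: "\<tau> i \<le> \<tau> j" if "i \<le> j" "j \<le> n" for i j
    using step that by (intro monotone_partition[of n \<tau> i j]) auto
  have "has_chart_integral M (c i) \<beta> x (\<tau> i) (\<tau> (Suc i)) (Z (\<tau> (Suc i)) - Z (\<tau> i))" if i: "i < n" for i
    using step[OF i] mono[of 0 i] mono[of "Suc i" n] i t \<tau> by (intro form_primitiveD[OF Z]) auto
  moreover have "I = (\<Sum>i<n. Z (\<tau> (Suc i)) - Z (\<tau> i))"
    using sum_lessThan_telescope[of "\<lambda>i. Z (\<tau> i)" n] \<tau> I by simp
  ultimately show "has_form_integral M \<beta> x 0 t I"
    unfolding has_form_integral_def using \<tau> step
    by (intro exI[of _ n] exI[of _ \<tau>] exI[of _ c] exI[of _ "\<lambda>i. Z (\<tau> (Suc i)) - Z (\<tau> i)"]) simp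
qed

lemma form_integral_eq_primitive:
  assumes M: "smooth_manifold M" and x: "chart_hoelder M \<alpha> T x" and t: "0 \<le> t" "t \<le> T"
    and Z: "form_primitive M \<beta> x 0 T Z"
  shows "form_integrable M \<beta> x 0 t" "form_integral M \<beta> x 0 t = Z t - Z 0"
  unfolding form_integrable_def form_integral_def has_form_integral_iff_primitive[OF assms] by simp_all

text \<open>The two primitives have equal increments on short intervals by the computation in charts, hence
  on all intervals by bisection.\<close>

lemma form_integral_pull_back:
  assumes M: "smooth_manifold M" and N: "smooth_manifold N" and F: "smooth_map M N F"
    and x: "chart_hoelder M \<alpha> T x" and \<alpha>: "1/2 < \<alpha>" and \<beta>: "one_form N \<beta>" and t: "0 \<le> t" "t \<le> T"
  shows "form_integrable N \<beta> (F \<circ> x) 0 t" "form_integrable M (pull_back N F \<beta>) x 0 t"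
    "form_integral N \<beta> (F \<circ> x) 0 t = form_integral M (pull_back N F \<beta>) x 0 t"
proof -
  have \<alpha>0: "\<alpha> > 0" and T: "0 \<le> T" using \<alpha> t by auto
  have Fx: "chart_hoelder N \<alpha> T (F \<circ> x)" by (rule chart_hoelder_smooth_map[OF M N F x \<alpha>0])
  obtain W where W: "form_primitive N \<beta> (F \<circ> x) 0 T W"
    using form_primitive_exists[OF N Fx \<alpha> \<beta> T] by (elim exE)
  obtain Z where Z: "form_primitive M (pull_back N F \<beta>) x 0 T Z"
    using form_primitive_exists[OF M x \<alpha> one_form_pull_back[OF M N F \<beta>] T] by (elim exE)
  define P where "P a b \<longleftrightarrow> (0 \<le> a \<longrightarrow> b \<le> T \<longrightarrow> W b - W a = Z b - Z a)" for a b
  have "P 0 t"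
    using t(1)
  proof (rule Bolzano)
    fix a b e assume "P a b" "P b e" "a \<le> b" "b \<le> e"
    then show "P a e" unfolding P_def by auto
  next
    fix s assume s: "0 \<le> s" "s \<le> t"
    then have s': "s \<in> {0..T}" using t by simp
    obtain U \<phi> \<delta> where c: "(U, \<phi>) \<in> atlas M" "\<delta> > 0"
      "\<forall>a b. 0 \<le> a \<longrightarrow> a \<le> s \<longrightarrow> s \<le> b \<longrightarrow> b \<le> T \<longrightarrow> b - a < \<delta> \<longrightarrow> x ` {a..b} \<subseteq> U"
      using chart_hoelder_local_chart[OF M x s'] by (elim exE conjE)
    obtain V \<psi> \<epsilon> where d: "(V, \<psi>) \<in> atlas N" "\<epsilon> > 0"
      "\<forall>a b. 0 \<le> a \<longrightarrow> a \<le> s \<longrightarrow> s \<le> b \<longrightarrow> b \<le> T \<longrightarrow> b - a < \<epsilon> \<longrightarrow> (F \<circ> x) ` {a..b} \<subseteq> V"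
      using chart_hoelder_local_chart[OF N Fx s'] by (elim exE conjE)
    have "P a b" if ab: "a \<le> s" "s \<le> b" "b - a < min \<delta> \<epsilon>" for a b
      unfolding P_def
    proof (intro impI)
      assume 0: "0 \<le> a" "b \<le> T"
      have le: "a \<le> b" using ab by simp
      have xU: "x ` {a..b} \<subseteq> U" and FV: "(F \<circ> x) ` {a..b} \<subseteq> V" using c(3) d(3) ab 0 by auto
      have "has_chart_integral N (V, \<psi>) \<beta> (F \<circ> x) a b (W b - W a)"
        using FV by (intro form_primitiveD[OF W d(1) 0(1) le 0(2)]) simp
      from chart_integral_pull_back[OF M N F x \<alpha> \<beta> c(1) d(1) 0(1) le 0(2) xU FV this]
      have "has_chart_integral M (U, \<phi>) (pull_back N F \<beta>) x a b (W b - W a)" .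
      moreover have "has_chart_integral M (U, \<phi>) (pull_back N F \<beta>) x a b (Z b - Z a)"
        using xU by (intro form_primitiveD[OF Z c(1) 0(1) le 0(2)]) simp
      ultimately show "W b - W a = Z b - Z a" by (rule has_chart_integral_unique[OF le])
    qed
    then show "\<exists>d>0. \<forall>a b. a \<le> s \<and> s \<le> b \<and> b - a < d \<longrightarrow> P a b"
      using c(2) d(2) by (intro exI[of _ "min \<delta> \<epsilon>"]) simp
  qed
  then have "W t - W 0 = Z t - Z 0" using t by (simp add: P_def)
  then show "form_integral N \<beta> (F \<circ> x) 0 t = form_integral M (pull_back N F \<beta>) x 0 t"
    by (simp add: form_integral_eq_primitive(2)[OF N Fx t W] form_integral_eq_primitive(2)[OF M x t Z])
  show "form_integrable N \<beta> (F \<circ> x) 0 t" by (rule form_integral_eq_primitive(1)[OF N Fx t W])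
  show "form_integrable M (pull_back N F \<beta>) x 0 t" by (rule form_integral_eq_primitive(1)[OF M x t Z])
qed

section \<open>Maps into Euclidean space\<close>

lemma smooth_manifold_euclidean: "smooth_manifold (euclidean_manifold :: ('f::euclidean_space, 'f) manifold)"
proof -
  have "second_countable (euclidean :: 'f topology)"
  proof -
    obtain B :: "'f set set" where B: "countable B" "topological_basis B"
      using ex_countable_basis by blast
    show ?thesis
      unfolding second_countable_def
    proof (intro exI[of _ B] conjI ballI allI impI)
      show "openin euclidean V" if "V \<in> B" for V
        using topological_basis_open[OF B(2) that] by simp
      show "\<exists>V\<in>B. y \<in> V \<and> V \<subseteq> U" if "openin euclidean U \<and> y \<in> U" for U :: "'f set" and y
        using topological_basisE[OF B(2), of U y] that by (metis open_openin)
    qed (rule B(1))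
  qed
  moreover have "smooth_on (id \<circ> inv_into UNIV id) (UNIV :: 'f set)"
    unfolding smooth_on_def by (simp add: inv_id[unfolded inv_def] o_def Ck_on_linear bounded_linear_ident)
  ultimately show ?thesis
    by (simp add: smooth_manifold_def euclidean_manifold_def)
qed

lemma smooth_near_euclidean_coordinate: "smooth_near euclidean_manifold y (\<lambda>z. z \<bullet> j)"
  by (intro smooth_nearI[of _ UNIV])
    (auto simp: euclidean_manifold_def smooth_on_def Ck_on_linear bounded_linear_inner_left)

lemma differential_coordinate_coord_vector:
  "differential (\<lambda>z. z \<bullet> j) y (coord_vector euclidean_manifold (UNIV, id) i y) = i \<bullet> j"
proof -
  have "frechet_derivative (\<lambda>z. z \<bullet> j) (at y) = (\<lambda>k. k \<bullet> j)"
    by (rule frechet_derivative_at'[OF bounded_linear_imp_has_derivative[OF bounded_linear_inner_left]])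
  then show ?thesis
    by (simp add: differential_def coord_vector_apply smooth_near_euclidean_coordinate)
qed

lemma one_form_differential_coordinate:
  "one_form (euclidean_manifold :: ('f::euclidean_space, 'f) manifold) (differential (\<lambda>z. z \<bullet> j))"
  unfolding one_form_def
proof (intro conjI ballI allI; (clarify)?)
  fix U and \<phi> :: "'f \<Rightarrow> 'f" and i :: 'f
  assume "(U, \<phi>) \<in> atlas (euclidean_manifold :: ('f, 'f) manifold)"
  then have [simp]: "U = UNIV" "\<phi> = id" by (auto simp: euclidean_manifold_def)
  show "smooth_on ((\<lambda>p. differential (\<lambda>z. z \<bullet> j) p (coord_vector euclidean_manifold (U, \<phi>) i p)) \<circ> inv_into U \<phi>) (\<phi> ` U)"
    by (simp add: differential_coordinate_coord_vector o_def smooth_on_const)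
qed (simp_all add: differential_def)

text \<open>The differential of a component of \<open>G\<close> is the pull-back of the corresponding
  constant form, so the general statement applies to it.\<close>

lemma differential_component:
  "differential (\<lambda>p. G p \<bullet> j) = pull_back euclidean_manifold G (differential (\<lambda>z. z \<bullet> j))"
  by (intro ext) (simp add: differential_def pull_back_def push_forward_def smooth_near_euclidean_coordinate o_def)

lemma has_RS_integral_const: "has_RS_integral (\<lambda>s. k) g a b (k * (g b - g a))"
  unfolding has_RS_integral_def
proof (intro allI impI exI[of _ 1] conjI)
  fix \<epsilon> :: real and n :: nat and \<tau> \<xi> :: "nat \<Rightarrow> real" assume "\<epsilon> > 0"
    and \<tau>: "\<tau> 0 = a \<and> \<tau> n = b \<and> (\<forall>i<n. \<tau> i \<le> \<xi> i \<and> \<xi> i \<le> \<tau> (Suc i) \<and> \<tau> (Suc i) - \<tau> i < 1)"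
  have "(\<Sum>i<n. k * (g (\<tau> (Suc i)) - g (\<tau> i))) = k * (g b - g a)"
    using sum_lessThan_telescope[of "\<lambda>i. g (\<tau> i)" n] \<tau> by (simp add: sum_distrib_left[symmetric])
  then show "\<bar>(\<Sum>i<n. k * (g (\<tau> (Suc i)) - g (\<tau> i))) - k * (g b - g a)\<bar> < \<epsilon>" using \<open>\<epsilon> > 0\<close> by simp
qed simp

text \<open>In the identity chart the coefficients of the form are constant, so all Riemann sums telescope
  to the same value.\<close>

lemma has_form_integral_differential_coordinate:
  fixes y :: "real \<Rightarrow> 'f::euclidean_space"
  assumes "a \<le> b" "j \<in> Basis"
  shows "has_form_integral euclidean_manifold (differential (\<lambda>z. z \<bullet> j)) y a b ((y b - y a) \<bullet> j)"
proof -
  let ?J = "\<lambda>i. (i \<bullet> j) * (y b \<bullet> i - y a \<bullet> i)"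
  have "has_chart_integral euclidean_manifold (UNIV, id) (differential (\<lambda>z. z \<bullet> j)) y a b (\<Sum>i\<in>Basis. ?J i)"
    unfolding has_chart_integral_def differential_coordinate_coord_vector snd_conv id_apply
    by (intro exI[of _ ?J] conjI ballI has_RS_integral_const refl)
  moreover have "(\<Sum>i\<in>Basis. ?J i) = (y b - y a) \<bullet> j"
    using assms(2) by (simp add: inner_Basis inner_diff_left if_distrib if_distribR sum.delta cong: if_cong)
  ultimately show ?thesis
    unfolding has_form_integral_def using assms(1)
    by (intro exI[of _ 1] exI[of _ "\<lambda>i. if i = 0 then a else b"] exI[of _ "\<lambda>_. (UNIV, id)"]
        exI[of _ "\<lambda>_. (y b - y a) \<bullet> j"]) (simp add: euclidean_manifold_def)
qed

lemma differential_integral: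
  fixes G :: "'a \<Rightarrow> 'f::euclidean_space"
  assumes M: "smooth_manifold M" and G: "smooth_map M euclidean_manifold G"
    and x: "chart_hoelder M \<alpha> T x" and \<alpha>: "1/2 < \<alpha>" and t: "0 \<le> t" "t \<le> T"
  shows "D_integrable M G x 0 t" "G (x t) = G (x 0) + D_integral M G x 0 t"
proof -
  note E = form_integral_pull_back[OF M smooth_manifold_euclidean G x \<alpha> one_form_differential_coordinate t,
      folded differential_component]
  show "D_integrable M G x 0 t" unfolding D_integrable_def using E(2) by blast
  have "form_integral M (differential (\<lambda>p. G p \<bullet> j)) x 0 t = (G (x t) - G (x 0)) \<bullet> j" if j: "j \<in> Basis" for j
  proof -
    have "form_integral euclidean_manifold (differential (\<lambda>z. z \<bullet> j)) (G \<circ> x) 0 t = ((G \<circ> x) t - (G \<circ> x) 0) \<bullet> j"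
      unfolding form_integral_def
      using E(1)[of j] unfolding form_integrable_def
      by (rule the1_equality) (rule has_form_integral_differential_coordinate[OF t(1) j])
    then show ?thesis using E(3)[of j] by simp
  qed
  then have "D_integral M G x 0 t = (\<Sum>j\<in>Basis. ((G (x t) - G (x 0)) \<bullet> j) *\<^sub>R j)"
    unfolding D_integral_def by (intro sum.cong) auto
  then show "G (x t) = G (x 0) + D_integral M G x 0 t" by (simp add: euclidean_representation)
qed

theorem theorem2p3:
  fixes M :: "('a, 'm::euclidean_space) manifold"
    and N :: "('b, 'n::euclidean_space) manifold"
    and g :: "'a \<Rightarrow> 'a tangent \<Rightarrow> 'a tangent \<Rightarrow> real"
    and h :: "'b \<Rightarrow> 'b tangent \<Rightarrow> 'b tangent \<Rightarrow> real"
    and \<alpha> T :: real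
    and x :: "real \<Rightarrow> 'a"
    and F :: "'a \<Rightarrow> 'b"
  assumes "smooth_manifold M" and "riemannian_metric M g"
    and "smooth_manifold N" and "riemannian_metric N h"
    and "1/2 < \<alpha>" and "\<alpha> \<le> 1" and "0 \<le> T"
    and "x \<in> hoelder_curves M g \<alpha> T"
    and "smooth_map M N F"
  shows "(\<forall>\<beta>. one_form N \<beta> \<longrightarrow> (\<forall>t\<in>{0..T}.
            form_integrable N \<beta> (F \<circ> x) 0 t \<and>
            form_integrable M (pull_back N F \<beta>) x 0 t \<and>
            form_integral N \<beta> (F \<circ> x) 0 t = form_integral M (pull_back N F \<beta>) x 0 t)) \<and>
         (\<forall>G :: 'a \<Rightarrow> 'f::euclidean_space. smooth_map M euclidean_manifold G \<longrightarrow> (\<forall>t\<in>{0..T}.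
            D_integrable M G x 0 t \<and>
            G (x t) = G (x 0) + D_integral M G x 0 t))"
proof -
  have "\<alpha> > 0" using assms(5) by simp
  then have x: "chart_hoelder M \<alpha> T x" using assms by (intro hoelder_curve_chart_hoelder)
  show ?thesis
    using form_integral_pull_back[OF assms(1,3,9) x assms(5)] differential_integral[OF assms(1) _ x assms(5)]
    by auto
qed

end
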